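(* There is an absolute constant $C$ such that for every integer $k\ge 1$ all of the following hold: (a) there exists a (pyramid, prism, wheel)-free graph $G$ with tree-width $2$, hyperbolicity at least $\lceil \frac{k}{2}\rceil-1$ and $ipco(G)\ge k$; (b) there exists a (theta, prism, wheel)-free planar graph $G$ with tree-width at most $3$, hyperbolicity at least $\lceil \frac{k}{2}\rceil-1$ and $ipco(G)\ge k$; (c) there exists a (theta, pyramid, wheel)-free planar graph $G$ with hyperbolicity at least $\lceil \frac{k}{2}\rceil-1$ and $ipco(G)\ge k$; (d) there exists a (prism, pyramid, wheel)-free planar bipartite graph $G$ such that $|V(G)|\le Ck^2$, $G$ has an isometric path cover of size $3k+1$, and, for any $v\in V(G)$, any $v$-rooted isometric path cover of $G$ has cardinality at least $k^2$.
   Context: All graphs are finite, simple, undirected and connected. The length of a path is its number of edges; a path is induced if no two non-consecutive vertices of it are adjacent. A path of $G$ is isometric if it is a shortest path in $G$ between its endpoints. An isometric path is $v$-rooted if $v$ is one of its endpoints. The isometric path complexity $ipco(G)$ is the minimum integer $k$ such that there exists a vertex $v\in V(G)$ satisfying: for every isometric path $P$ of $G$, the vertices of $P$ can be covered by $k$ many $v$-rooted isometric paths of $G$. An isometric path cover of $G$ is a set of isometric paths of $G$ such that each vertex of $G$ belongs to at least one of them; it is $v$-rooted if all its paths are $v$-rooted. With $\mathsf d$ the shortest-path distance, $G$ is $\delta$-hyperbolic if for any four vertices $u,v,x,y$, the two larger of the three sums $\mathsf d(u,v)+\mathsf d(x,y)$, $\mathsf d(u,x)+\mathsf d(v,y)$,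 $\mathsf d(u,y)+\mathsf d(v,x)$ differ by at most $2\delta$; the hyperbolicity of $G$ is the least such $\delta$. A theta is a graph made of three internally vertex-disjoint induced paths $P_1=a\ldots b$, $P_2=a\ldots b$, $P_3=a\ldots b$ of lengths at least $2$, such that no edges exist between the paths except the three edges incident to $a$ and the three edges incident to $b$. A pyramid is a graph made of three induced paths $P_1=a\ldots b_1$, $P_2=a\ldots b_2$, $P_3=a\ldots b_3$ of lengths at least $1$, two of which have lengths at least $2$, vertex-disjoint except at $a$, such that $b_1b_2b_3$ is a triangle and no edges exist between the paths except those of the triangle and the three edges incident to $a$. A prism is a graph made of three vertex-disjoint induced paths $P_1=a_1\ldots b_1$, $P_2=a_2\ldots b_2$, $P_3=a_3\ldots b_3$ of lengths at least $1$, such that $a_1a_2a_3$ and $b_1b_2b_3$ are triangles and no edges exist between the paths except those of the two triangles. A wheel consists of an induced cycle $C$ of order at least $4$ and a vertex $w\notin V(C)$ adjacent to at least three vertices of $C$. A graph is free of a family of such configurations if it has no induced subgraph isomorphic to any member of the family. *)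

theory Defs
  imports "HOL-Analysis.Analysis"
begin

section \<open>Graphs, paths and distances\<close>

record 'a ugraph =
  verts :: "'a set"
  edges :: "'a set set"

definition simple_graph :: "'a ugraph \<Rightarrow> bool" where
  "simple_graph G \<longleftrightarrow> finite (verts G) \<and> (\<forall>e\<in>edges G. e \<subseteq> verts G \<and> card e = 2)"

definition adj :: "'a ugraph \<Rightarrow> 'a \<Rightarrow> 'a \<Rightarrow> bool" where
  "adj G u v \<longleftrightarrow> {u, v} \<in> edges G"

definition induced_subgraph :: "'a ugraph \<Rightarrow> 'a set \<Rightarrow> 'a ugraph" where
  "induced_subgraph G W = \<lparr>verts = W, edges = {e \<in> edges G. e \<subseteq> W}\<rparr>"

text \<open>
  A path is given by the sequence of its vertices; a sequence and its reversal describe the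
  same path. A single vertex is a path of length 0.
\<close>

definition path_edges :: "'a list \<Rightarrow> 'a set set" where
  "path_edges p = {{p ! i, p ! Suc i} | i. Suc i < length p}"

definition path_length :: "'a list \<Rightarrow> nat" where
  "path_length p = length p - 1"

definition is_path :: "'a ugraph \<Rightarrow> 'a list \<Rightarrow> bool" where
  "is_path G p \<longleftrightarrow> p \<noteq> [] \<and> distinct p \<and> set p \<subseteq> verts G \<and> path_edges p \<subseteq> edges G"

definition path_between :: "'a ugraph \<Rightarrow> 'a \<Rightarrow> 'a list \<Rightarrow> 'a \<Rightarrow> bool" where
  "path_between G u p v \<longleftrightarrow> is_path G p \<and> hd p = u \<and> last p = v"

definition induced_path_between :: "'a ugraph \<Rightarrow> 'a \<Rightarrow> 'a list \<Rightarrow> 'a \<Rightarrow> bool" where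
  "induced_path_between G u p v \<longleftrightarrow> path_between G u p v \<and>
     (\<forall>i<length p. \<forall>j<length p. adj G (p ! i) (p ! j) \<longrightarrow> j = Suc i \<or> i = Suc j)"

definition cycle_edges :: "'a list \<Rightarrow> 'a set set" where
  "cycle_edges c = insert {last c, hd c} (path_edges c)"

definition is_cycle :: "'a ugraph \<Rightarrow> 'a list \<Rightarrow> bool" where
  "is_cycle G c \<longleftrightarrow> length c \<ge> 3 \<and> distinct c \<and> set c \<subseteq> verts G \<and> cycle_edges c \<subseteq> edges G"

definition induced_cycle :: "'a ugraph \<Rightarrow> 'a list \<Rightarrow> bool" where
  "induced_cycle G c \<longleftrightarrow> is_cycle G c \<and>
     (\<forall>x\<in>set c. \<forall>y\<in>set c. adj G x y \<longrightarrow> {x, y} \<in> cycle_edges c)"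

definition connected_graph :: "'a ugraph \<Rightarrow> bool" where
  "connected_graph G \<longleftrightarrow> verts G \<noteq> {} \<and>
     (\<forall>u\<in>verts G. \<forall>v\<in>verts G. \<exists>p. path_between G u p v)"

definition gdist :: "'a ugraph \<Rightarrow> 'a \<Rightarrow> 'a \<Rightarrow> nat" where
  "gdist G u v = (LEAST n. \<exists>p. path_between G u p v \<and> path_length p = n)"

section \<open>Isometric paths and isometric path complexity\<close>

definition isometric_path :: "'a ugraph \<Rightarrow> 'a list \<Rightarrow> bool" where
  "isometric_path G p \<longleftrightarrow> is_path G p \<and> path_length p = gdist G (hd p) (last p)"

definition rooted_isometric_path :: "'a ugraph \<Rightarrow> 'a \<Rightarrow> 'a list \<Rightarrow> bool" where
  "rooted_isometric_path G v p \<longleftrightarrow> isometric_path G p \<and> (v = hd p \<or> v = last p)"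

definition ipco :: "'a ugraph \<Rightarrow> nat" where
  "ipco G = (LEAST k. \<exists>v\<in>verts G. \<forall>p. isometric_path G p \<longrightarrow>
     (\<exists>Q. finite Q \<and> card Q \<le> k \<and> (\<forall>q\<in>Q. rooted_isometric_path G v q) \<and>
          set p \<subseteq> (\<Union>q\<in>Q. set q)))"

text \<open>
  The third condition ensures that a path and its reversal are not counted twice in
  the cardinality of a cover.
\<close>

definition isometric_path_cover :: "'a ugraph \<Rightarrow> 'a list set \<Rightarrow> bool" where
  "isometric_path_cover G P \<longleftrightarrow>
     (\<forall>p\<in>P. isometric_path G p) \<and>
     verts G \<subseteq> (\<Union>p\<in>P. set p) \<and>
     (\<forall>p\<in>P. rev p \<in> P \<longrightarrow> rev p = p)"

definition rooted_isometric_path_cover :: "'a ugraph \<Rightarrow> 'a \<Rightarrow> 'a list set \<Rightarrow> bool" where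
  "rooted_isometric_path_cover G v P \<longleftrightarrow>
     isometric_path_cover G P \<and> (\<forall>p\<in>P. rooted_isometric_path G v p)"

section \<open>Hyperbolicity\<close>

definition hyperbolic :: "real \<Rightarrow> 'a ugraph \<Rightarrow> bool" where
  "hyperbolic \<delta> G \<longleftrightarrow>
     (\<forall>u\<in>verts G. \<forall>v\<in>verts G. \<forall>x\<in>verts G. \<forall>y\<in>verts G.
        let s = sort [gdist G u v + gdist G x y,
                      gdist G u x + gdist G v y,
                      gdist G u y + gdist G v x]
        in real (s ! 2) - real (s ! 1) \<le> 2 * \<delta>)"

text \<open>
  For a finite nonempty graph the minimum exists: the admissible values form a closed half-line.
\<close>

definition hyperbolicity :: "'a ugraph \<Rightarrow> real" where
  "hyperbolicity G = (LEAST \<delta>. hyperbolic \<delta> G)"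

section \<open>Tree-width\<close>

definition is_tree :: "'a ugraph \<Rightarrow> bool" where
  "is_tree T \<longleftrightarrow> simple_graph T \<and> connected_graph T \<and> \<not> (\<exists>c. is_cycle T c)"

definition tree_decomposition :: "'a ugraph \<Rightarrow> 'b ugraph \<Rightarrow> ('b \<Rightarrow> 'a set) \<Rightarrow> bool" where
  "tree_decomposition G T bag \<longleftrightarrow> is_tree T \<and>
     (\<Union>t\<in>verts T. bag t) = verts G \<and>
     (\<forall>e\<in>edges G. \<exists>t\<in>verts T. e \<subseteq> bag t) \<and>
     (\<forall>v\<in>verts G. connected_graph (induced_subgraph T {t \<in> verts T. v \<in> bag t}))"

definition decomposition_width :: "'b ugraph \<Rightarrow> ('b \<Rightarrow> 'a set) \<Rightarrow> nat" where
  "decomposition_width T bag = Max ((\<lambda>t. card (bag t)) ` verts T) - 1"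

text \<open>Decomposition trees are finite, so taking their nodes in \<^typ>\<open>nat\<close> loses no generality.\<close>

definition tree_width :: "'a ugraph \<Rightarrow> nat" where
  "tree_width G = (LEAST w. \<exists>(T :: nat ugraph) bag.
     tree_decomposition G T bag \<and> decomposition_width T bag = w)"

section \<open>Planar and bipartite graphs\<close>

text \<open>
  A planar drawing places the vertices injectively and draws every edge as a simple arc joining
  its two ends, such that an arc passes through no other vertex and two distinct arcs
  meet only in common ends.
\<close>

definition planar :: "'a ugraph \<Rightarrow> bool" where
  "planar G \<longleftrightarrow> (\<exists>(f :: 'a \<Rightarrow> complex) (g :: 'a set \<Rightarrow> real \<Rightarrow> complex).
     inj_on f (verts G) \<and>
     (\<forall>e\<in>edges G. arc (g e) \<and> {pathstart (g e), pathfinish (g e)} = f ` e \<and>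
        path_image (g e) \<inter> f ` verts G = f ` e) \<and>
     (\<forall>e\<in>edges G. \<forall>e'\<in>edges G. e \<noteq> e' \<longrightarrow>
        path_image (g e) \<inter> path_image (g e') \<subseteq> f ` (e \<inter> e')))"

definition bipartite :: "'a ugraph \<Rightarrow> bool" where
  "bipartite G \<longleftrightarrow> (\<exists>A B. A \<union> B = verts G \<and> A \<inter> B = {} \<and>
     (\<forall>e\<in>edges G. \<exists>a\<in>A. \<exists>b\<in>B. e = {a, b}))"

section \<open>Thetas, pyramids, prisms and wheels\<close>

text \<open>
  In the first three configurations the condition that there are no further edges between the
  paths is expressed by listing all edges of the graph.
\<close>

definition theta :: "'a ugraph \<Rightarrow> bool" where
  "theta H \<longleftrightarrow> simple_graph H \<and> (\<exists>a b p1 p2 p3.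
     induced_path_between H a p1 b \<and> induced_path_between H a p2 b \<and>
     induced_path_between H a p3 b \<and>
     path_length p1 \<ge> 2 \<and> path_length p2 \<ge> 2 \<and> path_length p3 \<ge> 2 \<and>
     set p1 \<inter> set p2 = {a, b} \<and> set p1 \<inter> set p3 = {a, b} \<and> set p2 \<inter> set p3 = {a, b} \<and>
     verts H = set p1 \<union> set p2 \<union> set p3 \<and>
     edges H = path_edges p1 \<union> path_edges p2 \<union> path_edges p3)"

definition pyramid :: "'a ugraph \<Rightarrow> bool" where
  "pyramid H \<longleftrightarrow> simple_graph H \<and> (\<exists>a b1 b2 b3 p1 p2 p3.
     induced_path_between H a p1 b1 \<and> induced_path_between H a p2 b2 \<and>
     induced_path_between H a p3 b3 \<and>
     path_length p1 \<ge> 1 \<and> path_length p2 \<ge> 1 \<and> path_length p3 \<ge> 1 \<and>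
     (path_length p1 \<ge> 2 \<and> path_length p2 \<ge> 2 \<or>
      path_length p1 \<ge> 2 \<and> path_length p3 \<ge> 2 \<or>
      path_length p2 \<ge> 2 \<and> path_length p3 \<ge> 2) \<and>
     set p1 \<inter> set p2 = {a} \<and> set p1 \<inter> set p3 = {a} \<and> set p2 \<inter> set p3 = {a} \<and>
     verts H = set p1 \<union> set p2 \<union> set p3 \<and>
     edges H = path_edges p1 \<union> path_edges p2 \<union> path_edges p3 \<union>
               {{b1, b2}, {b1, b3}, {b2, b3}})"

definition prism :: "'a ugraph \<Rightarrow> bool" where
  "prism H \<longleftrightarrow> simple_graph H \<and> (\<exists>a1 a2 a3 b1 b2 b3 p1 p2 p3.
     induced_path_between H a1 p1 b1 \<and> induced_path_between H a2 p2 b2 \<and>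
     induced_path_between H a3 p3 b3 \<and>
     path_length p1 \<ge> 1 \<and> path_length p2 \<ge> 1 \<and> path_length p3 \<ge> 1 \<and>
     set p1 \<inter> set p2 = {} \<and> set p1 \<inter> set p3 = {} \<and> set p2 \<inter> set p3 = {} \<and>
     verts H = set p1 \<union> set p2 \<union> set p3 \<and>
     edges H = path_edges p1 \<union> path_edges p2 \<union> path_edges p3 \<union>
               {{a1, a2}, {a1, a3}, {a2, a3}} \<union> {{b1, b2}, {b1, b3}, {b2, b3}})"

definition wheel :: "'a ugraph \<Rightarrow> bool" where
  "wheel H \<longleftrightarrow> simple_graph H \<and> (\<exists>c w.
     induced_cycle H c \<and> length c \<ge> 4 \<and> w \<notin> set c \<and>
     verts H = insert w (set c) \<and> card {x \<in> set c. adj H w x} \<ge> 3)"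

text \<open>
  The four predicates above are invariant under isomorphism, so that an induced subgraph is
  isomorphic to a member of one of these families iff it satisfies the corresponding predicate.
\<close>

definition free_of :: "('a ugraph \<Rightarrow> bool) \<Rightarrow> 'a ugraph \<Rightarrow> bool" where
  "free_of F G \<longleftrightarrow> \<not> (\<exists>W\<subseteq>verts G. F (induced_subgraph G W))"

end

theory Submission
  imports Defs
begin

text \<open>
  All four graphs are doubles: two copies of a graph with a root \<open>r\<close>, glued at \<open>r\<close>. Let
  \<open>f\<close> be the distance to \<open>r\<close> inside one copy, its height. If \<open>v\<close> lies in the other copy (or is
  the root), every path from \<open>v\<close> into the copy runs through \<open>r\<close>, so distances from \<open>v\<close> are
  \<open>f\<close> plus a constant. An isometric path from \<open>v\<close> climbs one unit of height per step there,
  and once it reaches a local maximum of \<open>f\<close> it has to stop: a local maximum met by a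
  \<open>v\<close>-rooted isometric path is its other end (\<open>local_max_is_end\<close>). So every local maximum
  needs a rooted path of its own. Since one of the two copies always lies on the far side of
  \<open>v\<close>, this bounds below, for all \<open>v\<close> at once, the number of rooted paths that cover a given
  isometric path (\<open>ipco_double_ge\<close>) or the whole graph (\<open>rooted_cover_ge\<close>).

  What remains is to find rooted graphs with many local maxima on one isometric path. That a path is
  isometric is certified by a potential: a function that changes by at most one along every edge
  and grows by one at every step of the path. The same path makes the graph far from hyperbolic:
  for the root, the two ends of the path and its middle, the sum of the distances from root to middle and from end to end
  exceeds both other sums by an amount that grows with the path (\<open>hyperbolicity_double_ge\<close>).

  Three families of rooted graphs are used. In a fan, long spokes from the root end on a path, the
  level, on which every edge between consecutive spokes is subdivided once; the subdivision vertices are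
  the local maxima. Fans are bipartite, hence without triangles, and deleting the root of a
  fan with one level leaves a tree, which gives tree-width 2. A fan with \<open>k\<close> levels and \<open>k + 1\<close>
  spokes has \<open>k\<^sup>2\<close> local maxima in each copy, but its double is covered by the \<open>2k\<close> levels and the
  \<open>k + 1\<close> straight lines formed by opposite spokes. In a crown, the end of every
  spoke is replaced by a triangle. This destroys all claws except those at the root, and a theta
  contains two claws; a prism is excluded because two vertices separate any two
  triangles. In a ladder, a chain of triangles takes the place
  of the root as the hub of the spokes, so that no claw is left, and neither thetas nor
  pyramids exist. The price is that moving along the top of the ladder costs something, which is
  compensated by making the bottom path slower still.

  Wheels are excluded by a local test (\<open>wheel_free_local\<close>), planarity is shown by drawing the graphs
  in levels (\<open>planar_level_drawing\<close>), and tree decompositions are built from parent functions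
  (\<open>tree_decomposition_by_parents\<close>).
\<close>

section \<open>Paths, distances and potentials\<close>

lemma adj_sym: "adj G u v \<longleftrightarrow> adj G v u"
  by (simp add: adj_def insert_commute)

lemma adj_verts:
  assumes "simple_graph G" "adj G u v"
  shows "u \<in> verts G" "v \<in> verts G" "u \<noteq> v"
  using assms unfolding simple_graph_def adj_def by fastforce+

lemma is_path_iff:
  "is_path G p \<longleftrightarrow> p \<noteq> [] \<and> distinct p \<and> set p \<subseteq> verts G \<and>
     (\<forall>i. Suc i < length p \<longrightarrow> adj G (p ! i) (p ! Suc i))"
  unfolding is_path_def path_edges_def adj_def by blast

lemma path_edges_rev: "path_edges (rev p) = path_edges p"
proof -
  have *: "path_edges (rev q) \<subseteq> path_edges q" for q :: "'a list"
  proof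
    fix e assume "e \<in> path_edges (rev q)"
    then obtain i where i: "Suc i < length q" "e = {rev q ! i, rev q ! Suc i}"
      unfolding path_edges_def by auto
    let ?j = "length q - Suc (Suc i)"
    have "rev q ! i = q ! Suc ?j" "rev q ! Suc i = q ! ?j" "Suc ?j < length q"
      using i(1) by (auto simp: rev_nth Suc_diff_Suc)
    then show "e \<in> path_edges q"
      unfolding path_edges_def i(2) by (auto simp: insert_commute)
  qed
  show ?thesis using *[of p] *[of "rev p"] by auto
qed

lemma path_between_rev: "path_between G u p v \<Longrightarrow> path_between G v (rev p) u"
  unfolding path_between_def is_path_def by (simp add: path_edges_rev hd_rev last_rev)

lemma path_length_rev [simp]: "path_length (rev p) = path_length p"
  by (simp add: path_length_def)

lemma path_between_take:
  assumes "path_between G u p v" "i < length p"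
  shows "path_between G u (take (Suc i) p) (p ! i)"
proof -
  have "set (take (Suc i) p) \<subseteq> set p" by (rule set_take_subset)
  moreover have "last (take (Suc i) p) = p ! i"
    using assms(2) by (simp add: take_Suc_conv_app_nth)
  moreover have "p \<noteq> []" using assms(2) by auto
  ultimately show ?thesis
    using assms unfolding path_between_def is_path_iff by auto
qed

text \<open>
  Appending a vertex to a path may close a cycle, hence only an upper bound for the new length:
  if the vertex already lies on the path, the part of the path behind it is dropped.
\<close>

lemma path_between_extend:
  assumes p: "path_between G u p y" and a: "adj G y z" and z: "z \<in> verts G"
  obtains q where "path_between G u q z" "path_length q \<le> Suc (path_length p)"
proof (cases "z \<in> set p")
  case True
  then obtain i where i: "i < length p" "p ! i = z" by (auto simp: in_set_conv_nth)
  show ?thesis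
    using path_between_take[OF p i(1)] i that[of "take (Suc i) p"] by (simp add: path_length_def)
next
  case False
  have ne: "p \<noteq> []" and last: "p ! (length p - 1) = y"
    using p unfolding path_between_def is_path_iff by (auto simp: last_conv_nth)
  have "adj G ((p @ [z]) ! i) ((p @ [z]) ! Suc i)" if "Suc i < length (p @ [z])" for i
  proof (cases "Suc i < length p")
    case True
    then show ?thesis using p unfolding path_between_def is_path_iff by (simp add: nth_append)
  next
    case False
    then have "i = length p - 1" "i < length p" using that ne by auto
    then show ?thesis using a last ne by (simp add: nth_append)
  qed
  then have "path_between G u (p @ [z]) z"
    using p False z ne unfolding path_between_def is_path_iff by auto
  then show ?thesis using that[of "p @ [z]"] ne by (simp add: path_length_def)
qed

lemma path_of_reachable:
  assumes "simple_graph G" "u \<in> verts G" "(adj G)\<^sup>*\<^sup>* u v"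
  obtains p where "path_between G u p v"
proof -
  have "\<exists>p. path_between G u p v" using assms(3)
  proof (induction rule: rtranclp_induct)
    case base
    have "path_between G u [u] u" using assms(2) by (simp add: path_between_def is_path_iff)
    then show ?case ..
  next
    case (step y z)
    then obtain p where "path_between G u p y" by blast
    then show ?case
      using path_between_extend[of G u p y z] adj_verts[OF assms(1)] step.hyps(2) by metis
  qed
  then show ?thesis using that by blast
qed

lemma reachable_of_path:
  assumes "path_between G u p v"
  shows "(adj G)\<^sup>*\<^sup>* u v"
proof -
  have "(adj G)\<^sup>*\<^sup>* (p ! 0) (p ! i)" if "i < length p" for i
    using that
  proof (induction i)
    case (Suc i)
    have "adj G (p ! i) (p ! Suc i)"
      using assms Suc.prems unfolding path_between_def is_path_iff by auto
    with Suc show ?case by (auto intro: rtranclp.rtrancl_into_rtrancl)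
  qed simp
  moreover have "p \<noteq> []" "hd p = u" "last p = v"
    using assms unfolding path_between_def is_path_def by auto
  ultimately show ?thesis
    by (metis diff_less hd_conv_nth last_conv_nth length_greater_0_conv zero_less_one)
qed

lemma gdist_le: "path_between G u p v \<Longrightarrow> gdist G u v \<le> path_length p"
  unfolding gdist_def by (rule Least_le) blast

locale conn_graph =
  fixes G :: "'a ugraph"
  assumes simple: "simple_graph G" and connected: "connected_graph G"
begin

lemma shortest_path:
  assumes "u \<in> verts G" "v \<in> verts G"
  obtains p where "path_between G u p v" "path_length p = gdist G u v"
proof -
  have "\<exists>n p. path_between G u p v \<and> path_length p = n"
    using connected assms unfolding connected_graph_def by blast
  then have "\<exists>p. path_between G u p v \<and> path_length p = gdist G u v"
    unfolding gdist_def by (rule LeastI_ex)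
  then show ?thesis using that by blast
qed

lemma gdist_adj_le:
  assumes "v \<in> verts G" "adj G y z"
  shows "gdist G v z \<le> gdist G v y + 1"
proof -
  note yz = adj_verts[OF simple assms(2)]
  obtain p where p: "path_between G v p y" "path_length p = gdist G v y"
    using shortest_path assms(1) yz(1) by blast
  obtain q where "path_between G v q z" "path_length q \<le> Suc (path_length p)"
    using path_between_extend[OF p(1) assms(2) yz(2)] by blast
  with p(2) gdist_le[of G v q z] show ?thesis by simp
qed

lemma gdist_self [simp]: "v \<in> verts G \<Longrightarrow> gdist G v v = 0"
  using gdist_le[of G v "[v]" v] by (simp add: path_between_def is_path_iff path_length_def)

lemma gdist_sym:
  assumes "u \<in> verts G" "v \<in> verts G" shows "gdist G u v = gdist G v u"
proof -
  have "gdist G b a \<le> gdist G a b" if "a \<in> verts G" "b \<in> verts G" for a b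
    using shortest_path[OF that] path_between_rev gdist_le path_length_rev by metis
  then show ?thesis using assms by (simp add: eq_iff)
qed

lemma path_nth_potential:
  fixes \<phi> :: "'a \<Rightarrow> int"
  assumes "\<And>x y. adj G x y \<Longrightarrow> \<phi> y \<le> \<phi> x + 1" "is_path G p" "i < length p"
  shows "\<phi> (p ! i) \<le> \<phi> (hd p) + int i"
  using assms(3)
proof (induction i)
  case 0 then show ?case by (simp add: hd_conv_nth)
next
  case (Suc i)
  then show ?case using assms(1)[of "p ! i" "p ! Suc i"] assms(2) unfolding is_path_iff by force
qed

text \<open>
  A function that grows by at most one along every edge cannot grow faster than the distance.
  This is how all lower bounds for distances are obtained; no path is ever analysed.
\<close>

lemma gdist_ge_potential:
  fixes \<phi> :: "'a \<Rightarrow> int"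
  assumes "\<And>x y. adj G x y \<Longrightarrow> \<phi> y \<le> \<phi> x + 1" "u \<in> verts G" "v \<in> verts G"
  shows "\<phi> v - \<phi> u \<le> int (gdist G u v)"
proof -
  obtain p where p: "path_between G u p v" "path_length p = gdist G u v"
    using shortest_path assms(2,3) by blast
  then have "is_path G p" "p \<noteq> []" "hd p = u" "p ! (length p - 1) = v"
    unfolding path_between_def is_path_def by (auto simp: last_conv_nth)
  then show ?thesis
    using path_nth_potential[of \<phi> p "length p - 1", OF assms(1)] p(2)
    by (simp add: path_length_def)
qed

text \<open>
  The potential certifies at once that the walk has no repetition and that no path between its
  ends is shorter.
\<close>

lemma isometric_by_potential:
  fixes \<phi> :: "'a \<Rightarrow> int"
  assumes lip: "\<And>x y. adj G x y \<Longrightarrow> \<phi> y \<le> \<phi> x + 1"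
    and p: "p \<noteq> []" "set p \<subseteq> verts G" "\<And>i. Suc i < length p \<Longrightarrow> adj G (p ! i) (p ! Suc i)"
    and pot: "\<And>i. i < length p \<Longrightarrow> \<phi> (p ! i) = \<phi> (hd p) + int i"
  shows "isometric_path G p"
proof -
  have "distinct p"
    unfolding distinct_conv_nth using pot by (metis add_left_imp_eq of_nat_eq_iff)
  then have path: "is_path G p" using p unfolding is_path_iff by blast
  have e: "hd p \<in> verts G" "last p \<in> verts G" using p by auto
  have "int (path_length p) = \<phi> (last p) - \<phi> (hd p)"
    using pot[of "length p - 1"] p(1) by (simp add: last_conv_nth path_length_def)
  also have "\<dots> \<le> int (gdist G (hd p) (last p))" by (rule gdist_ge_potential[OF lip e])
  finally have "path_length p \<le> gdist G (hd p) (last p)" by simp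
  moreover have "gdist G (hd p) (last p) \<le> path_length p"
    using path by (intro gdist_le) (simp add: path_between_def)
  ultimately show ?thesis using path unfolding isometric_path_def by simp
qed

text \<open>
  A shortcut to an inner vertex of an isometric path would give a shortcut between its ends.
\<close>

lemma isometric_nth:
  assumes "isometric_path G p" "i < length p"
  shows "gdist G (hd p) (p ! i) = i"
proof -
  have path: "is_path G p" and len: "path_length p = gdist G (hd p) (last p)"
    using assms(1) unfolding isometric_path_def by auto
  have hd: "hd p \<in> verts G" and pb: "path_between G (hd p) p (last p)"
    using path unfolding is_path_def path_between_def by auto
  have le: "gdist G (hd p) (p ! i) \<le> i"
    using gdist_le[OF path_between_take[OF pb assms(2)]] assms(2) by (simp add: path_length_def)
  have "gdist G (hd p) (p ! j) \<le> gdist G (hd p) (p ! i) + (j - i)" if "i \<le> j" "j < length p" for j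
    using that
  proof (induction j rule: dec_induct)
    case (step j)
    have "adj G (p ! j) (p ! Suc j)" using step.prems path unfolding is_path_iff by simp
    then show ?case using step gdist_adj_le[OF hd, of "p ! j" "p ! Suc j"] by simp
  qed simp
  from this[of "length p - 1"] assms(2)
  have "path_length p \<le> gdist G (hd p) (p ! i) + (length p - 1 - i)"
    using len by (cases p) (auto simp: last_conv_nth)
  with le assms(2) show ?thesis by (simp add: path_length_def)
qed

lemma isometric_rev:
  assumes "isometric_path G p" shows "isometric_path G (rev p)"
proof -
  have p: "is_path G p" "path_length p = gdist G (hd p) (last p)"
    using assms unfolding isometric_path_def by auto
  then have "hd p \<in> verts G" "last p \<in> verts G" "p \<noteq> []" unfolding is_path_def by auto
  then show ?thesis
    using p gdist_sym[of "hd p" "last p"] path_between_rev[of G "hd p" p "last p"]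
    unfolding isometric_path_def by (simp add: path_between_def hd_rev last_rev)
qed

text \<open>
  Along an isometric path that starts in \<open>v\<close> the distance to \<open>v\<close> grows by one in every step, so
  a vertex without a neighbour further away from \<open>v\<close> can only be the last one.
\<close>

lemma rooted_path_ends_at_local_max:
  assumes q: "rooted_isometric_path G v q" and s: "s \<in> set q" "s \<noteq> v"
    and max: "\<And>u. adj G s u \<Longrightarrow> gdist G v u \<le> gdist G v s"
  shows "{hd q, last q} = {v, s}"
proof -
  have *: "last p = s" if p: "isometric_path G p" "hd p = v" "s \<in> set p" for p
  proof -
    obtain i where i: "i < length p" "p ! i = s" using p(3) by (auto simp: in_set_conv_nth)
    have "\<not> Suc i < length p"
    proof
      assume l: "Suc i < length p"
      then have "adj G s (p ! Suc i)" using p(1) i unfolding isometric_path_def is_path_iff by auto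
      from max[OF this] isometric_nth[OF p(1) l] isometric_nth[OF p(1) i(1)] p(2) i(2)
      show False by simp
    qed
    then have "i = length p - 1" using i by simp
    then show ?thesis using i by (metis last_conv_nth length_greater_0_conv less_nat_zero_code list.size(3))
  qed
  from q consider "isometric_path G q" "hd q = v" | "isometric_path G q" "last q = v"
    unfolding rooted_isometric_path_def by auto
  then show ?thesis
  proof cases
    case 1 then show ?thesis using *[OF 1] s by auto
  next
    case 2
    have "q \<noteq> []" using s by auto
    then show ?thesis using *[of "rev q"] isometric_rev[OF 2(1)] 2 s by (auto simp: hd_rev last_rev)
  qed
qed

lemma ex_rooted_path:
  assumes "v \<in> verts G" "x \<in> verts G"
  obtains q where "rooted_isometric_path G v q" "x \<in> set q"
proof -
  obtain p where p: "path_between G v p x" "path_length p = gdist G v x"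
    using shortest_path assms by blast
  then have "rooted_isometric_path G v p" "x \<in> set p"
    unfolding rooted_isometric_path_def isometric_path_def path_between_def is_path_def by auto
  then show ?thesis using that by blast
qed

text \<open>
  If no rooted path contains two vertices of \<open>S\<close>, then a cover of \<open>p\<close> needs one path for every
  vertex of \<open>S\<close>. Covering each vertex by a rooted path of its own shows that the
  minimum in the definition of \<open>ipco\<close> is attained.
\<close>

lemma ipco_ge:
  assumes "\<And>v. v \<in> verts G \<Longrightarrow> \<exists>p S. isometric_path G p \<and> finite S \<and> S \<subseteq> set p \<and> k \<le> card S \<and>
      (\<forall>q. rooted_isometric_path G v q \<longrightarrow> card (S \<inter> set q) \<le> 1)"
  shows "k \<le> ipco G"
proof -
  let ?P = "\<lambda>k. \<exists>v\<in>verts G. \<forall>p. isometric_path G p \<longrightarrow>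
     (\<exists>Q. finite Q \<and> card Q \<le> k \<and> (\<forall>q\<in>Q. rooted_isometric_path G v q) \<and> set p \<subseteq> (\<Union>q\<in>Q. set q))"
  have "?P (card (verts G))"
  proof -
    have fin: "finite (verts G)" using simple unfolding simple_graph_def by simp
    obtain v where v: "v \<in> verts G" using connected unfolding connected_graph_def by blast
    then have "\<forall>x\<in>verts G. \<exists>q. rooted_isometric_path G v q \<and> x \<in> set q"
      using ex_rooted_path by metis
    then obtain q where q: "\<And>x. x \<in> verts G \<Longrightarrow> rooted_isometric_path G v (q x) \<and> x \<in> set (q x)"
      by metis
    have "set p \<subseteq> (\<Union>r\<in>q ` verts G. set r)" if "isometric_path G p" for p
      using q that unfolding isometric_path_def is_path_def by fastforce
    then show ?thesis
      using v fin q by (intro bexI[of _ v] allI impI exI[of _ "q ` verts G"]) (auto simp: card_image_le)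
  qed
  then have "?P (ipco G)" unfolding ipco_def by (rule LeastI)
  then obtain v where v: "v \<in> verts G" and cov: "\<And>p. isometric_path G p \<Longrightarrow>
     \<exists>Q. finite Q \<and> card Q \<le> ipco G \<and> (\<forall>q\<in>Q. rooted_isometric_path G v q) \<and> set p \<subseteq> (\<Union>q\<in>Q. set q)"
    by blast
  obtain p S where p: "isometric_path G p" "S \<subseteq> set p" "k \<le> card S"
    and S: "\<And>q. rooted_isometric_path G v q \<Longrightarrow> card (S \<inter> set q) \<le> 1"
    using assms[OF v] by blast
  obtain Q where Q: "finite Q" "card Q \<le> ipco G" "\<And>q. q \<in> Q \<Longrightarrow> rooted_isometric_path G v q"
    "set p \<subseteq> (\<Union>q\<in>Q. set q)" using cov[OF p(1)] by blast
  have "S = (\<Union>q\<in>Q. S \<inter> set q)" using Q(4) p(2) by auto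
  then have "card S \<le> (\<Sum>q\<in>Q. card (S \<inter> set q))" using card_UN_le[OF Q(1)] by metis
  also have "\<dots> \<le> (\<Sum>q\<in>Q. 1)" using S Q(3) by (intro sum_mono) blast
  finally show ?thesis using p(3) Q(2) by simp
qed

text \<open>
  The admissible values of \<open>\<delta>\<close> form the half-line that starts at half of the largest gap between
  the two largest sums, which identifies the hyperbolicity as a maximum over quadruples.
\<close>

lemma hyperbolicity_ge:
  assumes V: "u \<in> verts G" "v \<in> verts G" "x \<in> verts G" "y \<in> verts G"
    and le: "gdist G u x + gdist G v y + d \<le> gdist G u v + gdist G x y"
      "gdist G u y + gdist G v x + d \<le> gdist G u v + gdist G x y"
  shows "real d / 2 \<le> hyperbolicity G"
proof -
  define gap where "gap = (\<lambda>(u, v, x, y).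
    let s = sort [gdist G u v + gdist G x y, gdist G u x + gdist G v y, gdist G u y + gdist G v x]
    in real (s ! 2) - real (s ! 1))"
  define Q where "Q = verts G \<times> verts G \<times> verts G \<times> verts G"
  have fin: "finite Q" and mem: "(u, v, x, y) \<in> Q"
    using simple V unfolding Q_def simple_graph_def by auto
  have hyp: "hyperbolic \<delta> G \<longleftrightarrow> Max (gap ` Q) / 2 \<le> \<delta>" for \<delta>
  proof -
    have "hyperbolic \<delta> G \<longleftrightarrow> (\<forall>t\<in>Q. gap t \<le> 2 * \<delta>)"
      unfolding hyperbolic_def Q_def gap_def by auto
    also have "\<dots> \<longleftrightarrow> Max (gap ` Q) \<le> 2 * \<delta>"
      using fin mem by (subst Max_le_iff) auto
    finally show ?thesis by auto
  qed
  have "hyperbolicity G = Max (gap ` Q) / 2"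
    unfolding hyperbolicity_def hyp by (rule Least_equality) auto
  moreover have "real d \<le> gap (u, v, x, y)"
    using le unfolding gap_def by (auto simp: Let_def)
  moreover have "gap (u, v, x, y) \<le> Max (gap ` Q)" using fin mem by (intro Max_ge) auto
  ultimately show ?thesis by simp
qed

end

section \<open>Thetas, pyramids, prisms and wheels\<close>

lemma simple_induced:
  assumes "simple_graph G" "W \<subseteq> verts G" shows "simple_graph (induced_subgraph G W)"
  using assms finite_subset unfolding simple_graph_def induced_subgraph_def by auto

lemma adj_induced: "adj (induced_subgraph G W) u v \<longleftrightarrow> adj G u v \<and> u \<in> W \<and> v \<in> W"
  by (auto simp: adj_def induced_subgraph_def)

text \<open>
  A claw is an induced star with three leaves; only its centre matters here.
\<close>

definition claw_at :: "'a ugraph \<Rightarrow> 'a \<Rightarrow> bool" where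
  "claw_at G a \<longleftrightarrow> (\<exists>x y z. adj G a x \<and> adj G a y \<and> adj G a z \<and> x \<noteq> y \<and> x \<noteq> z \<and> y \<noteq> z \<and>
     \<not> adj G x y \<and> \<not> adj G x z \<and> \<not> adj G y z)"

lemma claw_at_induced: "claw_at (induced_subgraph G W) a \<Longrightarrow> claw_at G a"
  unfolding claw_at_def adj_induced by blast

lemma path_edges_subset: "e \<in> path_edges p \<Longrightarrow> e \<subseteq> set p"
  unfolding path_edges_def by auto

lemma path_second:
  assumes "path_between G a p b" "1 \<le> path_length p"
  shows "p ! 1 \<in> set p" "p ! 1 \<noteq> a" "adj G a (p ! 1)" "2 \<le> path_length p \<Longrightarrow> p ! 1 \<noteq> b"
    "path_length p = 1 \<Longrightarrow> p ! 1 = b"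
proof -
  have p: "p \<noteq> []" "distinct p" "p ! 0 = a" "p ! (length p - 1) = b" "1 < length p"
    "\<And>i. Suc i < length p \<Longrightarrow> adj G (p ! i) (p ! Suc i)"
    using assms unfolding path_between_def is_path_iff path_length_def
    by (auto simp: hd_conv_nth last_conv_nth)
  show "p ! 1 \<in> set p" using p by auto
  show "p ! 1 \<noteq> a" using p nth_eq_iff_index_eq[OF p(2), of 1 0] by auto
  show "adj G a (p ! 1)" using p(6)[of 0] p by simp
  show "p ! 1 \<noteq> b" if "2 \<le> path_length p"
    using that p nth_eq_iff_index_eq[OF p(2), of 1 "length p - 1"] by (auto simp: path_length_def)
  show "p ! 1 = b" if "path_length p = 1"
    using that p by (simp add: path_length_def)
qed

lemma path_ends_neq:
  assumes "path_between G a p b" "1 \<le> path_length p"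
  shows "a \<noteq> b"
proof -
  obtain xs where "p = a # xs" "xs \<noteq> []"
    using assms unfolding path_between_def is_path_def path_length_def
    by (cases p) (auto simp: Suc_le_eq)
  then show ?thesis using assms(1) last_in_set[of xs] unfolding path_between_def is_path_def by auto
qed

text \<open>
  The second vertices of three paths from \<open>a\<close> are the leaves of the claw. The set \<open>F\<close> collects the
  edges outside the paths: none for a theta, the triangle for a pyramid.
\<close>

lemma claw_of_three_paths:
  assumes p: "path_between H a p1 c1" "path_between H a p2 c2" "path_between H a p3 c3"
    and len: "1 \<le> path_length p1" "1 \<le> path_length p2" "1 \<le> path_length p3"
    and avoid: "p1 ! 1 \<notin> set p2" "p1 ! 1 \<notin> set p3" "p2 ! 1 \<notin> set p1" "p2 ! 1 \<notin> set p3"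
      "p3 ! 1 \<notin> set p1" "p3 ! 1 \<notin> set p2"
    and edges: "edges H \<subseteq> path_edges p1 \<union> path_edges p2 \<union> path_edges p3 \<union> F"
    and F: "{p1 ! 1, p2 ! 1} \<notin> F" "{p1 ! 1, p3 ! 1} \<notin> F" "{p2 ! 1, p3 ! 1} \<notin> F"
  shows "claw_at H a"
proof -
  note s = path_second[OF p(1) len(1)] path_second[OF p(2) len(2)] path_second[OF p(3) len(3)]
  have "\<not> adj H (p1 ! 1) (p2 ! 1)" "\<not> adj H (p1 ! 1) (p3 ! 1)" "\<not> adj H (p2 ! 1) (p3 ! 1)"
    unfolding adj_def using edges F avoid
      path_edges_subset[of "{_, _}" p1] path_edges_subset[of "{_, _}" p2]
      path_edges_subset[of "{_, _}" p3] by blast+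
  then show ?thesis unfolding claw_at_def using s avoid by metis
qed

text \<open>
  Both branch vertices of a theta are centres of claws; reversing the three paths exchanges them.
\<close>

lemma theta_claws:
  assumes "theta H"
  obtains a b where "a \<noteq> b" "claw_at H a" "claw_at H b"
proof -
  obtain a b p1 p2 p3 where p: "path_between H a p1 b" "path_between H a p2 b" "path_between H a p3 b"
    and len: "path_length p1 \<ge> 2" "path_length p2 \<ge> 2" "path_length p3 \<ge> 2"
    and int: "set p1 \<inter> set p2 = {a, b}" "set p1 \<inter> set p3 = {a, b}" "set p2 \<inter> set p3 = {a, b}"
    and edges: "edges H = path_edges p1 \<union> path_edges p2 \<union> path_edges p3"
    using assms unfolding theta_def induced_path_between_def
    by (elim conjE exE) (rule that; assumption)
  have *: "claw_at H c" if "path_between H c q1 d" "path_between H c q2 d" "path_between H c q3 d"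
    "path_length q1 \<ge> 2" "path_length q2 \<ge> 2" "path_length q3 \<ge> 2"
    "set q1 \<inter> set q2 = {c, d}" "set q1 \<inter> set q3 = {c, d}" "set q2 \<inter> set q3 = {c, d}"
    "edges H = path_edges q1 \<union> path_edges q2 \<union> path_edges q3" for c d q1 q2 q3
  proof (rule claw_of_three_paths[OF that(1-3), where F = "{}"])
    have len: "1 \<le> path_length q1" "1 \<le> path_length q2" "1 \<le> path_length q3"
      using that(4-6) by auto
    then show "1 \<le> path_length q1" "1 \<le> path_length q2" "1 \<le> path_length q3" .
    note s = path_second[OF that(1) len(1)] path_second[OF that(2) len(2)] path_second[OF that(3) len(3)]
    show "q1 ! 1 \<notin> set q2" "q1 ! 1 \<notin> set q3" "q2 ! 1 \<notin> set q1" "q2 ! 1 \<notin> set q3"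
      "q3 ! 1 \<notin> set q1" "q3 ! 1 \<notin> set q2" using s(1,2,4,6,7,9,11,12,14) that(4-9) by blast+
  qed (use that(10) in auto)
  have "a \<noteq> b" using path_ends_neq[OF p(1)] len(1) by simp
  moreover have "claw_at H a" using *[OF p len int edges] .
  moreover have "claw_at H b"
    using *[OF p[THEN path_between_rev]] len int edges by (simp add: path_edges_rev insert_commute)
  ultimately show ?thesis using that by blast
qed

lemma theta_free_if_one_claw:
  assumes "\<And>a. claw_at G a \<Longrightarrow> a = r"
  shows "free_of theta G"
  unfolding free_of_def using theta_claws claw_at_induced assms by metis

text \<open>
  The apex of a pyramid is the centre of a claw: at most one of the three paths has length 1, so
  no triangle edge joins two neighbours of the apex.
\<close>

lemma pyramid_claw:
  assumes "pyramid H"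
  obtains a where "claw_at H a"
proof -
  obtain a b1 b2 b3 p1 p2 p3 where
    p: "path_between H a p1 b1" "path_between H a p2 b2" "path_between H a p3 b3"
    and len: "path_length p1 \<ge> 1" "path_length p2 \<ge> 1" "path_length p3 \<ge> 1"
      "path_length p1 \<ge> 2 \<and> path_length p2 \<ge> 2 \<or> path_length p1 \<ge> 2 \<and> path_length p3 \<ge> 2 \<or>
       path_length p2 \<ge> 2 \<and> path_length p3 \<ge> 2"
    and int: "set p1 \<inter> set p2 = {a}" "set p1 \<inter> set p3 = {a}" "set p2 \<inter> set p3 = {a}"
    and edges: "edges H = path_edges p1 \<union> path_edges p2 \<union> path_edges p3 \<union>
               {{b1, b2}, {b1, b3}, {b2, b3}}"
    using assms unfolding pyramid_def induced_path_between_def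
    by (elim conjE exE) (rule that; assumption)
  note s = path_second[OF p(1) len(1)] path_second[OF p(2) len(2)] path_second[OF p(3) len(3)]
  have b: "b1 \<in> set p1" "b2 \<in> set p2" "b3 \<in> set p3"
    using p unfolding path_between_def is_path_def by auto
  have "claw_at H a"
  proof (rule claw_of_three_paths[OF p len(1-3)])
    show "p1 ! 1 \<notin> set p2" "p1 ! 1 \<notin> set p3" "p2 ! 1 \<notin> set p1" "p2 ! 1 \<notin> set p3"
      "p3 ! 1 \<notin> set p1" "p3 ! 1 \<notin> set p2" using s int by blast+
    then have e: "p1 ! 1 \<notin> {b2, b3}" "p2 ! 1 \<notin> {b1, b3}" "p3 ! 1 \<notin> {b1, b2}" using b by blast+
    have "p1 ! 1 \<noteq> b1 \<and> p2 ! 1 \<noteq> b2 \<or> p1 ! 1 \<noteq> b1 \<and> p3 ! 1 \<noteq> b3 \<or> p2 ! 1 \<noteq> b2 \<and> p3 ! 1 \<noteq> b3"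
      using s(4,9,14) len(4) by blast
    with e show "{p1 ! 1, p2 ! 1} \<notin> {{b1, b2}, {b1, b3}, {b2, b3}}"
      "{p1 ! 1, p3 ! 1} \<notin> {{b1, b2}, {b1, b3}, {b2, b3}}"
      "{p2 ! 1, p3 ! 1} \<notin> {{b1, b2}, {b1, b3}, {b2, b3}}"
      by (simp_all add: doubleton_eq_iff) blast+
  qed (simp add: edges)
  then show ?thesis using that by blast
qed

lemma pyramid_free_if_claw_free:
  assumes "\<And>a. \<not> claw_at G a" shows "free_of pyramid G"
  unfolding free_of_def using pyramid_claw claw_at_induced assms by metis

lemma triangle_in_pyramid:
  assumes "pyramid H" obtains x y z where "adj H x y" "adj H x z" "adj H y z"
proof -
  obtain b1 b2 b3 p1 p2 p3 where "edges H = path_edges p1 \<union> path_edges p2 \<union> path_edges p3 \<union>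
      {{b1, b2}, {b1, b3}, {b2, b3}}"
    using assms unfolding pyramid_def by (elim conjE exE) (rule that; assumption)
  then show ?thesis using that[of b1 b2 b3] unfolding adj_def by simp
qed

lemma two_colouring_no_triangle:
  fixes c :: "'a \<Rightarrow> bool"
  assumes "\<And>x y. adj G x y \<Longrightarrow> c x \<noteq> c y"
  shows "\<not> (adj G x y \<and> adj G x z \<and> adj G y z)"
  using assms by metis

lemma pyramid_free_if_two_coloured:
  fixes c :: "'a \<Rightarrow> bool"
  assumes "\<And>x y. adj G x y \<Longrightarrow> c x \<noteq> c y"
  shows "free_of pyramid G"
  unfolding free_of_def
  using triangle_in_pyramid two_colouring_no_triangle[of G c, OF assms] adj_induced by metis

lemma path_meets_cut:
  assumes p: "path_between G a p b" and ab: "a \<in> X \<longleftrightarrow> b \<notin> X"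
    and cut: "\<And>u v. adj G u v \<Longrightarrow> u \<in> X \<Longrightarrow> v \<notin> X \<Longrightarrow> u \<in> Z \<or> v \<in> Z"
  shows "set p \<inter> Z \<noteq> {}"
proof
  assume Z: "set p \<inter> Z = {}"
  have P: "p \<noteq> []" "p ! 0 = a" "p ! (length p - 1) = b" and
    adj: "\<And>i. Suc i < length p \<Longrightarrow> adj G (p ! i) (p ! Suc i)"
    using p unfolding path_between_def is_path_iff by (auto simp: hd_conv_nth last_conv_nth)
  have "p ! i \<in> X \<longleftrightarrow> a \<in> X" if "i < length p" for i
    using that
  proof (induction i)
    case (Suc i)
    have "p ! i \<notin> Z" "p ! Suc i \<notin> Z" using Z Suc.prems by (meson disjoint_iff nth_mem Suc_lessD)+
    then show ?case
      using Suc adj[OF Suc.prems] cut[of "p ! i" "p ! Suc i"] cut[of "p ! Suc i" "p ! i"]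
        adj_sym[of G] by auto
  qed (simp add: P)
  from this[of "length p - 1"] P ab show False by auto
qed

text \<open>
  The three disjoint paths of a prism join its two triangles. If some set \<open>X\<close> separates the
  triangles and all edges that leave \<open>X\<close> are hit by two vertices, each path
  needs one of the two vertices.
\<close>

lemma prism_free_if_two_cuts:
  assumes cut: "\<And>a1 a2 a3 b1 b2 b3.
      \<lbrakk>adj G a1 a2; adj G a1 a3; adj G a2 a3; adj G b1 b2; adj G b1 b3; adj G b2 b3;
       {a1, a2, a3} \<inter> {b1, b2, b3} = {}\<rbrakk> \<Longrightarrow>
     \<exists>X z z'. (\<forall>a\<in>{a1, a2, a3}. \<forall>b\<in>{b1, b2, b3}. a \<in> X \<longleftrightarrow> b \<notin> X) \<and>
       (\<forall>u v. adj G u v \<longrightarrow> u \<in> X \<longrightarrow> v \<notin> X \<longrightarrow> u \<in> {z, z'} \<or> v \<in> {z, z'})"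
  shows "free_of prism G"
  unfolding free_of_def
proof safe
  fix W assume W: "W \<subseteq> verts G" and "prism (induced_subgraph G W)"
  then obtain a1 a2 a3 b1 b2 b3 p1 p2 p3 where
    p: "path_between (induced_subgraph G W) a1 p1 b1" "path_between (induced_subgraph G W) a2 p2 b2"
       "path_between (induced_subgraph G W) a3 p3 b3"
    and len: "path_length p1 \<ge> 1" "path_length p2 \<ge> 1" "path_length p3 \<ge> 1"
    and int: "set p1 \<inter> set p2 = {}" "set p1 \<inter> set p3 = {}" "set p2 \<inter> set p3 = {}"
    and edges: "edges (induced_subgraph G W) = path_edges p1 \<union> path_edges p2 \<union> path_edges p3 \<union>
               {{a1, a2}, {a1, a3}, {a2, a3}} \<union> {{b1, b2}, {b1, b3}, {b2, b3}}"
    unfolding prism_def induced_path_between_def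
    by (elim conjE exE) (rule that; assumption)
  have tri: "adj G a1 a2" "adj G a1 a3" "adj G a2 a3" "adj G b1 b2" "adj G b1 b3" "adj G b2 b3"
    using edges unfolding adj_def induced_subgraph_def by auto
  have ends: "a1 \<in> set p1" "a2 \<in> set p2" "a3 \<in> set p3" "b1 \<in> set p1" "b2 \<in> set p2" "b3 \<in> set p3"
    using p unfolding path_between_def is_path_def by auto
  have ne: "a1 \<noteq> b1" "a2 \<noteq> b2" "a3 \<noteq> b3"
    by (fact path_ends_neq[OF p(1) len(1)] path_ends_neq[OF p(2) len(2)] path_ends_neq[OF p(3) len(3)])+
  have disj: "{a1, a2, a3} \<inter> {b1, b2, b3} = {}"
    using ne ends int[unfolded disjoint_iff] by simp metis
  obtain X z z' where X: "\<forall>a\<in>{a1, a2, a3}. \<forall>b\<in>{b1, b2, b3}. a \<in> X \<longleftrightarrow> b \<notin> X"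
    and Z: "\<forall>u v. adj G u v \<longrightarrow> u \<in> X \<longrightarrow> v \<notin> X \<longrightarrow> u \<in> {z, z'} \<or> v \<in> {z, z'}"
    using cut[OF tri disj] by (elim exE conjE)
  have X': "a1 \<in> X \<longleftrightarrow> b1 \<notin> X" "a2 \<in> X \<longleftrightarrow> b2 \<notin> X" "a3 \<in> X \<longleftrightarrow> b3 \<notin> X"
    using X by auto
  have Z': "u \<in> {z, z'} \<or> v \<in> {z, z'}"
    if "adj (induced_subgraph G W) u v" "u \<in> X" "v \<notin> X" for u v
    using Z that unfolding adj_induced by blast
  \<comment> \<open>Two vertices cannot meet three disjoint paths.\<close>
  note meet = path_meets_cut[where X = X and Z = "{z, z'}", OF _ _ Z']
  have "set p1 \<inter> {z, z'} \<noteq> {}" "set p2 \<inter> {z, z'} \<noteq> {}" "set p3 \<inter> {z, z'} \<noteq> {}"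
    using meet[OF p(1) X'(1)] meet[OF p(2) X'(2)] meet[OF p(3) X'(3)] by simp_all
  then show False using int[unfolded disjoint_iff] by simp metis
qed

lemma prism_free_if_two_coloured:
  fixes c :: "'a \<Rightarrow> bool"
  assumes "\<And>x y. adj G x y \<Longrightarrow> c x \<noteq> c y"
  shows "free_of prism G"
  using two_colouring_no_triangle[of G c, OF assms] by (intro prism_free_if_two_cuts) metis

lemma cycle_edges_nth:
  assumes "e \<in> cycle_edges c" "2 \<le> length c"
  obtains j where "j < length c" "e = {c ! j, c ! (if Suc j = length c then 0 else Suc j)}"
proof -
  have "c \<noteq> []" using assms(2) by auto
  from assms(1) consider "e = {last c, hd c}" | j where "Suc j < length c" "e = {c ! j, c ! Suc j}"
    unfolding cycle_edges_def path_edges_def by auto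
  then show ?thesis
  proof cases
    case 1
    then show ?thesis using that[of "length c - 1"] \<open>c \<noteq> []\<close> by (simp add: hd_conv_nth last_conv_nth)
  next
    case 2
    then show ?thesis using that[of j] by auto
  qed
qed

lemma cycle_edge_nth:
  assumes "j < length c"
  shows "{c ! j, c ! (if Suc j = length c then 0 else Suc j)} \<in> cycle_edges c"
proof (cases "Suc j = length c")
  case True
  have "c \<noteq> []" using assms by auto
  moreover from this have "last c = c ! j" "hd c = c ! 0"
    by (simp_all add: last_conv_nth hd_conv_nth True[symmetric])
  ultimately show ?thesis using True unfolding cycle_edges_def by simp
next
  case False
  then show ?thesis using assms unfolding cycle_edges_def path_edges_def by auto
qed

lemma cycle_two_neighbours:
  assumes "is_cycle G c" "i < length c"
  defines "s \<equiv> (if Suc i = length c then 0 else Suc i)"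
    and "t \<equiv> (if i = 0 then length c - 1 else i - 1)"
  shows "adj G (c ! i) (c ! s)" "adj G (c ! i) (c ! t)" "c ! s \<noteq> c ! t" "s < length c" "t < length c"
proof -
  have c: "length c \<ge> 3" "distinct c" "cycle_edges c \<subseteq> edges G"
    using assms(1) unfolding is_cycle_def by auto
  show st: "s < length c" "t < length c" using assms(2) unfolding s_def t_def by auto
  show "adj G (c ! i) (c ! s)"
    using cycle_edge_nth[OF assms(2)] c(3) unfolding adj_def s_def by auto
  have "(if Suc t = length c then 0 else Suc t) = i"
    using assms(2) c(1) unfolding t_def by (auto split: if_splits)
  then show "adj G (c ! i) (c ! t)"
    using cycle_edge_nth[OF st(2)] c(3) unfolding adj_def by (auto simp: insert_commute)
  show "c ! s \<noteq> c ! t"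
    unfolding nth_eq_iff_index_eq[OF c(2) st] using c(1) assms(2) unfolding s_def t_def by auto
qed

text \<open>
  The two neighbours on the cycle are not adjacent, because the length is at least 4 and chords are absent.
\<close>

lemma induced_cycle_neighbours:
  assumes c: "induced_cycle G c" "4 \<le> length c" and u: "u \<in> set c"
  obtains p q where "p \<in> set c" "q \<in> set c" "p \<noteq> q" "adj G u p" "adj G u q" "\<not> adj G p q"
proof -
  have cyc: "is_cycle G c" and ind: "\<And>x y. x \<in> set c \<Longrightarrow> y \<in> set c \<Longrightarrow> adj G x y \<Longrightarrow> {x, y} \<in> cycle_edges c"
    using c(1) unfolding induced_cycle_def by auto
  then have d: "distinct c" unfolding is_cycle_def by simp
  obtain i where i: "i < length c" "c ! i = u" using u by (auto simp: in_set_conv_nth)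
  define s where "s = (if Suc i = length c then 0 else Suc i)"
  define t where "t = (if i = 0 then length c - 1 else i - 1)"
  note n = cycle_two_neighbours[OF cyc i(1), folded s_def t_def]
  have "\<not> adj G (c ! s) (c ! t)"
  proof
    assume "adj G (c ! s) (c ! t)"
    then have "{c ! s, c ! t} \<in> cycle_edges c" using ind n by simp
    then obtain j where j: "j < length c" "{c ! s, c ! t} = {c ! j, c ! (if Suc j = length c then 0 else Suc j)}"
      using cycle_edges_nth[of "{c ! s, c ! t}" c] c(2) by auto
    define l where "l = (if Suc j = length c then 0 else Suc j)"
    have "l < length c" using j(1) unfolding l_def by auto
    then have "s = j \<and> t = l \<or> s = l \<and> t = j"
      using j d n by (auto simp: doubleton_eq_iff l_def[symmetric] nth_eq_iff_index_eq)
    then show False using c(2) i j(1) unfolding s_def t_def l_def by (auto split: if_splits)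
  qed
  then show ?thesis using that[of "c ! s" "c ! t"] n i by simp
qed

text \<open>
  Suppose that \<open>w\<close> is the hub of a wheel. A neighbour \<open>u\<close> of \<open>w\<close> on the rim has two
  non-adjacent neighbours on the rim, both different from \<open>w\<close>. Hence a neighbour of \<open>w\<close> whose other
  neighbours are pairwise adjacent never lies on the rim, and \<open>w\<close> is no hub if at most two of
  its neighbours, \<open>A\<close> and \<open>B\<close>, are of another kind.
\<close>

lemma wheel_free_local:
  assumes exc: "\<And>w. \<exists>A B. \<forall>u. adj G w u \<longrightarrow> u = A \<or> u = B \<or>
      (\<forall>p q. adj G u p \<longrightarrow> adj G u q \<longrightarrow> p \<noteq> w \<longrightarrow> q \<noteq> w \<longrightarrow> p \<noteq> q \<longrightarrow> adj G p q)"
  shows "free_of wheel G"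
  unfolding free_of_def
proof safe
  fix W assume "wheel (induced_subgraph G W)"
  then obtain c w where c: "induced_cycle (induced_subgraph G W) c" "length c \<ge> 4" "w \<notin> set c"
    and n: "card {x \<in> set c. adj (induced_subgraph G W) w x} \<ge> 3"
    unfolding wheel_def by blast
  obtain A B where AB: "\<And>u. adj G w u \<Longrightarrow> u = A \<or> u = B \<or>
      (\<forall>p q. adj G u p \<longrightarrow> adj G u q \<longrightarrow> p \<noteq> w \<longrightarrow> q \<noteq> w \<longrightarrow> p \<noteq> q \<longrightarrow> adj G p q)"
    using exc[of w] by metis
  have "{x \<in> set c. adj (induced_subgraph G W) w x} \<subseteq> {A, B}"
  proof
    fix u assume "u \<in> {x \<in> set c. adj (induced_subgraph G W) w x}"
    then have u: "u \<in> set c" "adj (induced_subgraph G W) w u" by auto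
    obtain p q where "p \<in> set c" "q \<in> set c" "p \<noteq> q" "adj (induced_subgraph G W) u p"
      "adj (induced_subgraph G W) u q" "\<not> adj (induced_subgraph G W) p q"
      using induced_cycle_neighbours[OF c(1,2) u(1)] by blast
    then show "u \<in> {A, B}" using AB[of u] u c(3) unfolding adj_induced by simp metis
  qed
  then have "card {x \<in> set c. adj (induced_subgraph G W) w x} \<le> card {A, B}"
    by (intro card_mono) auto
  with n show False using card_insert_le_m1[of 2 "{B}" A] by (auto simp: card_insert_if split: if_splits)
qed

section \<open>Tree decompositions\<close>

text \<open>
  The tree of a decomposition is given by a root and a parent for every other node. A rank that
  decreases from a node to its parent is the only thing needed to know that it is a tree.
\<close>

definition parent_graph :: "'a set \<Rightarrow> 'a \<Rightarrow> ('a \<Rightarrow> 'a) \<Rightarrow> 'a ugraph" where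
  "parent_graph V r par = \<lparr>verts = V, edges = {{t, par t} | t. t \<in> V - {r}}\<rparr>"

lemma adj_parent_graph:
  "adj (parent_graph V r par) s t \<longleftrightarrow> s \<in> V \<and> s \<noteq> r \<and> t = par s \<or> t \<in> V \<and> t \<noteq> r \<and> s = par t"
  by (auto simp: adj_def parent_graph_def doubleton_eq_iff)

lemma rtranclp_adj_sym: "(adj G)\<^sup>*\<^sup>* u v \<Longrightarrow> (adj G)\<^sup>*\<^sup>* v u"
  by (induction rule: rtranclp_induct) (auto intro: converse_rtranclp_into_rtranclp adj_sym[THEN iffD1])

text \<open>
  A set of nodes that is closed under taking parents up to one of its nodes \<open>s\<close> is connected,
  because all its nodes climb to \<open>s\<close>.
\<close>

lemma connected_to_top:
  fixes rank :: "'a \<Rightarrow> nat"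
  assumes par: "\<And>t. t \<in> V \<Longrightarrow> t \<noteq> r \<Longrightarrow> par t \<in> V \<and> rank (par t) < rank t" and fin: "finite V"
    and S: "S \<subseteq> V" "s \<in> S" "\<And>t. t \<in> S \<Longrightarrow> t \<noteq> s \<Longrightarrow> t \<noteq> r \<and> par t \<in> S"
  shows "simple_graph (parent_graph V r par)"
    "connected_graph (induced_subgraph (parent_graph V r par) S)"
proof -
  let ?T = "parent_graph V r par" and ?H = "induced_subgraph (parent_graph V r par) S"
  have "{t, par t} \<subseteq> V \<and> card {t, par t} = 2" if "t \<in> V" "t \<noteq> r" for t
    using par[OF that] that by (auto simp: card_insert_if)
  then show simple: "simple_graph ?T"
    using fin unfolding simple_graph_def parent_graph_def by auto
  have vS: "verts ?H = S" by (simp add: induced_subgraph_def)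
  have sH: "simple_graph ?H" using simple S(1) by (intro simple_induced) (auto simp: parent_graph_def)
  have up: "t \<in> S \<longrightarrow> (adj ?H)\<^sup>*\<^sup>* t s" for t
  proof (induction "rank t" arbitrary: t rule: less_induct)
    case less
    show ?case
    proof
      assume t: "t \<in> S"
      show "(adj ?H)\<^sup>*\<^sup>* t s"
      proof (cases "t = s")
        case False
        then have p: "t \<noteq> r" "par t \<in> S" using S(3) t by auto
        then have "adj ?H t (par t)" using t S(1) by (auto simp: adj_induced adj_parent_graph)
        moreover have "(adj ?H)\<^sup>*\<^sup>* (par t) s" using less p t S(1) par by blast
        ultimately show ?thesis by (rule converse_rtranclp_into_rtranclp)
      qed simp
    qed
  qed
  have "\<exists>p. path_between ?H u p v" if "u \<in> S" "v \<in> S" for u v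
  proof -
    have "(adj ?H)\<^sup>*\<^sup>* u v" using up that rtranclp_adj_sym[of ?H v s] by (meson rtranclp_trans)
    then show ?thesis using path_of_reachable[OF sH] that vS by metis
  qed
  then show "connected_graph ?H" unfolding connected_graph_def vS using S(2) by blast
qed

text \<open>
  On a cycle, a node of maximal rank would have its two neighbours as parents.
\<close>

lemma parent_graph_is_tree:
  fixes rank :: "'a \<Rightarrow> nat"
  assumes par: "\<And>t. t \<in> V \<Longrightarrow> t \<noteq> r \<Longrightarrow> par t \<in> V \<and> rank (par t) < rank t"
    and fin: "finite V" and r: "r \<in> V"
  shows "is_tree (parent_graph V r par)"
proof -
  let ?T = "parent_graph V r par"
  have "induced_subgraph ?T V = ?T"
    using par by (auto simp: induced_subgraph_def parent_graph_def)
  then have "simple_graph ?T" "connected_graph ?T"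
    using connected_to_top[of V r par rank V r, OF par fin subset_refl r] par by auto
  moreover have "\<not> is_cycle ?T c" for c
  proof
    assume c: "is_cycle ?T c"
    then have "set c \<noteq> {}" unfolding is_cycle_def by auto
    then obtain m where m: "m \<in> set c" "\<And>x. x \<in> set c \<Longrightarrow> rank x \<le> rank m"
      using Max_in[of "rank ` set c"] Max_ge[of "rank ` set c"] by fastforce
    have V: "set c \<subseteq> V" using c unfolding is_cycle_def parent_graph_def by simp
    obtain i where i: "i < length c" "c ! i = m" using m(1) by (auto simp: in_set_conv_nth)
    have "x = par m" if "adj ?T m x" "x \<in> set c" for x
      using that par[of x] m(2)[OF that(2)] unfolding adj_parent_graph by auto
    then show False using cycle_two_neighbours[OF c i(1)] i(2) nth_mem by metis
  qed
  ultimately show ?thesis unfolding is_tree_def by blast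
qed

text \<open>
  The nodes of the decomposition tree are the vertices of the graph themselves. Since a bag adds at most its own
  node to the bag of the parent, the bags that contain \<open>v\<close> are connected through parents to the bag
  of \<open>v\<close>.
\<close>

lemma tree_decomposition_by_parents:
  fixes rank :: "'a \<Rightarrow> nat"
  assumes simple: "simple_graph G" and r: "r \<in> verts G"
    and par: "\<And>t. t \<in> verts G \<Longrightarrow> t \<noteq> r \<Longrightarrow> par t \<in> verts G \<and> rank (par t) < rank t"
    and bag: "\<And>t. t \<in> verts G \<Longrightarrow> t \<in> bag t \<and> bag t \<subseteq> verts G \<and> card (bag t) \<le> w + 1"
    and bag_r: "bag r = {r}"
    and bag_par: "\<And>t. t \<in> verts G \<Longrightarrow> t \<noteq> r \<Longrightarrow> bag t \<subseteq> insert t (bag (par t))"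
    and edge: "\<And>x y. adj G x y \<Longrightarrow> \<exists>t\<in>verts G. {x, y} \<subseteq> bag t"
  shows "tree_decomposition G (parent_graph (verts G) r par) bag"
    "decomposition_width (parent_graph (verts G) r par) bag \<le> w"
proof -
  let ?T = "parent_graph (verts G) r par"
  have fin: "finite (verts G)" using simple unfolding simple_graph_def by simp
  have vT: "verts ?T = verts G" by (simp add: parent_graph_def)
  have "connected_graph (induced_subgraph ?T {t \<in> verts ?T. v \<in> bag t})" if "v \<in> verts G" for v
    unfolding vT
  proof (rule connected_to_top(2)[of "verts G" r par rank _ v, OF par fin])
    fix t assume t: "t \<in> {t \<in> verts G. v \<in> bag t}" "t \<noteq> v"
    then have "t \<noteq> r" using bag_r by auto
    then show "t \<noteq> r \<and> par t \<in> {t \<in> verts G. v \<in> bag t}" using t par bag_par by blast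
  qed (use bag that in auto)
  moreover have "\<exists>t\<in>verts G. e \<subseteq> bag t" if "e \<in> edges G" for e
  proof -
    have "card e = 2" using simple that unfolding simple_graph_def by auto
    then obtain x y where "e = {x, y}" by (auto simp: card_2_iff)
    then show ?thesis using edge[of x y] that unfolding adj_def by auto
  qed
  ultimately show "tree_decomposition G ?T bag"
    unfolding tree_decomposition_def vT
    using parent_graph_is_tree[of "verts G" r par rank, OF par fin r] bag by fast
  have "Max ((\<lambda>t. card (bag t)) ` verts G) \<le> w + 1" using fin r bag by (subst Max_le_iff) auto
  then show "decomposition_width ?T bag \<le> w" unfolding decomposition_width_def vT by simp
qed

lemma tree_width_le:
  fixes T :: "nat ugraph"
  assumes "tree_decomposition G T bag" "decomposition_width T bag \<le> w"
  shows "tree_width G \<le> w"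
proof -
  have "tree_width G \<le> decomposition_width T bag"
    unfolding tree_width_def using assms(1) by (intro Least_le) blast
  with assms(2) show ?thesis by simp
qed

lemma leaving_step:
  assumes "R\<^sup>*\<^sup>* a b" "P a" "\<not> P b"
  shows "\<exists>s s'. R s s' \<and> P s \<and> \<not> P s' \<and> (\<lambda>u v. R u v \<and> \<not> P u \<and> \<not> P v)\<^sup>*\<^sup>* s' b"
proof -
  let ?Q = "\<lambda>u v. R u v \<and> \<not> P u \<and> \<not> P v"
  have "?Q\<^sup>*\<^sup>* a b \<and> \<not> P a \<or> (\<exists>s s'. R s s' \<and> P s \<and> \<not> P s' \<and> ?Q\<^sup>*\<^sup>* s' b)"
    using assms(1)
  proof (induction rule: converse_rtranclp_induct)
    case base
    then show ?case using assms(3) by simp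
  next
    case (step y z)
    then show ?case by (cases "P y") (auto intro: converse_rtranclp_into_rtranclp)
  qed
  then show ?thesis using assms(2) by blast
qed

text \<open>
  A path that joins the ends of a tree edge without using this edge would close a cycle.
\<close>

lemma tree_edge_is_bridge:
  assumes tree: "is_tree T" and e: "adj T s s'"
    and walk: "(\<lambda>u v. adj T u v \<and> {u, v} \<noteq> {s, s'})\<^sup>*\<^sup>* s' s"
  shows False
proof -
  let ?T = "\<lparr>verts = verts T, edges = edges T - {{s, s'}}\<rparr>"
  have T: "simple_graph T" "\<And>c. \<not> is_cycle T c" using tree unfolding is_tree_def by auto
  have s: "s' \<in> verts T" "s \<noteq> s'" using adj_verts[OF T(1) e] by auto
  have "simple_graph ?T" using T(1) unfolding simple_graph_def by auto
  moreover have adj: "adj ?T = (\<lambda>u v. adj T u v \<and> {u, v} \<noteq> {s, s'})"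
    by (auto simp: adj_def fun_eq_iff)
  ultimately obtain p where p: "path_between ?T s' p s"
    using path_of_reachable[of ?T s' s] walk s by auto
  have q: "p \<noteq> []" "distinct p" "set p \<subseteq> verts T" "path_edges p \<subseteq> edges T - {{s, s'}}" "hd p = s'" "last p = s"
    using p unfolding path_between_def is_path_def by auto
  have "length p \<noteq> 1" using q s by (cases p) auto
  moreover have "length p \<noteq> 2"
  proof
    assume 2: "length p = 2"
    then have "p = [s', s]" using q by (cases p; cases "tl p") auto
    then have "{s, s'} \<in> path_edges p" unfolding path_edges_def by (auto intro!: exI[of _ 0])
    then show False using q by auto
  qed
  moreover have "length p \<noteq> 0" using q by auto
  ultimately have "3 \<le> length p" by linarith
  then have "is_cycle T p"
    unfolding is_cycle_def cycle_edges_def using q e by (auto simp: adj_def)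
  then show False using T(2) by blast
qed

text \<open>
  The hypotheses describe a cycle through the edge \<open>xy\<close> without fixing its remaining vertices: \<open>z1\<close> and
  \<open>z2\<close> are joined outside \<open>{x, y}\<close>. Suppose that all bags have at most two elements. Let \<open>t0\<close> be the bag of the edge \<open>xy\<close>
  and \<open>t1\<close> that of \<open>y z1\<close>. Within the bags of \<open>y\<close> there is a tree edge \<open>s s'\<close> that leaves the bags
  of \<open>x\<close> for good; the bag of \<open>s\<close> is \<open>{x, y}\<close>. One can return from \<open>s'\<close> to \<open>s\<close> along the rest of the cycle: first through bags of \<open>y\<close> outside those of \<open>x\<close>, then through
  bags of vertices other than \<open>x\<close> and \<open>y\<close>, which avoid \<open>s\<close>, and finally through bags of \<open>x\<close>, which avoid \<open>s'\<close>.
  So the edge \<open>s s'\<close> is not a bridge of the tree.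
\<close>

lemma cycle_forces_width_2:
  assumes simple: "simple_graph G" and td: "tree_decomposition G T bag"
    and xy: "adj G x y" and z: "adj G y z1" "adj G x z2" "z1 \<notin> {x, y}" "z2 \<notin> {x, y}"
    and conn: "(\<lambda>u v. adj G u v \<and> u \<notin> {x, y} \<and> v \<notin> {x, y})\<^sup>*\<^sup>* z1 z2"
  shows "2 \<le> decomposition_width T bag"
proof (rule ccontr)
  assume "\<not> ?thesis"
  then have "Max ((\<lambda>t. card (bag t)) ` verts T) \<le> 2" unfolding decomposition_width_def by simp
  have tree: "is_tree T" and cover: "(\<Union>t\<in>verts T. bag t) = verts G"
    and edge: "\<And>e. e \<in> edges G \<Longrightarrow> \<exists>t\<in>verts T. e \<subseteq> bag t"
    and sub: "\<And>v. v \<in> verts G \<Longrightarrow> connected_graph (induced_subgraph T {t \<in> verts T. v \<in> bag t})"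
    using td unfolding tree_decomposition_def by auto
  have "finite (verts T)" "finite (verts G)"
    using tree simple unfolding is_tree_def simple_graph_def by auto
  have small: "bag t = {a, b}" if "t \<in> verts T" "a \<in> bag t" "b \<in> bag t" "a \<noteq> b" for a b t
  proof -
    have "card (bag t) \<le> 2"
      using \<open>Max _ \<le> 2\<close> \<open>finite (verts T)\<close> that(1) by (subst (asm) Max_le_iff) auto
    moreover have "finite (bag t)" using cover \<open>finite (verts G)\<close> that(1) by (metis UN_upper finite_subset)
    ultimately show ?thesis using that card_seteq[of "bag t" "{a, b}"] by (simp add: card_insert_if)
  qed
  have walk: "(\<lambda>a b. adj T a b \<and> v \<in> bag a \<and> v \<in> bag b)\<^sup>*\<^sup>* t t'"
    if v: "v \<in> verts G" "t \<in> verts T" "t' \<in> verts T" "v \<in> bag t" "v \<in> bag t'" for v t t'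
  proof -
    obtain p where "path_between (induced_subgraph T {t \<in> verts T. v \<in> bag t}) t p t'"
      using sub[OF v(1)] v(2-5) unfolding connected_graph_def
      by (auto simp: induced_subgraph_def)
    then have "(adj (induced_subgraph T {t \<in> verts T. v \<in> bag t}))\<^sup>*\<^sup>* t t'" by (rule reachable_of_path)
    then show ?thesis by (rule rtranclp_mono[THEN predicate2D, rotated]) (auto simp: adj_induced)
  qed
  note V = adj_verts[OF simple xy] adj_verts[OF simple z(1)] adj_verts[OF simple z(2)]
  obtain t0 where t0: "t0 \<in> verts T" "x \<in> bag t0" "y \<in> bag t0" using edge xy unfolding adj_def by blast
  obtain t1 where t1: "t1 \<in> verts T" "y \<in> bag t1" "z1 \<in> bag t1" using edge z(1) unfolding adj_def by blast
  obtain t2 where t2: "t2 \<in> verts T" "x \<in> bag t2" "z2 \<in> bag t2" using edge z(2) unfolding adj_def by blast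
  have "x \<notin> bag t1" using small[OF t1] V z by auto
  \<comment> \<open>The last step from \<open>t0\<close> to \<open>t1\<close> that leaves the bags of \<open>x\<close>.\<close>
  with leaving_step[OF walk[of y t0 t1], of "\<lambda>t. x \<in> bag t"] V t0 t1
  obtain s s' where s: "adj T s s'" "y \<in> bag s" "y \<in> bag s'" "x \<in> bag s" "x \<notin> bag s'"
    and tail: "(\<lambda>u v. (adj T u v \<and> y \<in> bag u \<and> y \<in> bag v) \<and> x \<notin> bag u \<and> x \<notin> bag v)\<^sup>*\<^sup>* s' t1"
    by blast
  have sT: "s \<in> verts T" "s' \<in> verts T" using adj_verts[OF _ s(1)] tree unfolding is_tree_def by auto
  have bag_s: "bag s = {x, y}" using small[OF sT(1) s(4,2)] V by simp
  let ?N = "\<lambda>u v. adj T u v \<and> {u, v} \<noteq> {s, s'}"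
  have 1: "?N\<^sup>*\<^sup>* s' t1"
    using tail by (rule rtranclp_mono[THEN predicate2D, rotated]) (auto simp: doubleton_eq_iff s)
  have avoid: "?N\<^sup>*\<^sup>* t t'"
    if "v \<in> verts G" "t \<in> verts T" "t' \<in> verts T" "v \<in> bag t" "v \<in> bag t'" "v \<notin> bag s \<or> v \<notin> bag s'" for v t t'
    using walk[OF that(1-5)] that(6)
    by (elim rtranclp_mono[THEN predicate2D, rotated]) (auto simp: doubleton_eq_iff)
  have "\<forall>t\<in>verts T. z2 \<in> bag t \<longrightarrow> ?N\<^sup>*\<^sup>* t1 t"
    using conn
  proof (induction rule: rtranclp_induct)
    case base
    then show ?case using avoid[of z1 t1] V t1 bag_s z by auto
  next
    case (step u v)
    note uv = adj_verts[OF simple, of u v]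
    obtain t' where t': "t' \<in> verts T" "u \<in> bag t'" "v \<in> bag t'"
      using edge step.hyps(2) unfolding adj_def by blast
    then have "?N\<^sup>*\<^sup>* t1 t'" using step.IH by blast
    moreover have "?N\<^sup>*\<^sup>* t' t" if "t \<in> verts T" "v \<in> bag t" for t
      using avoid[of v t' t] uv step.hyps(2) t' that bag_s by auto
    ultimately show ?case by (meson rtranclp_trans)
  qed
  then have "?N\<^sup>*\<^sup>* t1 t2" using t2 by blast
  moreover have "?N\<^sup>*\<^sup>* t2 s" using avoid[of x t2 s] V t2 sT s by auto
  ultimately have "?N\<^sup>*\<^sup>* s' s" using 1 by (meson rtranclp_trans)
  then show False using tree_edge_is_bridge[OF tree s(1)] by blast
qed

section \<open>Drawings in levels\<close>

lemma level_segment: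
  fixes a b a' b' :: real
  assumes "z \<in> closed_segment (Complex a b) (Complex a' b')"
  obtains t where "0 \<le> t" "t \<le> 1" "Re z = a + t * (a' - a)" "Im z = b + t * (b' - b)"
proof -
  obtain t :: real where t: "0 \<le> t" "t \<le> 1" "z = (1 - t) *\<^sub>R Complex a b + t *\<^sub>R Complex a' b'"
    using assms unfolding in_segment by blast
  have "Re z = a + t * (a' - a)" "Im z = b + t * (b' - b)"
    unfolding t(3) by (simp_all add: algebra_simps)
  then show ?thesis using that t(1,2) by blast
qed

text \<open>
  Vertices sit at integer points, and edges are straight segments that stay on one level
  (a vertical line \<open>px = const\<close>) or join two consecutive levels. For segments within a level it suffices
  that they join consecutive vertices of the level; for those between two levels it suffices that they keep the
  order weakly. Then two segments can only meet at a common end.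
\<close>

lemma planar_level_drawing:
  fixes px py :: "'a \<Rightarrow> int"
  assumes simple: "simple_graph G"
    and inj: "\<And>u v. \<lbrakk>u \<in> verts G; v \<in> verts G; px u = px v; py u = py v\<rbrakk> \<Longrightarrow> u = v"
    and near: "\<And>u v. adj G u v \<Longrightarrow> px u < px v \<Longrightarrow> px v = px u + 1"
    and level: "\<And>u v w. \<lbrakk>adj G u v; px u = px v; w \<in> verts G; px w = px u; py u < py w; py w < py v\<rbrakk> \<Longrightarrow> False"
    and mono: "\<And>u v u' v'. \<lbrakk>adj G u v; adj G u' v'; px v = px u + 1; px u' = px u; px v' = px v; py u < py u'\<rbrakk> \<Longrightarrow> py v \<le> py v'"
  shows "planar G"
proof -
  define f where "f v = Complex (px v) (py v)" for v
  define up where "up u v \<longleftrightarrow> adj G u v \<and> (px u < px v \<or> px u = px v \<and> py u < py v)" for u v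
  have up_ex: "\<exists>u v. e = {u, v} \<and> up u v" if "e \<in> edges G" for e
  proof -
    have "card e = 2" using simple that unfolding simple_graph_def by auto
    then obtain x y where e: "e = {x, y}" by (auto simp: card_2_iff)
    then have a: "adj G x y" using that unfolding adj_def by simp
    note xy = adj_verts[OF simple a]
    then have "up x y \<or> up y x" using inj[of x y] a adj_sym[of G x y] unfolding up_def by force
    then show ?thesis using e by (auto simp: insert_commute)
  qed
  define h where "h e = (SOME p. up (fst p) (snd p) \<and> e = {fst p, snd p})" for e
  have h: "up (fst (h e)) (snd (h e)) \<and> e = {fst (h e), snd (h e)}" if e: "e \<in> edges G" for e
  proof -
    obtain u v where "e = {u, v} \<and> up u v" using up_ex[OF e] by blast
    then show ?thesis
      using someI[of "\<lambda>p. up (fst p) (snd p) \<and> e = {fst p, snd p}" "(u, v)"] unfolding h_def by auto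
  qed
  define g where "g e = linepath (f (fst (h e))) (f (snd (h e)))" for e
  have f_inj: "f u = f v \<Longrightarrow> u = v" if "u \<in> verts G" "v \<in> verts G" for u v
    using inj[OF that] unfolding f_def by simp
  have upV: "u \<in> verts G" "v \<in> verts G" "u \<noteq> v" "px v = px u + 1 \<or> px u = px v \<and> py u < py v"
    if uv: "up u v" for u v
  proof -
    have a: "adj G u v" and o: "px u < px v \<or> px u = px v \<and> py u < py v"
      using uv unfolding up_def by auto
    show "u \<in> verts G" "v \<in> verts G" "u \<noteq> v" using adj_verts[OF simple a] .
    show "px v = px u + 1 \<or> px u = px v \<and> py u < py v" using o near[OF a] by blast
  qed
  have vert_on: "w = u \<or> w = v" if uv: "up u v" and w: "w \<in> verts G" and on: "f w \<in> closed_segment (f u) (f v)" for u v w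
  proof -
    obtain t :: real where t: "0 \<le> t" "t \<le> 1" "Re (f w) = px u + t * (real_of_int (px v) - px u)"
      "Im (f w) = py u + t * (real_of_int (py v) - py u)"
      using level_segment[OF on[unfolded f_def[of u] f_def[of v]]] .
    note t = t(1,2) t(3,4)[unfolded f_def complex.sel]
    consider "px v = px u + 1" | "px u = px v" "py u < py v" using upV[OF uv] by blast
    then show ?thesis
    proof cases
      case 1
      then have tw: "t = real_of_int (px w - px u)" using t(3) by simp
      then have "0 \<le> px w - px u" "px w - px u \<le> 1" using t(1,2) by linarith+
      then have "px w - px u = 0 \<or> px w - px u = 1" by linarith
      then have "t = 0 \<or> t = 1" using tw by auto
      then show ?thesis using t 1 inj[OF w upV(1)[OF uv]] inj[OF w upV(2)[OF uv]] by auto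
    next
      case 2
      then have px: "px w = px u" using t(3) by simp
      have "0 \<le> t * real_of_int (py v - py u)" "t * real_of_int (py v - py u) \<le> 1 * real_of_int (py v - py u)"
        using t(1,2) 2(2) by (auto intro: mult_right_mono)
      then have "py u \<le> py w" "py w \<le> py v" using t(4) by (simp_all add: algebra_simps)
      then show ?thesis
        using level[of u v w] uv 2 w px inj[OF w upV(1)[OF uv]] inj[OF w upV(2)[OF uv]]
        unfolding up_def by (smt (verit))
    qed
  qed
  \<comment> \<open>It is enough that a common point of two edges is a vertex, since a segment contains no
    vertex except its ends. By symmetry the first edge starts on the smaller level, or lower on the same level.\<close>
  have meet: "z \<in> f ` {u, v} \<union> f ` {u', v'}"
    if e: "up u v" "up u' v'" "{u, v} \<noteq> {u', v'}"
      and z: "z \<in> closed_segment (f u) (f v)" "z \<in> closed_segment (f u') (f v')"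
      and ord: "px u < px u' \<or> px u = px u' \<and> py u \<le> py u'" for u v u' v' z
  proof -
    note V = upV[OF e(1)] upV[OF e(2)]
    obtain t :: real where t: "0 \<le> t" "t \<le> 1" "Re z = px u + t * (real_of_int (px v) - px u)"
      "Im z = py u + t * (real_of_int (py v) - py u)"
      using level_segment[OF z(1)[unfolded f_def]] .
    obtain t' :: real where t': "0 \<le> t'" "t' \<le> 1" "Re z = px u' + t' * (real_of_int (px v') - px u')"
      "Im z = py u' + t' * (real_of_int (py v') - py u')"
      using level_segment[OF z(2)[unfolded f_def]] .
    have end0: "z = f u" if "t = 0" using t that unfolding f_def by (simp add: complex_eq_iff)
    have end1: "z = f v" if "t = 1" using t that unfolding f_def by (simp add: complex_eq_iff)
    have end0': "z = f u'" if "t' = 0" using t' that unfolding f_def by (simp add: complex_eq_iff)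
    consider (A) "px v = px u + 1" | (B) "px u = px v" "py u < py v" using V(4) by blast
    then show ?thesis
    proof cases
      case A
      then have re: "Re z = px u + t" using t(3) by simp
      have re': "px u' \<le> Re z" using t'(1,3) V(8) by auto
      consider (1) "px u + 1 \<le> px u'" | (2) "px u' = px u" "px v' = px u'" | (3) "px u' = px u" "px v' = px u + 1"
        using ord V(8) by fastforce
      then show ?thesis
      proof cases
        case 1
        then have "real_of_int (px u) + 1 \<le> real_of_int (px u')" by linarith
        then have "t = 1" using re re' t(2) by linarith
        then show ?thesis using end1 by simp
      next
        case 2
        then have "t = 0" using re t'(3) by simp
        then show ?thesis using end0 by simp
      next
        case 3
        have tt: "t' = t" using re t'(3) 3 by simp
        show ?thesis
        proof (cases "py u = py u'")
          case True
          then have "u = u'" using inj V 3 by metis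
          then have "v \<noteq> v'" using e(3) by auto
          then have "py v \<noteq> py v'" using inj V 3 A by metis
          then have "t = 0" using t(4) t'(4) tt True by auto
          then show ?thesis using end0 by simp
        next
          case False
          then have lt: "py u < py u'" using ord 3 by auto
          have le: "py v \<le> py v'"
            using mono[of u v u' v'] e A 3 lt unfolding up_def by auto
          \<comment> \<open>The height difference of the two segments is a convex combination of two non-negative numbers.\<close>
          have "(1 - t) * (py u' - py u) + t * (py v' - py v) = 0"
            using t(4) t'(4) unfolding tt by (simp add: algebra_simps)
          moreover have "0 \<le> (1 - t) * (py u' - py u)" "0 \<le> t * (py v' - py v)"
            using t(1,2) lt le by simp_all
          ultimately have "(1 - t) * (py u' - py u) = 0" by linarith
          then have "t = 1" using lt by simp
          then show ?thesis using end1 by simp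
        qed
      qed
    next
      case B
      then have re: "Re z = px u" using t(3) by simp
      consider (1) "px v' = px u' + 1" | (2) "px u' = px v'" "py u' < py v'" using V(8) by blast
      then show ?thesis
      proof cases
        case 1
        then have "px u' + t' = px u" using t'(3) re by simp
        then have "t' = 0" using ord t'(1) by auto
        then show ?thesis using end0' by simp
      next
        case 2
        then have same: "px u' = px u" using t'(3) re by simp
        have adj: "adj G u v" "adj G u' v'" using e unfolding up_def by auto
        show ?thesis
        proof (cases "py u = py u'")
          case True
          then have "u = u'" using inj V same by metis
          then have "v \<noteq> v'" using e(3) by auto
          then have "py v \<noteq> py v'" using inj V same B 2 by metis
          moreover have "py v' < py v \<Longrightarrow> False" "py v < py v' \<Longrightarrow> False"
            using level[OF adj(1) B(1) V(6)] level[OF adj(2) 2(1) V(2)] same B 2 True by simp_all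
          ultimately have False by (metis linorder_less_linear)
          then show ?thesis ..
        next
          case False
          then have "py v \<le> py u'"
            using level[OF adj(1) B(1) V(5)] same B ord by (smt (verit))
          moreover have "Im z \<le> py v"
          proof -
            have "t * real_of_int (py v - py u) \<le> 1 * real_of_int (py v - py u)"
              using B t(2) by (intro mult_right_mono) auto
            then show ?thesis using t(4) by simp
          qed
          moreover have "py u' \<le> Im z" using t'(1,4) 2(2) by simp
          ultimately have "Im z = py v" by linarith
          then have "z = f v" using re B unfolding f_def by (simp add: complex_eq_iff)
          then show ?thesis by simp
        qed
      qed
    qed
  qed
  have cross: "z \<in> f ` ({u, v} \<inter> {u', v'})"
    if e: "up u v" "up u' v'" "{u, v} \<noteq> {u', v'}"
      and z: "z \<in> closed_segment (f u) (f v)" "z \<in> closed_segment (f u') (f v')" for u v u' v' z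
  proof -
    have "z \<in> f ` {u, v} \<union> f ` {u', v'}"
      using meet[OF e z] meet[OF e(2,1) e(3)[symmetric] z(2,1)] by fastforce
    then show ?thesis
      using vert_on[OF e(1), of u'] vert_on[OF e(1), of v'] vert_on[OF e(2), of u] vert_on[OF e(2), of v]
        upV[OF e(1)] upV[OF e(2)] z by auto
  qed
  show ?thesis unfolding planar_def
  proof (intro exI[of _ f] exI[of _ g] conjI ballI impI)
    show "inj_on f (verts G)" using f_inj by (auto intro!: inj_onI)
    fix e assume e: "e \<in> edges G"
    note he = h[OF e]
    then have hV: "fst (h e) \<in> verts G" "snd (h e) \<in> verts G" "fst (h e) \<noteq> snd (h e)" using upV by blast+
    show "arc (g e)" unfolding g_def using f_inj hV by (intro arc_linepath) blast
    show "{pathstart (g e), pathfinish (g e)} = f ` e"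
      using arg_cong[OF conjunct2[OF he], of "image f"] unfolding g_def by simp
    show "path_image (g e) \<inter> f ` verts G = f ` e"
    proof
      show "path_image (g e) \<inter> f ` verts G \<subseteq> f ` e"
      proof
        fix z assume "z \<in> path_image (g e) \<inter> f ` verts G"
        then obtain w where w: "z = f w" "w \<in> verts G"
            "f w \<in> closed_segment (f (fst (h e))) (f (snd (h e)))"
          unfolding g_def path_image_linepath by blast
        then have "w \<in> {fst (h e), snd (h e)}" using vert_on[OF conjunct1[OF he] w(2,3)] by simp
        then show "z \<in> f ` e" using w(1) conjunct2[OF he] by blast
      qed
      have "f ` {fst (h e), snd (h e)} \<subseteq> path_image (g e) \<inter> f ` verts G"
        unfolding g_def path_image_linepath using hV by simp
      then show "f ` e \<subseteq> path_image (g e) \<inter> f ` verts G" using conjunct2[OF he] by simp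
    qed
    fix e' assume e': "e' \<in> edges G" "e \<noteq> e'"
    show "path_image (g e) \<inter> path_image (g e') \<subseteq> f ` (e \<inter> e')"
    proof
      fix z assume "z \<in> path_image (g e) \<inter> path_image (g e')"
      then have z: "z \<in> closed_segment (f (fst (h e))) (f (snd (h e)))"
        "z \<in> closed_segment (f (fst (h e'))) (f (snd (h e')))"
        unfolding g_def path_image_linepath by auto
      note he' = h[OF e'(1)]
      have "{fst (h e), snd (h e)} \<noteq> {fst (h e'), snd (h e')}"
        using he he' e'(2) by (elim conjE) simp
      from cross[OF conjunct1[OF he] conjunct1[OF he'] this z]
      show "z \<in> f ` (e \<inter> e')" using conjunct2[OF he, symmetric] conjunct2[OF he', symmetric] by simp
    qed
  qed
qed

section \<open>The double of a rooted graph\<close>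

text \<open>
  The copy of \<open>x\<close> on side \<open>s\<close>, coded as a natural number. The side of the root is always recorded
  as \<open>True\<close>, which glues the two copies there.
\<close>

definition copy :: "'a::countable \<Rightarrow> bool \<Rightarrow> 'a \<Rightarrow> nat" where
  "copy r s x = to_nat (x = r \<or> s, x)"

definition double :: "'a::countable set \<Rightarrow> ('a \<Rightarrow> 'a \<Rightarrow> bool) \<Rightarrow> 'a \<Rightarrow> nat ugraph" where
  "double V E r = \<lparr>verts = {copy r s x | s x. x \<in> V}, edges = {{copy r s x, copy r s y} | s x y. E x y}\<rparr>"

text \<open>
  \<open>pt\<close> and \<open>side\<close> decode a vertex of the double, so that potentials on a rooted graph can be
  transported to its double.
\<close>

definition pt :: "nat \<Rightarrow> 'a::countable" where
  "pt m = snd (from_nat m :: bool \<times> 'a)"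

definition side :: "'a::countable itself \<Rightarrow> nat \<Rightarrow> bool" where
  "side _ m = fst (from_nat m :: bool \<times> 'a)"

lemma pt_copy [simp]: "pt (copy r s x) = x"
  by (simp add: pt_def copy_def)

lemma side_copy [simp]: "side TYPE('a) (copy r s x) \<longleftrightarrow> x = r \<or> s" for x :: "'a::countable"
  by (simp add: side_def copy_def)

lemma copy_eq_iff: "copy r s x = copy r t y \<longleftrightarrow> x = y \<and> (x = r \<or> s = t)"
  by (auto simp: copy_def)

lemma copy_root: "copy r s r = copy r t r"
  by (simp add: copy_eq_iff)

text \<open>
  The assumptions on \<open>f\<close> say that \<open>f\<close> is the distance to the root, in a form that can be checked edge
  by edge: it changes by at most one along an edge, and each vertex except the root has a neighbour
  one step closer.
\<close>

locale rooted_graph =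
  fixes V :: "'a::countable set" and E :: "'a \<Rightarrow> 'a \<Rightarrow> bool" and r :: 'a and f :: "'a \<Rightarrow> nat"
  assumes finite_V: "finite V" and root: "r \<in> V"
    and E_sym: "E x y \<Longrightarrow> E y x" and E_irrefl: "\<not> E x x" and E_V: "E x y \<Longrightarrow> x \<in> V"
    and f_root: "f r = 0" and f_step: "E x y \<Longrightarrow> f y \<le> f x + 1"
    and f_down: "x \<in> V \<Longrightarrow> x \<noteq> r \<Longrightarrow> \<exists>y. E x y \<and> f x = f y + 1"
begin

abbreviation "G \<equiv> double V E r"
abbreviation "cp \<equiv> copy r"

lemma E_V2: "E x y \<Longrightarrow> y \<in> V"
  using E_V E_sym by blast

lemma verts_G: "verts G = {cp s x | s x. x \<in> V}"
  by (simp add: double_def)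

lemma adj_G: "adj G m n \<longleftrightarrow> (\<exists>s x y. m = cp s x \<and> n = cp s y \<and> E x y)"
  using E_sym by (auto simp: adj_def double_def doubleton_eq_iff) blast

lemma adj_cp: "adj G (cp s x) (cp t y) \<longleftrightarrow> E x y \<and> (x = r \<or> y = r \<or> s = t)"
  using E_irrefl unfolding adj_G copy_eq_iff by metis

lemma adj_cpD: "adj G (cp s x) n \<Longrightarrow> x \<noteq> r \<Longrightarrow> \<exists>y. n = cp s y \<and> E x y"
  unfolding adj_G by (metis copy_eq_iff)

lemma adj_rootD: "adj G (cp s r) n \<Longrightarrow> \<exists>t y. n = cp t y \<and> E r y \<and> y \<noteq> r"
  using E_irrefl unfolding adj_G by (metis copy_eq_iff)

lemma cp_in_G: "cp s x \<in> verts G \<longleftrightarrow> x \<in> V"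
  unfolding verts_G by (auto simp: copy_eq_iff)

lemma simple_G: "simple_graph G"
proof -
  have "verts G = cp True ` V \<union> cp False ` V"
    unfolding verts_G by (auto simp: image_iff) (metis (full_types))+
  moreover have "e \<subseteq> verts G \<and> card e = 2" if e: "e \<in> edges G" for e
  proof -
    obtain s x y where "e = {cp s x, cp s y}" "E x y" using e by (auto simp: double_def)
    then show ?thesis using E_V E_sym E_irrefl by (auto simp: cp_in_G card_insert_if copy_eq_iff)
  qed
  ultimately show ?thesis unfolding simple_graph_def using finite_V by auto
qed

lemma card_verts_G: "card (verts G) \<le> 2 * card V"
proof -
  have "verts G = cp True ` V \<union> cp False ` V"
    unfolding verts_G by (auto simp: image_iff) (metis (full_types))+
  then have "card (verts G) \<le> card (cp True ` V) + card (cp False ` V)"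
    using card_Un_le[of "cp True ` V" "cp False ` V"] by simp
  then show ?thesis
    using card_image_le[OF finite_V, of "cp True"]
      card_image_le[OF finite_V, of "cp False"] by linarith
qed

lemma reaches_root: "x \<in> V \<Longrightarrow> (adj G)\<^sup>*\<^sup>* (cp s x) (cp s r)"
proof (induction "f x" arbitrary: x rule: less_induct)
  case less
  show ?case
  proof (cases "x = r")
    case False
    then obtain y where y: "E x y" "f x = f y + 1" using f_down less.prems by blast
    then have "adj G (cp s x) (cp s y)" by (simp add: adj_cp)
    moreover have "(adj G)\<^sup>*\<^sup>* (cp s y) (cp s r)" using less.hyps[of y] y E_V2 by auto
    ultimately show ?thesis by (rule converse_rtranclp_into_rtranclp)
  qed simp
qed

lemma connected_G: "connected_graph G"
  unfolding connected_graph_def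
proof (intro conjI ballI)
  show "verts G \<noteq> {}" using root cp_in_G by blast
  fix u v assume uv: "u \<in> verts G" "v \<in> verts G"
  then obtain s x t y where *: "u = cp s x" "x \<in> V" "v = cp t y" "y \<in> V" unfolding verts_G by blast
  have "(adj G)\<^sup>*\<^sup>* u (cp True r)" "(adj G)\<^sup>*\<^sup>* v (cp True r)"
    using reaches_root[OF *(2), of s] reaches_root[OF *(4), of t] * copy_root[of r _ True] by metis+
  then have "(adj G)\<^sup>*\<^sup>* u v" by (meson rtranclp_adj_sym rtranclp_trans)
  then show "\<exists>p. path_between G u p v" using path_of_reachable[OF simple_G uv(1)] by metis
qed

sublocale conn_graph G
  using simple_G connected_G by unfold_locales

text \<open>
  The root separates the two copies. The lower bound uses the potential that is the distance from \<open>v\<close>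
  outside side \<open>s\<close>, and the height plus the distance to the root on side \<open>s\<close>; both agree at the root.
\<close>

lemma gdist_across:
  assumes v: "v = cp t y" "y \<in> V" "y = r \<or> t \<noteq> s" and x: "x \<in> V"
  shows "gdist G v (cp s x) = gdist G v (cp s r) + f x"
proof (rule antisym)
  have vG: "v \<in> verts G" using v cp_in_G by simp
  show "gdist G v (cp s x) \<le> gdist G v (cp s r) + f x"
    using x
  proof (induction "f x" arbitrary: x rule: less_induct)
    case less
    show ?case
    proof (cases "x = r")
      case False
      then obtain z where z: "E x z" "f x = f z + 1" using f_down less.prems by blast
      then have "adj G (cp s z) (cp s x)" using E_sym by (simp add: adj_cp)
      then have "gdist G v (cp s x) \<le> gdist G v (cp s z) + 1" by (rule gdist_adj_le[OF vG])
      moreover have "gdist G v (cp s z) \<le> gdist G v (cp s r) + f z" using less.hyps[of z] z E_V2 by auto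
      ultimately show ?thesis using z(2) by simp
    qed simp
  qed
  define \<psi> where "\<psi> m = int (if pt m \<noteq> r \<and> side TYPE('a) m = s
      then gdist G v (cp s r) + f (pt m) else gdist G v m)" for m
  have same: "\<psi> (cp s z) = int (gdist G v (cp s r) + f z)" for z
    unfolding \<psi>_def by (auto simp: f_root)
  have other: "\<psi> (cp t' z) = int (gdist G v (cp t' z))" if "t' \<noteq> s" for t' z
    unfolding \<psi>_def using that by auto
  have "\<psi> n \<le> \<psi> m + 1" if "adj G m n" for m n
  proof -
    obtain s' a b where ab: "m = cp s' a" "n = cp s' b" "E a b" using \<open>adj G m n\<close> unfolding adj_G by blast
    show ?thesis
      using same other[of s'] f_step[OF ab(3)] gdist_adj_le[OF vG that] ab by (cases "s' = s") auto
  qed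
  then have "\<psi> (cp s x) - \<psi> v \<le> int (gdist G v (cp s x))"
    by (rule gdist_ge_potential) (use vG x in \<open>auto simp: cp_in_G\<close>)
  moreover have "\<psi> v = 0"
  proof (cases "y = r")
    case True
    then have "v = cp s r" using v copy_root by simp
    then show ?thesis using same[of r] f_root vG by simp
  next
    case False
    then show ?thesis using other[of t y] v vG by simp
  qed
  ultimately show "gdist G v (cp s r) + f x \<le> gdist G v (cp s x)" using same[of x] by simp
qed

lemma gdist_root: "x \<in> V \<Longrightarrow> gdist G (cp s r) (cp s x) = f x"
  using gdist_across[of "cp s r" s r s x] root by (simp add: cp_in_G)

text \<open>
  On the far side of \<open>v\<close>, distances from \<open>v\<close> are heights up to a constant, so local maxima of the height
  are local maxima of the distance from \<open>v\<close>.
\<close>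

lemma local_max_is_end:
  assumes v: "v = cp t y" "y \<in> V" "t \<noteq> s" and x: "x \<in> V" "x \<noteq> r" "\<And>y. E x y \<Longrightarrow> f y \<le> f x"
    and q: "rooted_isometric_path G v q" "cp s x \<in> set q"
  shows "{hd q, last q} = {v, cp s x}"
proof (rule rooted_path_ends_at_local_max[OF q])
  show "cp s x \<noteq> v" using v x by (auto simp: copy_eq_iff)
  fix u assume "adj G (cp s x) u"
  then obtain z where z: "u = cp s z" "E x z" using adj_cpD x(2) by blast
  then have "z \<in> V" using E_V E_sym by blast
  then show "gdist G v u \<le> gdist G v (cp s x)"
    using gdist_across[OF v(1,2)] v(3) x z by auto
qed

text \<open>
  A potential of one copy that vanishes at the root extends to the double by zero.
\<close>

lemma isometric_copy:
  fixes \<phi> :: "'a \<Rightarrow> int"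
  assumes \<phi>: "\<phi> r = 0" "\<And>x y. E x y \<Longrightarrow> \<phi> y \<le> \<phi> x + 1"
    and p: "p \<noteq> []" "set p \<subseteq> V" "\<And>i. Suc i < length p \<Longrightarrow> E (p ! i) (p ! Suc i)"
    and pot: "\<And>i. i < length p \<Longrightarrow> \<phi> (p ! i) = \<phi> (hd p) + int i"
  shows "isometric_path G (map (cp s) p)"
proof -
  define \<psi> where "\<psi> m = (if side TYPE('a) m = s \<and> pt m \<noteq> r then \<phi> (pt m) else 0)" for m
  have \<psi>: "\<psi> (cp t x) = (if t = s then \<phi> x else 0)" for t x
    unfolding \<psi>_def using \<phi>(1) by auto
  show ?thesis
  proof (rule isometric_by_potential[of \<psi>])
    show "\<psi> n \<le> \<psi> m + 1" if "adj G m n" for m n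
      using that \<phi>(2) unfolding adj_G by (auto simp: \<psi>)
    show "map (cp s) p \<noteq> []" "set (map (cp s) p) \<subseteq> verts G"
      using p cp_in_G by auto
    show "adj G (map (cp s) p ! i) (map (cp s) p ! Suc i)" if "Suc i < length (map (cp s) p)" for i
      using p(3) that by (simp add: adj_cp)
    show "\<psi> (map (cp s) p ! i) = \<psi> (hd (map (cp s) p)) + int i" if "i < length (map (cp s) p)" for i
      using pot[of i] that p(1) by (simp add: \<psi> hd_map)
  qed
qed

text \<open>
  For a given \<open>v\<close> the copy of \<open>p\<close> on the other side is taken; a rooted path contains at most one of its local maxima,
  namely its end.
\<close>

lemma ipco_double_ge:
  fixes \<phi> :: "'a \<Rightarrow> int"
  assumes \<phi>: "\<phi> r = 0" "\<And>x y. E x y \<Longrightarrow> \<phi> y \<le> \<phi> x + 1"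
    and p: "p \<noteq> []" "set p \<subseteq> V" "\<And>i. Suc i < length p \<Longrightarrow> E (p ! i) (p ! Suc i)"
      "\<And>i. i < length p \<Longrightarrow> \<phi> (p ! i) = \<phi> (hd p) + int i"
    and M: "M \<subseteq> set p" "k \<le> card M" "\<And>x. x \<in> M \<Longrightarrow> x \<noteq> r" "\<And>x y. x \<in> M \<Longrightarrow> E x y \<Longrightarrow> f y \<le> f x"
  shows "k \<le> ipco G"
proof (rule ipco_ge)
  fix v assume "v \<in> verts G"
  then obtain t y where v: "v = cp t y" "y \<in> V" unfolding verts_G by blast
  let ?s = "\<not> t"
  have "inj_on (cp ?s) M" by (auto simp: inj_on_def copy_eq_iff)
  then have "k \<le> card (cp ?s ` M)" using M(2) by (simp add: card_image)
  moreover have "finite (cp ?s ` M)" using M(1) finite_subset by blast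
  moreover have "card (cp ?s ` M \<inter> set q) \<le> 1" if q: "rooted_isometric_path G v q" for q
  proof -
    have "{hd q, last q} = {v, cp ?s x}" "cp ?s x \<noteq> v" if "x \<in> M" "cp ?s x \<in> set q" for x
    proof -
      show "{hd q, last q} = {v, cp ?s x}"
        using that M p(2) by (intro local_max_is_end[OF v _ _ _ _ q]) auto
      show "cp ?s x \<noteq> v" using v M(3)[OF that(1)] by (auto simp: copy_eq_iff)
    qed
    then have "\<exists>e. e \<noteq> v \<and> a = e \<and> {hd q, last q} = {v, e}" if "a \<in> cp ?s ` M \<inter> set q" for a
      using that by blast
    then have "a = b" if "a \<in> cp ?s ` M \<inter> set q" "b \<in> cp ?s ` M \<inter> set q" for a b
      using that by (metis doubleton_eq_iff)
    then show ?thesis by (metis card_le_Suc0_iff_eq One_nat_def finite_Int finite_set)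
  qed
  ultimately show "\<exists>p S. isometric_path G p \<and> finite S \<and> S \<subseteq> set p \<and> k \<le> card S \<and>
      (\<forall>q. rooted_isometric_path G v q \<longrightarrow> card (S \<inter> set q) \<le> 1)"
    using isometric_copy[where \<phi> = \<phi>, OF \<phi> p, of ?s] M(1)
    by (intro exI[of _ "map (cp ?s) p"] exI[of _ "cp ?s ` M"]) auto
qed

text \<open>
  The quadruple consists of the root and the vertices \<open>0\<close>, \<open>a\<close>, \<open>b\<close> of the isometric path \<open>p\<close>. The
  distances to the root are heights, those along \<open>p\<close> are differences of indices.
\<close>

lemma hyperbolicity_double_ge:
  fixes \<phi> :: "'a \<Rightarrow> int"
  assumes \<phi>: "\<phi> r = 0" "\<And>x y. E x y \<Longrightarrow> \<phi> y \<le> \<phi> x + 1"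
    and p: "p \<noteq> []" "set p \<subseteq> V" "\<And>i. Suc i < length p \<Longrightarrow> E (p ! i) (p ! Suc i)"
      "\<And>i. i < length p \<Longrightarrow> \<phi> (p ! i) = \<phi> (hd p) + int i"
    and ab: "a \<le> b" "b < length p"
    and d: "f (p ! 0) + (b - a) + d \<le> f (p ! a) + b" "f (p ! b) + a + d \<le> f (p ! a) + b"
  shows "real d / 2 \<le> hyperbolicity G"
proof -
  have dist: "gdist G (cp True (p ! i)) (cp True (p ! j)) = j - i" if "i \<le> j" "j < length p" for i j
  proof -
    have q: "isometric_path G (map (cp True) (drop i p))"
      using that p set_drop_subset[of i p]
      by (intro isometric_copy[where \<phi> = \<phi>, OF \<phi>]) (auto simp: hd_drop_conv_nth)
    show ?thesis using isometric_nth[OF q, of "j - i"] that by (simp add: hd_map hd_drop_conv_nth)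
  qed
  have V: "p ! i \<in> V" if "i < length p" for i using p(2) that by auto
  show ?thesis
    by (rule hyperbolicity_ge[of "cp True r" "cp True (p ! a)" "cp True (p ! 0)" "cp True (p ! b)"])
      (use ab d p(1) in \<open>auto simp: cp_in_G root V gdist_root dist gdist_sym[of "cp True (p ! a)" "cp True (p ! 0)"]\<close>)
qed

text \<open>
  Different local maxima on the far side of \<open>v\<close> are ends of different paths of the cover.
\<close>

lemma rooted_cover_ge:
  assumes M: "M \<subseteq> V" "r \<notin> M" "\<And>x y. x \<in> M \<Longrightarrow> E x y \<Longrightarrow> f y \<le> f x"
    and v: "v \<in> verts G" and P: "rooted_isometric_path_cover G v P"
  shows "card M \<le> card P"
proof -
  obtain t y where v: "v = cp t y" "y \<in> V" using v unfolding verts_G by blast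
  let ?s = "\<not> t"
  have P1: "\<And>q. q \<in> P \<Longrightarrow> rooted_isometric_path G v q" and P2: "verts G \<subseteq> (\<Union>q\<in>P. set q)"
    using P unfolding rooted_isometric_path_cover_def isometric_path_cover_def by auto
  have "\<exists>q. q \<in> P \<and> cp ?s x \<in> set q" if x: "x \<in> M" for x
  proof -
    have "cp ?s x \<in> verts G" using x M(1) cp_in_G by auto
    then show ?thesis using P2 by auto
  qed
  then obtain q where q: "\<And>x. x \<in> M \<Longrightarrow> q x \<in> P \<and> cp ?s x \<in> set (q x)" by metis
  have ends: "{hd (q x), last (q x)} = {v, cp ?s x}" if "x \<in> M" for x
    using q[OF that] P1 that M by (intro local_max_is_end[OF v]) auto
  have "inj_on q M"
  proof (rule inj_onI)
    fix x x' assume x: "x \<in> M" "x' \<in> M" "q x = q x'"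
    then have "{v, cp ?s x} = {v, cp ?s x'}" using ends by metis
    moreover have "cp ?s x \<noteq> v" "cp ?s x' \<noteq> v" using x M(2) v by (auto simp: copy_eq_iff)
    ultimately show "x = x'" by (auto simp: doubleton_eq_iff copy_eq_iff)
  qed
  moreover have "P \<subseteq> {p. set p \<subseteq> verts G \<and> distinct p}"
    using P1 unfolding rooted_isometric_path_def isometric_path_def is_path_def by auto
  then have "finite P"
    using finite_subset_distinct simple unfolding simple_graph_def by (metis finite_subset)
  ultimately show ?thesis using card_inj_on_le[of q M P] q by auto
qed

text \<open>
  Two copies of a geodesic from the root form one isometric path through the root, because
  the height, taken with opposite signs on the two sides, is a potential.
\<close>

lemma isometric_through_root:
  assumes g: "g 0 = r" "\<And>i. i < h \<Longrightarrow> E (g i) (g (Suc i))" "\<And>i. i \<le> h \<Longrightarrow> f (g i) = i"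
  shows "isometric_path G (map (\<lambda>i. if i < h then cp False (g (h - i)) else cp True (g (i - h))) [0..<2 * h + 1])"
proof -
  define \<psi> where "\<psi> m = (if side TYPE('a) m then int (f (pt m)) else - int (f (pt m)))" for m
  have \<psi>: "\<psi> (cp s x) = (if s then int (f x) else - int (f x))" for s x
    unfolding \<psi>_def by (auto simp: f_root)
  have E: "E (g i) (g (Suc i))" "E (g (Suc i)) (g i)" if "i < h" for i using g(2)[OF that] E_sym by auto
  have gV: "g i \<in> V" if "i \<le> h" for i
    using g(1) root E_V E(2)[of "i - 1"] that by (cases i) auto
  define p where "p = map (\<lambda>i. if i < h then cp False (g (h - i)) else cp True (g (i - h))) [0..<2 * h + 1]"
  have len: "length p = 2 * h + 1" by (simp add: p_def)
  have nth: "p ! i = (if i < h then cp False (g (h - i)) else cp True (g (i - h)))" if "i < length p" for i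
    using that unfolding p_def by (simp del: upt_Suc)
  have "hd p = p ! 0" using len by (intro hd_conv_nth) auto
  then have hd: "hd p = cp False (g h)" using nth[of 0] len g(1) copy_root[of r False True] by auto
  have "isometric_path G p"
  proof (rule isometric_by_potential[of \<psi>])
    show "\<psi> n \<le> \<psi> m + 1" if "adj G m n" for m n
      using that f_step E_sym unfolding adj_G by (fastforce simp: \<psi>)
    show "p \<noteq> []" using len by auto
    show "set p \<subseteq> verts G" using gV unfolding p_def by (auto simp: cp_in_G)
    show "adj G (p ! i) (p ! Suc i)" if i: "Suc i < length p" for i
    proof -
      consider "Suc i < h" | "Suc i = h" | "h \<le> i" by linarith
      then show ?thesis
      proof cases
        case 1
        then show ?thesis using E(2)[of "h - Suc i"] i by (simp add: nth adj_cp Suc_diff_Suc)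
      next
        case 2
        then show ?thesis using E(2)[of 0] i g(1) by (auto simp: nth adj_cp)
      next
        case 3
        then show ?thesis using E(1)[of "i - h"] i len by (simp add: nth adj_cp Suc_diff_le)
      qed
    qed
    show "\<psi> (p ! i) = \<psi> (hd p) + int i" if "i < length p" for i
      using that len g(3) unfolding hd nth[OF that] by (auto simp: \<psi>)
  qed
  then show ?thesis unfolding p_def .
qed

end

context rooted_graph
begin

text \<open>
  A neighbour \<open>u\<close> that is dull for \<open>w\<close> cannot lie on the rim of a wheel with hub \<open>w\<close>.
\<close>

definition dull :: "'a \<Rightarrow> 'a \<Rightarrow> bool" where
  "dull w u \<longleftrightarrow> (\<forall>p q. E u p \<longrightarrow> E u q \<longrightarrow> p \<noteq> w \<longrightarrow> q \<noteq> w \<longrightarrow> p \<noteq> q \<longrightarrow> E p q)"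

lemma dull_if_two_neighbours:
  assumes "E w u" "\<And>p. E u p \<Longrightarrow> p = a \<or> p = b" shows "dull w u"
  using assms E_sym unfolding dull_def by metis

lemma dull_if_triangle:
  assumes "E a b" "\<And>p. E u p \<Longrightarrow> p = w \<or> p = a \<or> p = b" shows "dull w u"
  using assms E_sym unfolding dull_def by metis

lemma dull_cp:
  assumes "dull w u" "u \<noteq> r" "adj G (cp s u) m" "adj G (cp s u) n" "m \<noteq> cp s w" "n \<noteq> cp s w" "m \<noteq> n"
  shows "adj G m n"
proof -
  obtain p q where "m = cp s p" "E u p" "n = cp s q" "E u q"
    using adj_cpD[OF assms(3,2)] adj_cpD[OF assms(4,2)] by blast
  then show ?thesis using assms unfolding dull_def by (auto simp: adj_cp copy_eq_iff)
qed

text \<open>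
  The local test for wheels, on one copy. Every neighbour of the root must be dull, since the root has
  neighbours in both copies. The root itself needs an exception: it is harmless as a
  neighbour of \<open>w\<close> when \<open>w\<close> is its only neighbour in the copy, as it then has degree 2 in the double.
\<close>

lemma wheel_free_double:
  assumes loc: "\<And>w. w \<in> V \<Longrightarrow> w \<noteq> r \<Longrightarrow> \<exists>A B. \<forall>u. E w u \<longrightarrow> u = A \<or> u = B \<or>
        u \<noteq> r \<and> dull w u \<or> u = r \<and> (\<forall>y. E r y \<longrightarrow> y = w)"
    and rt: "\<And>u. E r u \<Longrightarrow> dull r u"
  shows "free_of wheel G"
proof (rule wheel_free_local)
  fix w
  let ?D = "\<lambda>u. \<forall>p q. adj G u p \<longrightarrow> adj G u q \<longrightarrow> p \<noteq> w \<longrightarrow> q \<noteq> w \<longrightarrow> p \<noteq> q \<longrightarrow> adj G p q"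
  show "\<exists>A B. \<forall>u. adj G w u \<longrightarrow> u = A \<or> u = B \<or> ?D u"
  proof (cases "\<exists>s x. w = cp s x \<and> x \<in> V")
    case True
    then obtain s x where w: "w = cp s x" "x \<in> V" by blast
    show ?thesis
    proof (cases "x = r")
      case True
      have "?D u" if wu: "adj G w u" for u
      proof -
        obtain t y where y: "u = cp t y" "E r y" "y \<noteq> r" using adj_rootD wu w True by blast
        have "w = cp t r" using w True copy_root by simp
        then show ?thesis using dull_cp[OF rt[OF y(2)] y(3)] y(1) by blast
      qed
      then show ?thesis by blast
    next
      case False
      obtain A B where AB: "\<And>u. E x u \<Longrightarrow> u = A \<or> u = B \<or>
          u \<noteq> r \<and> dull x u \<or> u = r \<and> (\<forall>y. E r y \<longrightarrow> y = x)" using loc[OF w(2) False] by blast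
      have root_dull: "?D u" if u: "u = cp s r" "\<And>y. E r y \<Longrightarrow> y = x" for u
      proof -
        have "p = w" if p: "adj G u p" "q \<noteq> w" "adj G u q" "p \<noteq> q" for p q
        proof -
          obtain t y t' y' where "p = cp t y" "E r y" "q = cp t' y'" "E r y'"
            using adj_rootD p(1,3) u(1) by meson
          then have "p = cp t x" "q = cp t' x" using u(2) by auto
          then show ?thesis using p(2,4) w(1) by (cases s; cases t; cases t') auto
        qed
        then show ?thesis by blast
      qed
      have "u = cp s A \<or> u = cp s B \<or> ?D u" if wu: "adj G w u" for u
      proof -
        obtain y where y: "u = cp s y" "E x y" using adj_cpD wu w False by blast
        then show ?thesis using AB[OF y(2)] dull_cp[of x y s] root_dull[of u] w by blast
      qed
      then show ?thesis by blast
    qed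
  next
    case False
    then have "\<not> adj G w u" for u using adj_verts(1)[OF simple_G, of w u] unfolding verts_G by blast
    then show ?thesis by blast
  qed
qed

definition claw_centre :: "'a \<Rightarrow> bool" where
  "claw_centre a \<longleftrightarrow> (\<exists>x y z. E a x \<and> E a y \<and> E a z \<and> x \<noteq> y \<and> x \<noteq> z \<and> y \<noteq> z \<and>
     \<not> E x y \<and> \<not> E x z \<and> \<not> E y z)"

lemma no_claw_two_neighbours:
  assumes "\<And>p. E u p \<Longrightarrow> p = a \<or> p = b" shows "\<not> claw_centre u"
  using assms unfolding claw_centre_def by metis

lemma no_claw_triangle:
  assumes "E a b" "\<And>p. E u p \<Longrightarrow> p = a \<or> p = b \<or> p = c" shows "\<not> claw_centre u"
  using assms E_sym unfolding claw_centre_def by metis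

lemma claw_only_at_root:
  assumes "\<And>a. a \<in> V \<Longrightarrow> a \<noteq> r \<Longrightarrow> \<not> claw_centre a" and claw: "claw_at G m"
  shows "m = cp True r"
proof (rule ccontr)
  assume ne: "m \<noteq> cp True r"
  obtain x y z where xyz: "adj G m x" "adj G m y" "adj G m z" "x \<noteq> y" "x \<noteq> z" "y \<noteq> z"
    "\<not> adj G x y" "\<not> adj G x z" "\<not> adj G y z" using claw unfolding claw_at_def by blast
  obtain s a where a: "m = cp s a" "a \<in> V" using adj_verts(1)[OF simple_G xyz(1)] unfolding verts_G by blast
  then have ar: "a \<noteq> r" using ne copy_root by metis
  obtain x' where x': "x = cp s x'" "E a x'" using adj_cpD[OF xyz(1)[unfolded a(1)] ar] by blast
  obtain y' where y': "y = cp s y'" "E a y'" using adj_cpD[OF xyz(2)[unfolded a(1)] ar] by blast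
  obtain z' where z': "z = cp s z'" "E a z'" using adj_cpD[OF xyz(3)[unfolded a(1)] ar] by blast
  note * = x' y' z'
  then have "claw_centre a" unfolding claw_centre_def using xyz by (auto simp: adj_cp)
  with assms(1) a ar show False by blast
qed

text \<open>
  A root of degree 1 has degree 2 in the double.
\<close>

lemma no_claw_at_pendant_root:
  assumes "\<And>y y'. E r y \<Longrightarrow> E r y' \<Longrightarrow> y = y'"
  shows "\<not> claw_at G (cp True r)"
proof
  assume "claw_at G (cp True r)"
  then obtain x y z where xyz: "adj G (cp True r) x" "adj G (cp True r) y" "adj G (cp True r) z"
    "x \<noteq> y" "x \<noteq> z" "y \<noteq> z" unfolding claw_at_def by blast
  obtain s1 x' s2 y' s3 z' where "x = cp s1 x'" "E r x'" "y = cp s2 y'" "E r y'" "z = cp s3 z'" "E r z'"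
    using xyz(1-3) adj_rootD by meson
  moreover from this have "x' = y'" "x' = z'" using assms by blast+
  ultimately show False using xyz(4-6) by (cases s1; cases s2; cases s3) auto
qed

lemma two_coloured_double:
  fixes c :: "'a \<Rightarrow> bool"
  assumes c: "\<And>x y. E x y \<Longrightarrow> c x \<noteq> c y"
  shows "free_of pyramid G" "free_of prism G" "bipartite G"
proof -
  have col: "c (pt m) \<noteq> c (pt n)" if "adj G m n" for m n
    using that c unfolding adj_G by auto
  show "free_of pyramid G" "free_of prism G"
    using pyramid_free_if_two_coloured[of G "\<lambda>m. c (pt m)"] prism_free_if_two_coloured[of G "\<lambda>m. c (pt m)"] col
    by blast+
  let ?A = "{m \<in> verts G. c (pt m)}" and ?B = "{m \<in> verts G. \<not> c (pt m)}"
  have "\<exists>a\<in>?A. \<exists>b\<in>?B. e = {a, b}" if eG: "e \<in> edges G" for e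
  proof -
    obtain s x y where "e = {cp s x, cp s y}" "E x y" using eG by (auto simp: double_def)
    then obtain m n where e: "e = {m, n}" "adj G m n" using adj_cp by metis
    then have "m \<in> verts G" "n \<in> verts G" using adj_verts[OF simple_G] by blast+
    then show ?thesis
      using col[OF e(2)] e(1) by (cases "c (pt m)") (auto simp: insert_commute)
  qed
  then show "bipartite G" unfolding bipartite_def by (intro exI[of _ ?A] exI[of _ ?B]) auto
qed

text \<open>
  The copies are thought of as sequences of blocks, numbered by \<open>idx\<close>; every triangle lies in one block and
  contains the tip of the block, so disjoint triangles lie in different blocks or on different sides.
  Apart from the root, all connections from the blocks up to \<open>j\<close> to the later ones pass through \<open>gate j\<close>.
  So the root and one gate separate two disjoint triangles.
\<close>

lemma prism_free_double:
  fixes idx :: "'a \<Rightarrow> int" and gate :: "int \<Rightarrow> 'a"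
  assumes cut: "\<And>x y j. \<lbrakk>E x y; x \<noteq> r; y \<noteq> r; idx x \<le> j; j < idx y\<rbrakk> \<Longrightarrow> x = gate j \<or> y = gate j"
    and tri: "\<And>x y z. \<lbrakk>E x y; E x z; E y z\<rbrakk> \<Longrightarrow> x \<noteq> r \<and> idx y = idx x"
    and tip: "\<And>x y z. \<lbrakk>E x y; E x z; E y z\<rbrakk> \<Longrightarrow> tip (idx x) \<in> {x, y, z}"
  shows "free_of prism G"
proof (rule prism_free_if_two_cuts)
  have T: "\<exists>s x y z. m = cp s x \<and> n = cp s y \<and> l = cp s z \<and> E x y \<and> E x z \<and> E y z \<and>
      x \<noteq> r \<and> y \<noteq> r \<and> z \<noteq> r \<and> idx y = idx x \<and> idx z = idx x \<and> tip (idx x) \<in> {x, y, z}"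
    if mnl: "adj G m n" "adj G m l" "adj G n l" for m n l
  proof -
    obtain s x y where xy: "m = cp s x" "n = cp s y" "E x y" using mnl(1) unfolding adj_G by blast
    obtain z where z: "l = cp s z" using adj_cpD[of s x l] adj_cpD[of s y l] mnl xy E_irrefl by metis
    have e: "E x z" "E y z" using mnl xy z by (simp_all add: adj_cp)
    note E' = E_sym[OF xy(3)] E_sym[OF e(1)] E_sym[OF e(2)]
    have "x \<noteq> r" "idx y = idx x" using tri[OF xy(3) e] by auto
    moreover have "y \<noteq> r" using tri[OF E'(1) e(2) e(1)] by auto
    moreover have "z \<noteq> r" "idx z = idx x" using tri[OF E'(2,3) xy(3)] by auto
    ultimately show ?thesis using tip[OF xy(3) e] xy e z by (intro exI conjI)
  qed
  define X where "X s j = {cp s x | x. x \<noteq> r \<and> idx x \<le> j}" for s j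
  have X: "cp t x \<in> X s j \<longleftrightarrow> x \<noteq> r \<and> t = s \<and> idx x \<le> j" for t x s j
    unfolding X_def by (auto simp: copy_eq_iff)
  have cutset: "\<forall>u v. adj G u v \<longrightarrow> u \<in> X s j \<longrightarrow> v \<notin> X s j \<longrightarrow>
      u \<in> {cp True r, cp s (gate j)} \<or> v \<in> {cp True r, cp s (gate j)}" for s j
  proof (intro allI impI)
    fix u v assume uv: "adj G u v" "u \<in> X s j" "v \<notin> X s j"
    obtain x where x: "u = cp s x" "x \<noteq> r" "idx x \<le> j" using uv(2) unfolding X_def by blast
    obtain y where y: "v = cp s y" "E x y" using adj_cpD[OF uv(1)[unfolded x(1)] x(2)] by blast
    show "u \<in> {cp True r, cp s (gate j)} \<or> v \<in> {cp True r, cp s (gate j)}"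
    proof (cases "y = r")
      case True
      then show ?thesis using y copy_root[of r s True] by simp
    next
      case False
      then have "j < idx y" using uv(3) y by (simp add: X)
      then show ?thesis using cut[OF y(2) x(2) False x(3)] x y by auto
    qed
  qed
  fix a1 a2 a3 b1 b2 b3
  assume a: "adj G a1 a2" "adj G a1 a3" "adj G a2 a3" and b: "adj G b1 b2" "adj G b1 b3" "adj G b2 b3"
    and disj: "{a1, a2, a3} \<inter> {b1, b2, b3} = {}"
  obtain s x y z where A: "a1 = cp s x" "a2 = cp s y" "a3 = cp s z" "x \<noteq> r" "y \<noteq> r" "z \<noteq> r"
    "idx y = idx x" "idx z = idx x" "tip (idx x) \<in> {x, y, z}"
    using T[OF a] by (elim exE conjE) (rule that; assumption)
  obtain s' x' y' z' where B: "b1 = cp s' x'" "b2 = cp s' y'" "b3 = cp s' z'" "x' \<noteq> r" "y' \<noteq> r" "z' \<noteq> r"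
    "idx y' = idx x'" "idx z' = idx x'" "tip (idx x') \<in> {x', y', z'}"
    using T[OF b] by (elim exE conjE) (rule that; assumption)
  have "cp s (tip (idx x)) \<in> {a1, a2, a3}" "cp s' (tip (idx x')) \<in> {b1, b2, b3}"
    using A(1-3,9) B(1-3,9) by auto
  then have "cp s (tip (idx x)) \<noteq> cp s' (tip (idx x'))" by (rule disjoint_iff_not_equal[THEN iffD1, OF disj, rule_format])
  then have "s \<noteq> s' \<or> idx x \<noteq> idx x'" by (cases s; cases s') auto
  then consider "s \<noteq> s' \<or> idx x < idx x'" | "s = s'" "idx x' < idx x" by linarith
  then show "\<exists>X z z'. (\<forall>a\<in>{a1, a2, a3}. \<forall>b\<in>{b1, b2, b3}. a \<in> X \<longleftrightarrow> b \<notin> X) \<and>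
       (\<forall>u v. adj G u v \<longrightarrow> u \<in> X \<longrightarrow> v \<notin> X \<longrightarrow> u \<in> {z, z'} \<or> v \<in> {z, z'})"
  proof cases
    case 1
    then have "\<forall>a\<in>{a1, a2, a3}. \<forall>b\<in>{b1, b2, b3}. a \<in> X s (idx x) \<longleftrightarrow> b \<notin> X s (idx x)"
      using A(4-8) B(4-8) unfolding A(1-3) B(1-3) by (simp add: X) linarith
    then show ?thesis using cutset[of s "idx x"] by (intro exI conjI)
  next
    case 2
    then have "\<forall>a\<in>{a1, a2, a3}. \<forall>b\<in>{b1, b2, b3}. a \<in> X s (idx x') \<longleftrightarrow> b \<notin> X s (idx x')"
      using A(4-8) B(4-8) unfolding A(1-3) B(1-3) by (simp add: X)
    then show ?thesis using cutset[of s "idx x'"] by (intro exI conjI)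
  qed
qed

lemma tree_decomposition_double:
  fixes rank :: "'a \<Rightarrow> nat"
  assumes par: "\<And>t. t \<in> V \<Longrightarrow> t \<noteq> r \<Longrightarrow> par t \<in> V \<and> rank (par t) < rank t"
    and bag: "\<And>t. t \<in> V \<Longrightarrow> t \<in> bag t \<and> bag t \<subseteq> V \<and> card (bag t) \<le> w + 1"
    and bag_r: "bag r = {r}"
    and bag_par: "\<And>t. t \<in> V \<Longrightarrow> t \<noteq> r \<Longrightarrow> bag t \<subseteq> insert t (bag (par t))"
    and edge: "\<And>x y. E x y \<Longrightarrow> \<exists>t\<in>V. {x, y} \<subseteq> bag t"
  obtains T :: "nat ugraph" and bag' where "tree_decomposition G T bag'" "decomposition_width T bag' \<le> w"
proof -
  define par' where "par' m = cp (side TYPE('a) m) (par (pt m))" for m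
  define bag' where "bag' m = cp (side TYPE('a) m) ` bag (pt m)" for m
  define rank' where "rank' m = rank (pt m :: 'a)" for m
  have par': "par' (cp s x) = cp s (par x)" if "x \<noteq> r" for s x unfolding par'_def using that by simp
  have bag': "bag' (cp s x) = cp s ` bag x" for s x
    unfolding bag'_def using bag_r copy_root[of r s True] by (cases "x = r") auto
  note criterion = tree_decomposition_by_parents[of G "cp True r" par' rank' bag' w]
  have hyps: "simple_graph G" "cp True r \<in> verts G"
    "\<And>t. t \<in> verts G \<Longrightarrow> t \<noteq> cp True r \<Longrightarrow> par' t \<in> verts G \<and> rank' (par' t) < rank' t"
    "\<And>t. t \<in> verts G \<Longrightarrow> t \<in> bag' t \<and> bag' t \<subseteq> verts G \<and> card (bag' t) \<le> w + 1"
    "bag' (cp True r) = {cp True r}"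
    "\<And>t. t \<in> verts G \<Longrightarrow> t \<noteq> cp True r \<Longrightarrow> bag' t \<subseteq> insert t (bag' (par' t))"
    "\<And>x y. adj G x y \<Longrightarrow> \<exists>t\<in>verts G. {x, y} \<subseteq> bag' t"
  proof -
    show "simple_graph G" by (rule simple_G)
    show "cp True r \<in> verts G" by (simp add: cp_in_G root)
    show "bag' (cp True r) = {cp True r}" by (simp add: bag' bag_r)
    fix t assume "t \<in> verts G"
    then obtain s x where t: "t = cp s x" "x \<in> V" unfolding verts_G by blast
    have "card (cp s ` bag x) \<le> card (bag x)"
      using bag[OF t(2)] finite_V by (intro card_image_le) (auto intro: finite_subset)
    then show "t \<in> bag' t \<and> bag' t \<subseteq> verts G \<and> card (bag' t) \<le> w + 1"
      using bag[OF t(2)] unfolding t bag' by (auto simp: cp_in_G)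
    assume "t \<noteq> cp True r"
    then have x: "x \<noteq> r" using t copy_root by metis
    show "par' t \<in> verts G \<and> rank' (par' t) < rank' t"
      using par[OF t(2) x] unfolding t par'[OF x] rank'_def by (simp add: cp_in_G)
    show "bag' t \<subseteq> insert t (bag' (par' t))"
      using bag_par[OF t(2) x] unfolding t par'[OF x] bag' by blast
  next
    fix m n assume "adj G m n"
    then obtain s x y where "m = cp s x" "n = cp s y" "E x y" unfolding adj_G by blast
    moreover from this obtain z where "z \<in> V" "{x, y} \<subseteq> bag z" using edge by blast
    ultimately have "cp s z \<in> verts G" "{m, n} \<subseteq> bag' (cp s z)" by (auto simp: cp_in_G bag')
    then show "\<exists>t\<in>verts G. {m, n} \<subseteq> bag' t" by blast
  qed
  show ?thesis using that[OF criterion(1,2)] hyps by blast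
qed

text \<open>
  A level drawing of the rooted graph in the half-plane \<open>px \<ge> 0\<close>, with the root at the
  origin and all other vertices of level 0 above it, is completed by its image under the rotation by 180 degrees.
\<close>

lemma planar_double:
  fixes px py :: "'a \<Rightarrow> int"
  assumes rt: "px r = 0" "py r = 0"
    and pos: "\<And>x. x \<in> V \<Longrightarrow> 0 \<le> px x" "\<And>x. x \<in> V \<Longrightarrow> x \<noteq> r \<Longrightarrow> px x = 0 \<Longrightarrow> 0 < py x"
    and inj: "\<And>u v. \<lbrakk>u \<in> V; v \<in> V; px u = px v; py u = py v\<rbrakk> \<Longrightarrow> u = v"
    and near: "\<And>u v. E u v \<Longrightarrow> px u < px v \<Longrightarrow> px v = px u + 1"
    and level: "\<And>u v w. \<lbrakk>E u v; px u = px v; w \<in> V; px w = px u; py u < py w; py w < py v\<rbrakk> \<Longrightarrow> False"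
    and mono: "\<And>u v u' v'. \<lbrakk>E u v; E u' v'; px v = px u + 1; px u' = px u; px v' = px v; py u < py u'\<rbrakk> \<Longrightarrow> py v \<le> py v'"
  shows "planar G"
proof -
  define sg :: "nat \<Rightarrow> int" where "sg m = (if side TYPE('a) m then 1 else - 1)" for m
  define qx where "qx m = sg m * px (pt m)" for m
  define qy where "qy m = sg m * py (pt m)" for m
  have q: "qx (cp s x) = (if s then px x else - px x)" "qy (cp s x) = (if s then py x else - py x)" for s x
    unfolding qx_def qy_def sg_def using rt by auto
  have low: "0 \<le> py x" if "x \<in> V" "px x = 0" for x using pos(2)[OF that(1)] that rt by force
  show ?thesis
  proof (rule planar_level_drawing[OF simple_G, of qx qy])
    fix u v assume "u \<in> verts G" "v \<in> verts G" and e: "qx u = qx v" "qy u = qy v"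
    then obtain s x t y where uv: "u = cp s x" "x \<in> V" "v = cp t y" "y \<in> V" unfolding verts_G by blast
    show "u = v"
    proof (cases "s = t")
      case True
      then show ?thesis using e uv inj[of x y] by (auto simp: q split: if_splits)
    next
      case False
      then have z: "px x = 0" "px y = 0" using e uv pos(1)[of x] pos(1)[of y] by (auto simp: q split: if_splits)
      then have "py x = 0" "py y = 0" using e uv low[of x] low[of y] False by (auto simp: q split: if_splits)
      then show ?thesis using uv z pos(2)[of x] pos(2)[of y] copy_root by force
    qed
  next
    fix u v assume a: "adj G u v" and lt: "qx u < qx v"
    then obtain s x y where "u = cp s x" "v = cp s y" "E x y" unfolding adj_G by blast
    then show "qx v = qx u + 1" using lt near[of x y] near[of y x] E_sym[of x y] by (auto simp: q split: if_splits)
  next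
    fix u v w assume a: "adj G u v" "qx u = qx v" "w \<in> verts G" "qx w = qx u" "qy u < qy w" "qy w < qy v"
    then obtain s x y t z where *: "u = cp s x" "v = cp s y" "E x y" "w = cp t z" "z \<in> V"
      unfolding adj_G verts_G by blast
    have V: "x \<in> V" "y \<in> V" using * E_V E_V2 by auto
    show False
    proof (cases "s = t")
      case True
      then show ?thesis
        using a * level[of x y z] level[of y x z] E_sym by (auto simp: q split: if_splits)
    next
      case False
      then have "px x = 0" "px z = 0" "px y = 0"
        using a * V pos(1)[of x] pos(1)[of z] by (auto simp: q split: if_splits)
      then show ?thesis using a * V False low[of x] low[of y] low[of z] by (auto simp: q split: if_splits)
    qed
  next
    fix u v u' v'
    assume a: "adj G u v" "adj G u' v'" "qx v = qx u + 1" "qx u' = qx u" "qx v' = qx v" "qy u < qy u'"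
    obtain s x y where *: "u = cp s x" "v = cp s y" "E x y" using a(1) unfolding adj_G by blast
    obtain t x' y' where **: "u' = cp t x'" "v' = cp t y'" "E x' y'" using a(2) unfolding adj_G by blast
    have V: "x \<in> V" "y \<in> V" "x' \<in> V" "y' \<in> V" using * ** E_V E_V2 by auto
    have st: "s = t"
      using a * ** pos(1)[OF V(1)] pos(1)[OF V(2)] pos(1)[OF V(3)] pos(1)[OF V(4)]
      by (auto simp: q split: if_splits)
    show "qy v \<le> qy v'"
    proof (cases s)
      case True
      then show ?thesis using a * ** st mono[of x y x' y'] by (simp add: q)
    next
      case False
      then show ?thesis
        using a * ** st mono[of y x y' x'] E_sym by (fastforce simp: q)
    qed
  qed
qed

end

section \<open>Fans\<close>

type_synonym point = "int \<times> int"

text \<open>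
  A fan with \<open>n + 1\<close> spokes and \<open>m\<close> levels. The first coordinate is the distance from the root along the spokes; the
  even values of the second coordinate are the spokes, and the odd ones are midpoints of the edges that the levels
  would have between consecutive spokes. Levels start beyond height \<open>2 * n\<close>: a level
  has length \<open>2 * n\<close>, and at a height below \<open>n\<close> its ends would be closer through the root.
\<close>

definition fan_verts :: "int \<Rightarrow> int \<Rightarrow> point set" where
  "fan_verts n m = {(x, y). x = 0 \<and> y = 0 \<or>
     1 \<le> x \<and> x \<le> 2 * n + m \<and> 0 \<le> y \<and> y \<le> 2 * n \<and> (even y \<or> 2 * n < x)}"

fun fan_arc :: "int \<Rightarrow> point \<Rightarrow> point \<Rightarrow> bool" where
  "fan_arc n (x, y) (x', y') \<longleftrightarrow>
     x' = x + 1 \<and> even y' \<and> (y' = y \<or> x = 0) \<or> x' = x \<and> 2 * n < x \<and> y' = y + 1"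

definition fan_adj :: "int \<Rightarrow> int \<Rightarrow> point \<Rightarrow> point \<Rightarrow> bool" where
  "fan_adj n m p q \<longleftrightarrow> p \<in> fan_verts n m \<and> q \<in> fan_verts n m \<and> (fan_arc n p q \<or> fan_arc n q p)"

lemma fan_verts_iff: "(x, y) \<in> fan_verts n m \<longleftrightarrow> x = 0 \<and> y = 0 \<or>
     1 \<le> x \<and> x \<le> 2 * n + m \<and> 0 \<le> y \<and> y \<le> 2 * n \<and> (even y \<or> 2 * n < x)"
  by (simp add: fan_verts_def)

lemma fan_adj_iff: "fan_adj n m (x, y) (x', y') \<longleftrightarrow>
    (x, y) \<in> fan_verts n m \<and> (x', y') \<in> fan_verts n m \<and> (fan_arc n (x, y) (x', y') \<or> fan_arc n (x', y') (x, y))"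
  by (simp add: fan_adj_def)

fun fan_height :: "point \<Rightarrow> nat" where
  "fan_height (x, y) = nat x + (if odd y then 1 else 0)"

lemma fan_rooted:
  assumes n: "1 \<le> n" and m: "1 \<le> m"
  shows "rooted_graph (fan_verts n m) (fan_adj n m) (0, 0) fan_height"
proof
  have "fan_verts n m \<subseteq> {0..2 * n + m} \<times> {0..2 * n}"
    unfolding fan_verts_def using n m by auto
  then show "finite (fan_verts n m)" by (rule finite_subset) auto
  show "(0, 0) \<in> fan_verts n m" by (simp add: fan_verts_def)
  fix p q
  show "fan_adj n m p q \<Longrightarrow> fan_adj n m q p" "fan_adj n m p q \<Longrightarrow> p \<in> fan_verts n m"
    by (auto simp: fan_adj_def)
  show "\<not> fan_adj n m p p" by (cases p) (auto simp: fan_adj_def)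
  show "fan_height (0, 0) = 0" by simp
  show "fan_height q \<le> fan_height p + 1" if "fan_adj n m p q"
  proof -
    obtain x y x' y' where pq: "p = (x, y)" "q = (x', y')" by (cases p; cases q)
    show ?thesis using that n unfolding pq fan_adj_def fan_verts_def
      by (auto simp: nat_add_distrib)
  qed
  show "\<exists>q. fan_adj n m p q \<and> fan_height p = fan_height q + 1" if "p \<in> fan_verts n m" "p \<noteq> (0, 0)"
  proof -
    obtain x y where p: "p = (x, y)" by (cases p)
    define q where "q = (if odd y then (x, y - 1) else if x = 1 then (0, 0) else (x - 1, y))"
    have "0 < y" if "odd y" "0 \<le> y" using that by (cases "y = 0") auto
    then have "fan_adj n m p q \<and> fan_height p = fan_height q + 1"
      using that n m unfolding p q_def fan_adj_def fan_verts_def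
      by (auto simp: nat_diff_distrib)
    then show ?thesis ..
  qed
qed

lemma fan_two_coloured: "fan_adj n m p q \<Longrightarrow> even (fst p + snd p) \<noteq> even (fst q + snd q)"
  by (cases p; cases q) (auto simp: fan_adj_def fan_verts_def)

text \<open>
  Beyond height \<open>2 * n\<close> this potential is the second coordinate, so it certifies that levels are
  isometric; cutting it off at the height makes it vanish at the root.
\<close>

lemma fan_potential:
  assumes "fan_adj n m p q" "1 \<le> n"
  shows "min (fst q) (snd q) \<le> min (fst p) (snd p) + 1"
  using assms by (cases p; cases q) (auto simp: fan_adj_def fan_verts_def)

lemma fan_neighbours_odd:
  "fan_adj n m (x, y) q \<Longrightarrow> odd y \<Longrightarrow> 1 \<le> n \<Longrightarrow> q = (x, y - 1) \<or> q = (x, y + 1)"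
  by (cases q) (auto simp: fan_adj_def fan_verts_def)

lemma fan_neighbours_first:
  "fan_adj n m (1, y) q \<Longrightarrow> 1 \<le> n \<Longrightarrow> q = (0, 0) \<or> q = (2, y)"
  by (cases q) (auto simp: fan_adj_def fan_verts_def)

lemma fan_neighbours_root:
  "fan_adj n m (0, 0) q \<Longrightarrow> 1 \<le> n \<Longrightarrow> fst q = 1"
  by (cases q) (auto simp: fan_adj_def fan_verts_def)

lemma fan_neighbours_even:
  "fan_adj n m (x, y) q \<Longrightarrow> even y \<Longrightarrow> (x, y) \<noteq> (0, 0) \<Longrightarrow> 1 \<le> n \<Longrightarrow>
     q = (if x = 1 then (0, 0) else (x - 1, y)) \<or> q = (x + 1, y) \<or> fst q = x \<and> odd (snd q)"
  by (cases q; simp only: fan_adj_def fan_arc.simps; elim conjE disjE; auto simp: fan_verts_def)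

lemma fan_adj_up: "fan_adj n m p q \<Longrightarrow> fst q = fst p + 1 \<Longrightarrow> snd q = snd p \<or> p = (0, 0)"
  by (cases p; cases q) (auto simp: fan_adj_def fan_verts_def)

lemma fan_verts_left: "p \<in> fan_verts n m \<Longrightarrow> fst p = 0 \<Longrightarrow> p = (0, 0)"
  by (cases p) (auto simp: fan_verts_def)

definition fan_level :: "int \<Rightarrow> int \<Rightarrow> point list" where
  "fan_level n h = map (\<lambda>i. (h, int i)) [0..<nat (2 * n) + 1]"

definition fan_mids :: "int \<Rightarrow> int \<Rightarrow> point set" where
  "fan_mids n m = {(x, y). 2 * n < x \<and> x \<le> 2 * n + m \<and> 0 \<le> y \<and> y \<le> 2 * n \<and> odd y}"

context
  fixes n m :: int
  assumes n: "1 \<le> n" and m: "1 \<le> m"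
begin

interpretation fan: rooted_graph "fan_verts n m" "fan_adj n m" "(0, 0)" fan_height
  using n m by (rule fan_rooted)

text \<open>
  Midpoints have degree 2 and so are dull, and so are the neighbours of the root. For any other vertex only its two
  neighbours along the spoke remain.
\<close>

lemma fan_wheel_free: "free_of wheel fan.G"
proof (rule fan.wheel_free_double)
  fix u assume u: "fan_adj n m (0, 0) u"
  then obtain y where y: "u = (1, y)" using fan_neighbours_root n by (metis prod.collapse)
  show "fan.dull (0, 0) u"
    using fan_neighbours_first[of n m y] n y by (intro fan.dull_if_two_neighbours[OF u]) blast
next
  fix w assume w: "w \<in> fan_verts n m" "w \<noteq> (0, 0)"
  obtain x y where xy: "w = (x, y)" by (cases w)
  show "\<exists>A B. \<forall>u. fan_adj n m w u \<longrightarrow> u = A \<or> u = B \<or>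
      u \<noteq> (0, 0) \<and> fan.dull w u \<or> u = (0, 0) \<and> (\<forall>y. fan_adj n m (0, 0) y \<longrightarrow> y = w)"
  proof (cases "odd y")
    case True
    then show ?thesis using fan_neighbours_odd[of n m x y] n unfolding xy by blast
  next
    case False
    have mid: "u \<noteq> (0, 0) \<and> fan.dull w u" if u: "fan_adj n m w u" "odd (snd u)" for u
      using u fan_neighbours_odd[of n m "fst u" "snd u"] n
      by (auto intro!: fan.dull_if_two_neighbours[OF u(1)])
    then show ?thesis using fan_neighbours_even[of n m x y] w n False unfolding xy by blast
  qed
qed

lemma fan_planar: "planar fan.G"
proof (rule fan.planar_double[where px = fst and py = snd])
  show "snd v \<le> snd v'"
    if "fan_adj n m u v" "fan_adj n m u' v'" "fst v = fst u + 1" "fst u' = fst u" "fst v' = fst v" "snd u < snd u'"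
    for u v u' v'
  proof -
    have "u = (0, 0) \<longleftrightarrow> u' = (0, 0)"
      using fan_verts_left[OF fan.E_V[OF that(1)]] fan_verts_left[OF fan.E_V[OF that(2)]] that(4)
      by (metis fst_conv)
    then have "u \<noteq> (0, 0)" "u' \<noteq> (0, 0)" using that(6) by auto
    then show ?thesis
      using fan_adj_up[OF that(1,3)] fan_adj_up[OF that(2)] that(3-6) by simp
  qed
  show "fst v = fst u + 1" if "fan_adj n m u v" "fst u < fst v" for u v
    using that by (cases u; cases v) (auto simp: fan_adj_def)
  show False if "fan_adj n m u v" "fst u = fst v" "w \<in> fan_verts n m" "fst w = fst u" "snd u < snd w" "snd w < snd v" for u v w
    using that by (cases u; cases v) (auto simp: fan_adj_def)
qed (auto simp: fan_verts_def)

lemma fan_level_path: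
  assumes "2 * n < h" "h \<le> 2 * n + m"
  shows "fan_level n h \<noteq> []" "set (fan_level n h) \<subseteq> fan_verts n m"
    "\<And>i. Suc i < length (fan_level n h) \<Longrightarrow> fan_adj n m (fan_level n h ! i) (fan_level n h ! Suc i)"
    "\<And>i. i < length (fan_level n h) \<Longrightarrow>
      min (fst (fan_level n h ! i)) (snd (fan_level n h ! i)) = min (fst (hd (fan_level n h))) (snd (hd (fan_level n h))) + int i"
  using assms n m unfolding fan_level_def
  by (auto simp: fan_adj_def fan_verts_def hd_map simp del: upt_Suc)

lemma fan_mids_local_max:
  assumes "p \<in> fan_mids n m" shows "p \<noteq> (0, 0)" "\<And>q. fan_adj n m p q \<Longrightarrow> fan_height q \<le> fan_height p"
proof -
  show "p \<noteq> (0, 0)" using assms n unfolding fan_mids_def by auto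
  fix q assume "fan_adj n m p q"
  with assms n show "fan_height q \<le> fan_height p"
    by (cases p; cases q) (auto simp: fan_mids_def fan_adj_def)
qed

lemma card_fan_mids: "card (fan_mids n m) = nat m * nat n"
proof -
  have "fan_mids n m = (\<lambda>(i, j). (2 * n + 1 + i, 2 * j + 1)) ` ({0..<m} \<times> {0..<n})"
  proof (intro equalityI subsetI)
    fix p assume "p \<in> fan_mids n m"
    then obtain x j where "p = (x, 2 * j + 1)" "2 * n < x" "x \<le> 2 * n + m" "0 \<le> 2 * j + 1" "2 * j + 1 \<le> 2 * n"
      unfolding fan_mids_def by (auto elim!: oddE)
    then show "p \<in> (\<lambda>(i, j). (2 * n + 1 + i, 2 * j + 1)) ` ({0..<m} \<times> {0..<n})"
      by (intro image_eqI[of _ _ "(x - 2 * n - 1, j)"]) auto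
  qed (auto simp: fan_mids_def)
  then show ?thesis by (simp add: card_image inj_on_def)
qed

text \<open>
  The middle of the level lies on a spoke, at the same height as its ends, because \<open>n\<close> is even.
\<close>

lemma fan_hyperbolic:
  assumes "even n"
  shows "real_of_int n / 2 \<le> hyperbolicity fan.G"
proof -
  have "real (nat n) / 2 \<le> hyperbolicity fan.G"
    using fan_level_path[of "2 * n + 1"] n m assms
    by (intro fan.hyperbolicity_double_ge[where \<phi> = "\<lambda>p. min (fst p) (snd p)" and p = "fan_level n (2 * n + 1)"
          and a = "nat n" and b = "nat (2 * n)"] fan_potential)
      (auto simp: fan_level_def simp del: upt_Suc)
  then show ?thesis using n by simp
qed

lemma fan_ipco: "nat n \<le> ipco fan.G"
proof -
  have "card {p \<in> fan_mids n m. fst p = 2 * n + 1} = nat n"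
  proof -
    have "{p \<in> fan_mids n m. fst p = 2 * n + 1} = (\<lambda>j. (2 * n + 1, 2 * j + 1)) ` {0..<n}"
      using m unfolding fan_mids_def by (auto elim!: oddE)
    then show ?thesis by (simp add: card_image inj_on_def)
  qed
  moreover have "{p \<in> fan_mids n m. fst p = 2 * n + 1} \<subseteq> set (fan_level n (2 * n + 1))"
  proof
    fix p assume "p \<in> {p \<in> fan_mids n m. fst p = 2 * n + 1}"
    then obtain y where "p = (2 * n + 1, y)" "0 \<le> y" "y \<le> 2 * n" by (auto simp: fan_mids_def)
    then have "p = (\<lambda>i. (2 * n + 1, int i)) (nat y)" "nat y \<in> set [0..<nat (2 * n) + 1]"
      by (auto simp del: upt_Suc)
    then show "p \<in> set (fan_level n (2 * n + 1))" unfolding fan_level_def set_map by blast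
  qed
  ultimately show ?thesis
    using fan_level_path[of "2 * n + 1"] n m fan_mids_local_max
    by (intro fan.ipco_double_ge[where \<phi> = "\<lambda>p. min (fst p) (snd p)" and p = "fan_level n (2 * n + 1)"
          and M = "{p \<in> fan_mids n m. fst p = 2 * n + 1}"] fan_potential)
      auto
qed

end

text \<open>
  Parents lead up a spoke to the level and along the level to its first vertex: without the root, a fan with one
  level is a tree, and every edge of this tree joins a vertex to its parent.
\<close>

fun fan_parent :: "int \<Rightarrow> point \<Rightarrow> point" where
  "fan_parent n (x, y) = (if x = 0 then (0, 0) else if 2 * n < x then if y = 0 then (0, 0) else (x, y - 1) else (x + 1, y))"

text \<open>
  The bag of a vertex consists of the vertex, its parent and the root. For the lower bound, the cycle through the
  first two spokes is used.
\<close>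

lemma fan_tree_width:
  assumes n: "1 \<le> n"
  shows "tree_width (double (fan_verts n 1) (fan_adj n 1) (0, 0)) = 2"
proof -
  interpret fan: rooted_graph "fan_verts n 1" "fan_adj n 1" "(0, 0)" fan_height
    using n by (intro fan_rooted) auto
  define rank :: "point \<Rightarrow> nat" where "rank p = (if fst p = 0 then 0 else nat (snd p + 2 * n + 2 - fst p))" for p
  define bag where "bag p = {p, fan_parent n p, (0, 0)}" for p
  obtain T :: "nat ugraph" and bag' where T: "tree_decomposition fan.G T bag'" "decomposition_width T bag' \<le> 2"
  proof (rule fan.tree_decomposition_double[of "fan_parent n" rank bag 2])
    fix t assume t: "t \<in> fan_verts n 1"
    have par: "fan_parent n t \<in> fan_verts n 1"
      using t n by (cases t) (auto simp: fan_verts_def)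
    then show "t \<in> bag t \<and> bag t \<subseteq> fan_verts n 1 \<and> card (bag t) \<le> 2 + 1"
      using t fan.root unfolding bag_def by (auto simp: card_insert_if)
    assume "t \<noteq> (0, 0)"
    then have "rank (fan_parent n t) < rank t"
      using t n unfolding rank_def by (cases t) (auto simp: fan_verts_def)
    then show "fan_parent n t \<in> fan_verts n 1 \<and> rank (fan_parent n t) < rank t" using par by simp
    show "bag t \<subseteq> insert t (bag (fan_parent n t))" unfolding bag_def by auto
  next
    show "bag (0, 0) = {(0, 0)}" unfolding bag_def by simp
  next
    fix p q assume pq: "fan_adj n 1 p q"
    have "fan_parent n p = q \<or> fan_parent n q = p \<or> p = (0, 0) \<or> q = (0, 0)"
      using pq n by (cases p; cases q; simp only: fan_adj_def fan_arc.simps; elim conjE disjE; auto simp: fan_verts_def)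
    then show "\<exists>t\<in>fan_verts n 1. {p, q} \<subseteq> bag t"
      using fan.E_V[OF pq] fan.E_V2[OF pq] unfolding bag_def by blast
  qed
  have "2 \<le> decomposition_width T' bag''" if "tree_decomposition fan.G T' bag''" for T' :: "nat ugraph" and bag''
  proof (rule cycle_forces_width_2[OF fan.simple_G that])
    let ?x = "fan.cp True (2 * n + 1, 0)" and ?y = "fan.cp True (2 * n + 1, 1)"
    let ?R = "\<lambda>u v. adj fan.G u v \<and> u \<notin> {?x, ?y} \<and> v \<notin> {?x, ?y}"
    show "adj fan.G ?x ?y" "adj fan.G ?y (fan.cp True (2 * n + 1, 2))" "adj fan.G ?x (fan.cp True (2 * n, 0))"
      "fan.cp True (2 * n + 1, 2) \<notin> {?x, ?y}" "fan.cp True (2 * n, 0) \<notin> {?x, ?y}"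
      using n by (auto simp: fan.adj_cp fan_adj_iff fan_verts_iff copy_eq_iff)
    have spoke: "?R\<^sup>*\<^sup>* (fan.cp True (0, 0)) (fan.cp True (1 + int i, y))"
      if "y = 2 \<and> int i \<le> 2 * n \<or> y = 0 \<and> int i < 2 * n" for i y
      using that
    proof (induction i)
      case 0
      then show ?case using n
        by (intro r_into_rtranclp) (auto simp: fan.adj_cp fan_adj_iff fan_verts_iff copy_eq_iff)
    next
      case (Suc i)
      have "?R (fan.cp True (1 + int i, y)) (fan.cp True (1 + int (Suc i), y))"
        using n Suc.prems by (auto simp: fan.adj_cp fan_adj_iff fan_verts_iff copy_eq_iff)
      then show ?case using Suc by (intro rtranclp.rtrancl_into_rtrancl[OF Suc.IH]) auto
    qed
    have "?R\<^sup>*\<^sup>* (fan.cp True (0, 0)) (fan.cp True (2 * n + 1, 2))" "?R\<^sup>*\<^sup>* (fan.cp True (0, 0)) (fan.cp True (2 * n, 0))"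
      using spoke[of 2 "nat (2 * n)"] spoke[of 0 "nat (2 * n - 1)"] n by (simp_all add: add.commute)
    moreover have "?R\<^sup>*\<^sup>* b a" if "?R\<^sup>*\<^sup>* a b" for a b
      using that by (induction rule: rtranclp_induct) (auto intro: converse_rtranclp_into_rtranclp adj_sym[THEN iffD1])
    ultimately show "?R\<^sup>*\<^sup>* (fan.cp True (2 * n + 1, 2)) (fan.cp True (2 * n, 0))"
      by (meson rtranclp_trans)
  qed
  moreover have "\<exists>(T :: nat ugraph) bag'. tree_decomposition fan.G T bag' \<and> decomposition_width T bag' = tree_width fan.G"
    unfolding tree_width_def by (rule LeastI_ex) (use T(1) in blast)
  ultimately show ?thesis using tree_width_le[OF T] by force
qed

lemma fan_properties:
  assumes "1 \<le> k"
  shows "\<exists>G :: nat ugraph. simple_graph G \<and> connected_graph G \<and>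
        free_of pyramid G \<and> free_of prism G \<and> free_of wheel G \<and>
        tree_width G = 2 \<and>
        hyperbolicity G \<ge> real_of_int (\<lceil>real k / 2\<rceil> - 1) \<and>
        ipco G \<ge> k"
proof -
  define n where "n = 2 * int k"
  have n: "1 \<le> n" "even n" using assms unfolding n_def by auto
  interpret fan: rooted_graph "fan_verts n 1" "fan_adj n 1" "(0, 0)" fan_height
    using n by (intro fan_rooted) auto
  have "real_of_int (\<lceil>real k / 2\<rceil> - 1) \<le> real_of_int n / 2" unfolding n_def by simp linarith
  then have "real_of_int (\<lceil>real k / 2\<rceil> - 1) \<le> hyperbolicity fan.G"
    using fan_hyperbolic[OF n(1) _ n(2), of 1] by simp
  moreover have "k \<le> ipco fan.G" using fan_ipco[OF n(1), of 1] unfolding n_def by simp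
  ultimately show ?thesis
    using fan.simple_G fan.connected_G fan_tree_width[OF n(1)] fan_wheel_free[OF n(1), of 1]
      fan.two_coloured_double(1,2)[of "\<lambda>p. even (fst p + snd p)", OF fan_two_coloured]
    by (intro exI[of _ fan.G]) simp
qed

definition fan_spoke :: "int \<Rightarrow> nat \<Rightarrow> point" where
  "fan_spoke j i = (if i = 0 then (0, 0) else (int i, 2 * j))"

definition fan_line :: "int \<Rightarrow> int \<Rightarrow> nat list" where
  "fan_line n j = map (\<lambda>i. if i < nat (3 * n) then copy (0, 0) False (fan_spoke j (nat (3 * n) - i))
     else copy (0, 0) True (fan_spoke j (i - nat (3 * n)))) [0..<2 * nat (3 * n) + 1]"

text \<open>
  The cover of the double of the fan with \<open>n\<close> spoke gaps and \<open>n\<close> levels: every line consists of two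
  opposite spokes and covers the vertices with an even second coordinate, and the \<open>n\<close> levels on each side cover the midpoints.
\<close>

definition fan_cover :: "int \<Rightarrow> nat list set" where
  "fan_cover n = fan_line n ` {0..n} \<union> (\<lambda>(s, h). map (copy (0, 0) s) (fan_level n h)) ` (UNIV \<times> {2 * n + 1..3 * n})"

context
  fixes n :: int
  assumes n: "1 \<le> n"
begin

interpretation fan: rooted_graph "fan_verts n n" "fan_adj n n" "(0, 0)" fan_height
  using n n by (rule fan_rooted)

lemma card_fan_verts: "int (card (verts fan.G)) \<le> 20 * n ^ 2"
proof -
  have "fan_verts n n \<subseteq> insert (0, 0) ({1..3 * n} \<times> {0..2 * n})" unfolding fan_verts_def by auto
  then have "card (fan_verts n n) \<le> card (insert (0, 0) ({1..3 * n} \<times> {0..2 * n}))"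
    by (intro card_mono) auto
  also have "\<dots> \<le> Suc (nat (3 * n) * nat (2 * n + 1))"
    by (simp add: card_insert_if)
  finally have "int (card (fan_verts n n)) \<le> 1 + 3 * n * (2 * n + 1)"
    using n of_nat_mono[where 'a = int] by fastforce
  then have "int (card (fan_verts n n)) \<le> 1 + 3 * n + 6 * n ^ 2"
    by (simp add: power2_eq_square algebra_simps)
  moreover have "n \<le> n ^ 2" using n by (simp add: self_le_power)
  moreover have "int (card (verts fan.G)) \<le> 2 * int (card (fan_verts n n))"
    using fan.card_verts_G by simp
  ultimately show ?thesis using n by linarith
qed

lemma isometric_fan_line:
  assumes "0 \<le> j" "j \<le> n"
  shows "isometric_path fan.G (fan_line n j)"
  unfolding fan_line_def
  using assms n by (intro fan.isometric_through_root) (auto simp: fan_spoke_def fan_adj_iff fan_verts_iff)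

lemma isometric_fan_level:
  assumes "2 * n < h" "h \<le> 3 * n"
  shows "isometric_path fan.G (map (fan.cp s) (fan_level n h))"
  using fan_level_path[OF n n, of h] assms n
  by (intro fan.isometric_copy[where \<phi> = "\<lambda>p. min (fst p) (snd p)"] fan_potential) auto

lemma hd_fan_line: "hd (fan_line n j) = fan.cp False (3 * n, 2 * j)"
  and last_fan_line: "last (fan_line n j) = fan.cp True (3 * n, 2 * j)"
  using n unfolding fan_line_def by (auto simp: hd_map last_map fan_spoke_def simp del: upt_Suc)

lemma hd_fan_level: "hd (map (fan.cp s) (fan_level n h)) = fan.cp s (h, 0)"
  and last_fan_level: "last (map (fan.cp s) (fan_level n h)) = fan.cp s (h, 2 * n)"
  using n unfolding fan_level_def by (auto simp: hd_map last_map simp del: upt_Suc)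

lemma card_fan_cover: "card (fan_cover n) = 3 * nat n + 1"
proof -
  have "inj_on (fan_line n) {0..n}"
    by (rule inj_onI) (drule arg_cong[of _ _ hd], simp add: hd_fan_line copy_eq_iff)
  then have 1: "card (fan_line n ` {0..n}) = nat n + 1" using n by (simp add: card_image nat_add_distrib)
  have "inj_on (\<lambda>(s, h). map (fan.cp s) (fan_level n h)) (UNIV \<times> {2 * n + 1..3 * n})"
    by (rule inj_onI) (use n in \<open>auto dest!: arg_cong[of _ _ hd] simp: hd_fan_level copy_eq_iff\<close>)
  then have 2: "card ((\<lambda>(s, h). map (fan.cp s) (fan_level n h)) ` (UNIV \<times> {2 * n + 1..3 * n})) = 2 * nat n"
    using n by (simp add: card_image card_cartesian_product)
  have "fan_line n j \<noteq> map (fan.cp s) (fan_level n h)" for j s h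
  proof
    assume eq: "fan_line n j = map (fan.cp s) (fan_level n h)"
    have "fan.cp False (3 * n, 2 * j) = fan.cp s (h, 0)" "fan.cp True (3 * n, 2 * j) = fan.cp s (h, 2 * n)"
      using hd_fan_line[of j] last_fan_line[of j] hd_fan_level[of s h] last_fan_level[of s h] unfolding eq by simp_all
    then show False using n by (auto simp: copy_eq_iff)
  qed
  then have "fan_line n ` {0..n} \<inter> (\<lambda>(s, h). map (fan.cp s) (fan_level n h)) ` (UNIV \<times> {2 * n + 1..3 * n}) = {}"
    by auto
  then show ?thesis unfolding fan_cover_def using 1 2 by (subst card_Un_disjoint) auto
qed

lemma isometric_fan_cover: "isometric_path_cover fan.G (fan_cover n)"
  unfolding isometric_path_cover_def
proof (intro conjI ballI impI)
  show "isometric_path fan.G p" if "p \<in> fan_cover n" for p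
    using that isometric_fan_line isometric_fan_level unfolding fan_cover_def by auto
  show "verts fan.G \<subseteq> (\<Union>p\<in>fan_cover n. set p)"
  proof
    fix v assume "v \<in> verts fan.G"
    then obtain s x y where v: "v = fan.cp s (x, y)" "(x, y) \<in> fan_verts n n"
      unfolding fan.verts_G by auto
    show "v \<in> (\<Union>p\<in>fan_cover n. set p)"
    proof (cases "even y")
      case True
      then obtain j where y: "y = 2 * j" by (auto elim: evenE)
      have b: "0 \<le> x" "x \<le> 3 * n" "0 \<le> j" "j \<le> n" using v(2) n y unfolding fan_verts_iff by auto
      have sp: "fan_spoke j (nat x) = (x, y)" using v(2) y b unfolding fan_spoke_def fan_verts_iff by auto
      have "v \<in> set (fan_line n j)"
      proof (cases "s \<or> x = 0")
        case True
        then have "v = fan.cp True (x, y)" using v(1) v(2) copy_root[of "(0, 0) :: point" s True]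
          unfolding fan_verts_iff by auto
        then show ?thesis unfolding fan_line_def
          by (auto simp: sp intro!: image_eqI[of _ _ "nat (3 * n) + nat x"] simp del: upt_Suc)
            (use nat_mono[OF b(2)] in auto)
      next
        case False
        then show ?thesis unfolding fan_line_def using v(1) b
          by (auto simp: sp intro!: image_eqI[of _ _ "nat (3 * n) - nat x"] simp del: upt_Suc)
      qed
      then show ?thesis using b unfolding fan_cover_def by auto
    next
      case False
      then have b: "2 * n < x" "x \<le> 3 * n" "0 \<le> y" "y \<le> 2 * n" using v(2) n unfolding fan_verts_iff by auto
      then have "(x, y) \<in> set (fan_level n x)"
        unfolding fan_level_def using n by (auto intro!: image_eqI[of _ _ "nat y"] simp del: upt_Suc)
      then have "v \<in> set (map (fan.cp s) (fan_level n x))" using v(1) by auto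
      then show ?thesis using b unfolding fan_cover_def by force
    qed
  qed
  fix p assume p: "p \<in> fan_cover n" "rev p \<in> fan_cover n"
  \<comment> \<open>No path of the cover is the reversal of another one: all of them run from a smaller to a larger value of \<open>t\<close>.\<close>
  define t where "t m = (if side TYPE(point) m then fst (pt m :: point) else - fst (pt m :: point)) + snd (pt m :: point)" for m
  have t: "t (fan.cp s (x, y)) = (if s then x else - x) + y" if "x \<noteq> 0" for s x y
    using that unfolding t_def by simp
  have up: "q \<noteq> [] \<and> t (hd q) < t (last q)" if "q \<in> fan_cover n" for q
    using that n unfolding fan_cover_def
    by (auto simp: hd_fan_line last_fan_line hd_fan_level last_fan_level t simp del: map_map)
      (simp_all add: fan_line_def fan_level_def)
  from up[OF p(1)] up[OF p(2)] show "rev p = p" by (simp add: hd_rev last_rev)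
qed

lemma fan_rooted_cover_ge:
  assumes "v \<in> verts fan.G" "rooted_isometric_path_cover fan.G v P"
  shows "nat n ^ 2 \<le> card P"
proof -
  have "card (fan_mids n n) \<le> card P"
    using assms fan_mids_local_max[OF n n] by (intro fan.rooted_cover_ge[of _ v]) (auto simp: fan_mids_def fan_verts_iff)
  then show ?thesis by (simp add: card_fan_mids[OF n n] power2_eq_square)
qed

end

lemma tall_fan_properties:
  assumes "1 \<le> k"
  shows "\<exists>G :: nat ugraph. simple_graph G \<and> connected_graph G \<and>
        free_of prism G \<and> free_of pyramid G \<and> free_of wheel G \<and>
        planar G \<and> bipartite G \<and>
        real (card (verts G)) \<le> 20 * real k ^ 2 \<and>
        (\<exists>P. isometric_path_cover G P \<and> card P = 3 * k + 1) \<and>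
        (\<forall>v\<in>verts G. \<forall>P. rooted_isometric_path_cover G v P \<longrightarrow> card P \<ge> k ^ 2)"
proof -
  define n where "n = int k"
  have n: "1 \<le> n" using assms unfolding n_def by auto
  interpret fan: rooted_graph "fan_verts n n" "fan_adj n n" "(0, 0)" fan_height
    using n n by (rule fan_rooted)
  have "real_of_int (int (card (verts fan.G))) \<le> real_of_int (20 * n ^ 2)"
    using card_fan_verts[OF n] by (simp only: of_int_le_iff)
  then have "real (card (verts fan.G)) \<le> 20 * real k ^ 2" by (simp add: n_def)
  moreover have "\<exists>P. isometric_path_cover fan.G P \<and> card P = 3 * k + 1"
    using isometric_fan_cover[OF n] card_fan_cover[OF n] unfolding n_def by auto
  moreover have "\<forall>v\<in>verts fan.G. \<forall>P. rooted_isometric_path_cover fan.G v P \<longrightarrow> card P \<ge> k ^ 2"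
    using fan_rooted_cover_ge[OF n] unfolding n_def by simp
  ultimately show ?thesis
    using fan.simple_G fan.connected_G fan_wheel_free[OF n n] fan_planar[OF n n]
      fan.two_coloured_double[of "\<lambda>p. even (fst p + snd p)", OF fan_two_coloured]
    by (intro exI[of _ fan.G]) simp
qed

section \<open>Crowns\<close>

type_synonym triple = "int \<times> int \<times> int"

text \<open>
  In a crown, the spoke \<open>j\<close> ends in the apex \<open>(3n+1, j, 0)\<close> of a triangle with the other two vertices
  \<open>(3n+2, j, 0)\<close> and \<open>(3n+2, j, 1)\<close>. The rim \<open>x = 3n+2\<close> passes through all triangles, with
  one vertex \<open>(3n+2, j, 2)\<close> between consecutive triangles. Coordinates \<open>(j, t)\<close> rather than the
  position \<open>3 * j + t\<close> keep all conditions linear. The spokes are as long as the rim, so that the rim is isometric.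
\<close>

definition crown_verts :: "int \<Rightarrow> triple set" where
  "crown_verts n = {(x, j, t). x = 0 \<and> j = 0 \<and> t = 0 \<or>
     1 \<le> x \<and> x \<le> 3 * n + 1 \<and> 0 \<le> j \<and> j \<le> n \<and> t = 0 \<or>
     x = 3 * n + 2 \<and> 0 \<le> j \<and> j \<le> n \<and> 0 \<le> t \<and> t \<le> 2 \<and> (j < n \<or> t \<le> 1)}"

fun crown_arc :: "int \<Rightarrow> triple \<Rightarrow> triple \<Rightarrow> bool" where
  "crown_arc n (x, j, t) (x', j', t') \<longleftrightarrow>
     x' = x + 1 \<and> (x = 0 \<or> j' = j \<and> t = 0 \<and> (t' = 0 \<or> x = 3 * n + 1 \<and> t' = 1)) \<or>
     x' = x \<and> x = 3 * n + 2 \<and> (j' = j \<and> t' = t + 1 \<or> j' = j + 1 \<and> t = 2 \<and> t' = 0)"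

definition crown_adj :: "int \<Rightarrow> triple \<Rightarrow> triple \<Rightarrow> bool" where
  "crown_adj n p q \<longleftrightarrow> p \<in> crown_verts n \<and> q \<in> crown_verts n \<and> (crown_arc n p q \<or> crown_arc n q p)"

lemma crown_verts_iff: "(x, j, t) \<in> crown_verts n \<longleftrightarrow> x = 0 \<and> j = 0 \<and> t = 0 \<or>
     1 \<le> x \<and> x \<le> 3 * n + 1 \<and> 0 \<le> j \<and> j \<le> n \<and> t = 0 \<or>
     x = 3 * n + 2 \<and> 0 \<le> j \<and> j \<le> n \<and> 0 \<le> t \<and> t \<le> 2 \<and> (j < n \<or> t \<le> 1)"
  by (simp add: crown_verts_def)

lemma crown_adj_iff: "crown_adj n (x, j, t) (x', j', t') \<longleftrightarrow>
    (x, j, t) \<in> crown_verts n \<and> (x', j', t') \<in> crown_verts n \<and>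
    (crown_arc n (x, j, t) (x', j', t') \<or> crown_arc n (x', j', t') (x, j, t))"
  by (simp add: crown_adj_def)

lemmas crown_iff = crown_adj_iff crown_verts_iff

fun crown_height :: "triple \<Rightarrow> nat" where
  "crown_height (x, j, t) = nat x + (if t = 2 then 1 else 0)"

text \<open>
  The position along the rim; spokes are drawn at the position of their first rim vertex.
\<close>

fun crown_coord :: "triple \<Rightarrow> int" where
  "crown_coord (x, j, t) = 3 * j + t"

lemma crown_rooted:
  assumes n: "1 \<le> n"
  shows "rooted_graph (crown_verts n) (crown_adj n) (0, 0, 0) crown_height"
proof
  have "crown_verts n \<subseteq> {0..3 * n + 2} \<times> {0..n} \<times> {0..2}"
    using n by (auto simp: crown_verts_def)
  then show "finite (crown_verts n)" by (rule finite_subset) auto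
  show "(0, 0, 0) \<in> crown_verts n" by (simp add: crown_verts_def)
  fix p q
  show "crown_adj n p q \<Longrightarrow> crown_adj n q p" "crown_adj n p q \<Longrightarrow> p \<in> crown_verts n"
    by (auto simp: crown_adj_def)
  show "\<not> crown_adj n p p" by (cases p) (auto simp: crown_adj_def)
  show "crown_height (0, 0, 0) = 0" by simp
  show "crown_height q \<le> crown_height p + 1" if "crown_adj n p q"
    using that n
    by (cases p; cases q; simp only: crown_adj_iff crown_arc.simps; elim conjE disjE; auto simp: crown_verts_iff)
  show "\<exists>q. crown_adj n p q \<and> crown_height p = crown_height q + 1" if "p \<in> crown_verts n" "p \<noteq> (0, 0, 0)"
  proof -
    obtain x j t where p: "p = (x, j, t)" by (cases p)
    define q :: triple where "q = (if t = 2 then (x, j, 1) else if x = 1 then (0, 0, 0) else (x - 1, j, 0))"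
    have "crown_adj n p q \<and> crown_height p = crown_height q + 1"
      using that n unfolding p q_def
      by (simp only: crown_verts_iff; elim conjE disjE; auto simp: crown_iff)
    then show ?thesis ..
  qed
qed

context
  fixes n :: int
  assumes n: "1 \<le> n"
begin

interpretation crown: rooted_graph "crown_verts n" "crown_adj n" "(0, 0, 0)" crown_height
  using n by (rule crown_rooted)

lemma crown_nbrs_root: "crown_adj n (0, 0, 0) q \<Longrightarrow> \<exists>j. q = (1, j, 0)"
  using n by (cases q; simp add: crown_iff split: if_splits; smt (z3))

lemma crown_nbrs_spoke: "crown_adj n (x, j, t) q \<Longrightarrow> 1 \<le> x \<Longrightarrow> x \<le> 3 * n \<Longrightarrow>
    q = (if x = 1 then (0, 0, 0) else (x - 1, j, 0)) \<or> q = (x + 1, j, 0)"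
  using n by (cases q; simp add: crown_iff split: if_splits; smt (z3))

lemma crown_nbrs_apex: "crown_adj n (3 * n + 1, j, t) q \<Longrightarrow>
    q = (3 * n, j, 0) \<or> q = (3 * n + 2, j, 0) \<or> q = (3 * n + 2, j, 1)"
  using n by (cases q; simp add: crown_iff split: if_splits; smt (z3))

lemma crown_nbrs_0: "crown_adj n (3 * n + 2, j, 0) q \<Longrightarrow>
    q = (3 * n + 2, j - 1, 2) \<or> q = (3 * n + 1, j, 0) \<or> q = (3 * n + 2, j, 1)"
  using n by (cases q; simp add: crown_iff split: if_splits; smt (z3))

lemma crown_nbrs_1: "crown_adj n (3 * n + 2, j, 1) q \<Longrightarrow>
    q = (3 * n + 2, j, 2) \<or> q = (3 * n + 1, j, 0) \<or> q = (3 * n + 2, j, 0)"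
  using n by (cases q; simp add: crown_iff split: if_splits; smt (z3))

lemma crown_nbrs_2: "crown_adj n (3 * n + 2, j, 2) q \<Longrightarrow> q = (3 * n + 2, j, 1) \<or> q = (3 * n + 2, j + 1, 0)"
  using n by (cases q; simp add: crown_iff split: if_splits; smt (z3))

lemma crown_cases:
  assumes "p \<in> crown_verts n"
  obtains "p = (0, 0, 0)" | x j where "p = (x, j, 0)" "1 \<le> x" "x \<le> 3 * n" "0 \<le> j" "j \<le> n"
  | j where "p = (3 * n + 1, j, 0)" "0 \<le> j" "j \<le> n" | j where "p = (3 * n + 2, j, 0)" "0 \<le> j" "j \<le> n"
  | j where "p = (3 * n + 2, j, 1)" "0 \<le> j" "j \<le> n" | j where "p = (3 * n + 2, j, 2)" "0 \<le> j" "j < n"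
proof -
  obtain x j t where p: "p = (x, j, t)" by (cases p)
  consider "x = 0 \<and> j = 0 \<and> t = 0" | "t = 0 \<and> 1 \<le> x \<and> x \<le> 3 * n \<and> 0 \<le> j \<and> j \<le> n"
    | "x = 3 * n + 1 \<and> t = 0 \<and> 0 \<le> j \<and> j \<le> n" | "x = 3 * n + 2 \<and> t = 0 \<and> 0 \<le> j \<and> j \<le> n"
    | "x = 3 * n + 2 \<and> t = 1 \<and> 0 \<le> j \<and> j \<le> n" | "x = 3 * n + 2 \<and> t = 2 \<and> 0 \<le> j \<and> j < n"
    using assms unfolding p crown_verts_iff by (smt (z3))
  then show ?thesis
    by cases (use that p in simp_all)
qed

lemma crown_triangle: "0 \<le> j \<Longrightarrow> j \<le> n \<Longrightarrow> crown_adj n (3 * n + 1, j, 0) (3 * n + 2, j, 0) \<and>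
   crown_adj n (3 * n + 1, j, 0) (3 * n + 2, j, 1) \<and> crown_adj n (3 * n + 2, j, 0) (3 * n + 2, j, 1)"
  using n by (auto simp: crown_iff)

text \<open>
  The neighbour of a triangle vertex outside the triangle is dull, having degree 2; so only the other two
  vertices of the triangle remain.
\<close>

lemma crown_wheel_free: "free_of wheel crown.G"
proof (rule crown.wheel_free_double)
  fix u assume u: "crown_adj n (0, 0, 0) u"
  then obtain j where j: "u = (1, j, 0)" using crown_nbrs_root by blast
  show "crown.dull (0, 0, 0) u"
    using crown_nbrs_spoke[of 1 j 0] n j by (intro crown.dull_if_two_neighbours[OF u]) auto
next
  fix w assume w: "w \<in> crown_verts n" "w \<noteq> (0, 0, 0)"
  show "\<exists>A B. \<forall>u. crown_adj n w u \<longrightarrow> u = A \<or> u = B \<or>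
      u \<noteq> (0, 0, 0) \<and> crown.dull w u \<or> u = (0, 0, 0) \<and> (\<forall>y. crown_adj n (0, 0, 0) y \<longrightarrow> y = w)"
    using w(1)
  proof (cases rule: crown_cases)
    case 1
    then show ?thesis using w by blast
  next
    case (2 x j)
    then show ?thesis using crown_nbrs_spoke[of x j 0] by blast
  next
    case (3 j)
    have "u \<noteq> (0, 0, 0) \<and> crown.dull w u" if "crown_adj n w u" "u = (3 * n, j, 0)" for u
      using crown_nbrs_spoke[of "3 * n" j 0] n that(2)
      by (intro conjI crown.dull_if_two_neighbours[OF that(1)]) auto
    then show ?thesis using crown_nbrs_apex[of j 0] 3 by blast
  next
    case (4 j)
    have "u \<noteq> (0, 0, 0) \<and> crown.dull w u" if "crown_adj n w u" "u = (3 * n + 2, j - 1, 2)" for u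
      using crown_nbrs_2[of "j - 1"] n that(2)
      by (intro conjI crown.dull_if_two_neighbours[OF that(1)]) auto
    then show ?thesis using crown_nbrs_0[of j] 4 n by blast
  next
    case (5 j)
    have "u \<noteq> (0, 0, 0) \<and> crown.dull w u" if "crown_adj n w u" "u = (3 * n + 2, j, 2)" for u
      using crown_nbrs_2[of j] n that(2)
      by (intro conjI crown.dull_if_two_neighbours[OF that(1)]) auto
    then show ?thesis using crown_nbrs_1[of j] 5 n by blast
  next
    case (6 j)
    then show ?thesis using crown_nbrs_2[of j] by blast
  qed
qed

lemma crown_theta_free: "free_of theta crown.G"
proof (rule theta_free_if_one_claw, rule crown.claw_only_at_root)
  fix a assume a: "a \<in> crown_verts n" "a \<noteq> (0, 0, 0)"
  show "\<not> crown.claw_centre a"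
    using a(1)
  proof (cases rule: crown_cases)
    case 1
    then show ?thesis using a by blast
  next
    case (2 x j)
    then show ?thesis using crown_nbrs_spoke[of x j 0] by (intro crown.no_claw_two_neighbours) auto
  next
    case (3 j)
    then show ?thesis using crown_nbrs_apex[of j 0] crown_triangle[of j]
      by (intro crown.no_claw_triangle[of "(3 * n + 2, j, 0)" "(3 * n + 2, j, 1)" _ "(3 * n, j, 0)"]) auto
  next
    case (4 j)
    then show ?thesis using crown_nbrs_0[of j] crown_triangle[of j]
      by (intro crown.no_claw_triangle[of "(3 * n + 1, j, 0)" "(3 * n + 2, j, 1)" _ "(3 * n + 2, j - 1, 2)"]) auto
  next
    case (5 j)
    then show ?thesis using crown_nbrs_1[of j] crown_triangle[of j]
      by (intro crown.no_claw_triangle[of "(3 * n + 1, j, 0)" "(3 * n + 2, j, 0)" _ "(3 * n + 2, j, 2)"]) auto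
  next
    case (6 j)
    then show ?thesis using crown_nbrs_2[of j] by (intro crown.no_claw_two_neighbours) auto
  qed
qed

lemma crown_triangles:
  assumes xyz: "crown_adj n p q" "crown_adj n p s" "crown_adj n q s"
  shows "p \<noteq> (0, 0, 0) \<and> fst (snd q) = fst (snd p) \<and> (3 * n + 1, fst (snd p), 0) \<in> {p, q, s}"
  using crown.E_V[OF xyz(1)]
proof (cases rule: crown_cases)
  case 1
  then obtain i j where "q = (1, i, 0)" "s = (1, j, 0)" using crown_nbrs_root xyz by metis
  then show ?thesis using xyz(3) by (simp add: crown_adj_iff)
next
  case (2 x j)
  then show ?thesis using crown_nbrs_spoke[of x j 0 q] crown_nbrs_spoke[of x j 0 s] xyz
    by (auto simp: crown_adj_iff split: if_splits)
next
  case (3 j)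
  then show ?thesis using crown_nbrs_apex[of j 0 q] xyz(1) by auto
next
  case (4 j)
  then show ?thesis using crown_nbrs_0[of j q] crown_nbrs_0[of j s] xyz
    by (auto simp: crown_adj_iff)
next
  case (5 j)
  then show ?thesis using crown_nbrs_1[of j q] crown_nbrs_1[of j s] xyz
    by (auto simp: crown_adj_iff)
next
  case (6 j)
  then show ?thesis using crown_nbrs_2[of j q] crown_nbrs_2[of j s] xyz
    by (auto simp: crown_adj_iff)
qed

text \<open>
  Block \<open>j\<close> consists of spoke \<open>j\<close>, its triangle and the rim vertex behind the triangle, which is the gate.
\<close>

lemma crown_prism_free: "free_of prism crown.G"
proof (rule crown.prism_free_double[where idx = "\<lambda>p. fst (snd p)" and gate = "\<lambda>j. (3 * n + 2, j, 2)"
      and tip = "\<lambda>j. (3 * n + 1, j, 0)"])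
  fix p q j
  assume "crown_adj n p q" "p \<noteq> (0, 0, 0)" "q \<noteq> (0, 0, 0)" "fst (snd p) \<le> j" "j < fst (snd q)"
  then show "p = (3 * n + 2, j, 2) \<or> q = (3 * n + 2, j, 2)"
    by (cases p; cases q; simp only: crown_adj_iff crown_arc.simps; elim conjE disjE; auto simp: crown_verts_iff)
qed (use crown_triangles in blast)+

lemma crown_planar: "planar crown.G"
proof (rule crown.planar_double[where px = fst and py = crown_coord])
  have up: "fst u = 0 \<or> crown_coord u \<le> crown_coord v \<and> crown_coord v \<le> crown_coord u + 1"
    if "crown_adj n u v" "fst v = fst u + 1" for u v
    using that by (cases u; cases v; simp only: crown_adj_iff crown_arc.simps; elim conjE disjE; auto simp: crown_verts_iff)
  have left: "u = (0, 0, 0)" if "u \<in> crown_verts n" "fst u = 0" for u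
    using that n by (cases u) (auto simp: crown_verts_iff)
  show "crown_coord v \<le> crown_coord v'"
    if "crown_adj n u v" "crown_adj n u' v'" "fst v = fst u + 1" "fst u' = fst u" "fst v' = fst v" "crown_coord u < crown_coord u'"
    for u v u' v'
  proof -
    have "fst u \<noteq> 0" using left[of u] left[of u'] crown.E_V[OF that(1)] crown.E_V[OF that(2)] that(4,6) by auto
    then show ?thesis using up[OF that(1)] up[OF that(2)] that(3-6) by simp
  qed
  show "fst v = fst u + 1" if "crown_adj n u v" "fst u < fst v" for u v
    using that by (cases u; cases v) (auto simp: crown_adj_iff)
  show False if "crown_adj n u v" "fst u = fst v" "w \<in> crown_verts n" "fst w = fst u"
    "crown_coord u < crown_coord w" "crown_coord w < crown_coord v" for u v w
    using that by (cases u; cases v) (auto simp: crown_adj_iff)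
  show "u = v" if "u \<in> crown_verts n" "v \<in> crown_verts n" "fst u = fst v" "crown_coord u = crown_coord v" for u v
    using that n by (cases u; cases v; simp add: crown_verts_iff; smt (z3))
qed (use n in \<open>auto simp: crown_verts_def\<close>)

lemma crown_potential:
  assumes "crown_adj n p q"
  shows "min (fst q) (crown_coord q) \<le> min (fst p) (crown_coord p) + 1"
  using assms n
  by (cases p; cases q; simp only: crown_adj_iff crown_arc.simps; elim conjE disjE; auto simp: crown_verts_iff)

end

definition crown_rim :: "int \<Rightarrow> triple list" where
  "crown_rim n = map (\<lambda>i. (3 * n + 2, int (i div 3), int (i mod 3))) [0..<nat (3 * n) + 2]"

context
  fixes n :: int
  assumes n: "1 \<le> n"
begin

interpretation crown: rooted_graph "crown_verts n" "crown_adj n" "(0, 0, 0)" crown_height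
  using n by (rule crown_rooted)

lemma crown_rim_nth: "i < length (crown_rim n) \<Longrightarrow> crown_rim n ! i = (3 * n + 2, int (i div 3), int (i mod 3))"
  and length_crown_rim: "length (crown_rim n) = nat (3 * n) + 2"
  by (simp_all add: crown_rim_def del: upt_Suc)

lemma crown_rim_in:
  assumes i: "i < length (crown_rim n)" shows "crown_rim n ! i \<in> crown_verts n"
proof -
  have "3 * int (i div 3) + int (i mod 3) = int i" "int (i mod 3) \<le> 2" by presburger+
  moreover have "int i \<le> 3 * n + 1" using i n unfolding length_crown_rim by linarith
  ultimately have "int (i div 3) \<le> n \<and> (int (i div 3) < n \<or> int (i mod 3) \<le> 1)" by linarith
  then show ?thesis unfolding crown_rim_nth[OF i] crown_verts_iff using \<open>int (i mod 3) \<le> 2\<close> by simp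
qed

lemma crown_rim_path:
  shows "crown_rim n \<noteq> []" "set (crown_rim n) \<subseteq> crown_verts n"
    "\<And>i. Suc i < length (crown_rim n) \<Longrightarrow> crown_adj n (crown_rim n ! i) (crown_rim n ! Suc i)"
    "\<And>i. i < length (crown_rim n) \<Longrightarrow>
      min (fst (crown_rim n ! i)) (crown_coord (crown_rim n ! i))
        = min (fst (hd (crown_rim n))) (crown_coord (hd (crown_rim n))) + int i"
proof -
  show ne: "crown_rim n \<noteq> []" using length_crown_rim by auto
  show "set (crown_rim n) \<subseteq> crown_verts n" using crown_rim_in by (metis in_set_conv_nth subsetI)
  show "crown_adj n (crown_rim n ! i) (crown_rim n ! Suc i)" if "Suc i < length (crown_rim n)" for i
  proof -
    have "int (Suc i div 3) = int (i div 3) \<and> int (Suc i mod 3) = int (i mod 3) + 1 \<or>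
        int (Suc i div 3) = int (i div 3) + 1 \<and> int (i mod 3) = 2 \<and> int (Suc i mod 3) = 0"
      by (auto simp: div_Suc mod_Suc)
    then have "crown_arc n (crown_rim n ! i) (crown_rim n ! Suc i)"
      using that by (auto simp: crown_rim_nth)
    then show ?thesis
      unfolding crown_adj_def using crown_rim_in[of i] crown_rim_in[OF that] that by simp
  qed
  have c: "min (fst (crown_rim n ! i)) (crown_coord (crown_rim n ! i)) = int i" if i: "i < length (crown_rim n)" for i
  proof -
    have "3 * int (i div 3) + int (i mod 3) = int i" by presburger
    moreover have "int i \<le> 3 * n + 2" using i n unfolding length_crown_rim by linarith
    ultimately show ?thesis by (simp add: crown_rim_nth[OF i])
  qed
  show "min (fst (crown_rim n ! i)) (crown_coord (crown_rim n ! i))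
        = min (fst (hd (crown_rim n))) (crown_coord (hd (crown_rim n))) + int i" if "i < length (crown_rim n)" for i
    using c[OF that] c[of 0] ne by (simp add: hd_conv_nth)
qed

lemma crown_ipco: "nat n \<le> ipco crown.G"
proof (rule crown.ipco_double_ge[where \<phi> = "\<lambda>p. min (fst p) (crown_coord p)" and p = "crown_rim n"
      and M = "(\<lambda>j. (3 * n + 2, j, 2)) ` {0..<n}"])
  show "(\<lambda>j. (3 * n + 2, j, 2)) ` {0..<n} \<subseteq> set (crown_rim n)"
  proof safe
    fix j assume j: "j \<in> {0..<n}"
    define i where "i = 3 * nat j + 2"
    have "i mod 3 = 2" "i div 3 = nat j" unfolding i_def by presburger+
    then have i: "i < length (crown_rim n)" "int (i div 3) = j" "int (i mod 3) = 2"
      using j unfolding i_def length_crown_rim by auto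
    then show "(3 * n + 2, j, 2) \<in> set (crown_rim n)" using nth_mem[OF i(1)] crown_rim_nth[OF i(1)] by simp
  qed
  show "nat n \<le> card ((\<lambda>j. (3 * n + 2, j, 2)) ` {0..<n})" by (simp add: card_image inj_on_def)
  show "crown_height q \<le> crown_height p" if pq: "p \<in> (\<lambda>j. (3 * n + 2, j, 2)) ` {0..<n}" "crown_adj n p q" for p q
  proof -
    obtain j where p: "p = (3 * n + 2, j, 2)" using pq(1) by auto
    have "q = (3 * n + 2, j, 1) \<or> q = (3 * n + 2, j + 1, 0)" using crown_nbrs_2[OF n] pq(2) p by blast
    then show ?thesis using p n by auto
  qed
qed (use crown_rim_path crown_potential[OF n] n in auto)

lemma crown_hyperbolic:
  assumes "even n"
  shows "real_of_int (3 * n) / 4 \<le> hyperbolicity crown.G"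
proof -
  obtain k where k: "n = 2 * k" using assms by (auto elim: evenE)
  define a where "a = nat k"
  have "n = 2 * int a" using n k unfolding a_def by simp
  then have len: "length (crown_rim n) = 6 * a + 2" unfolding length_crown_rim by linarith
  have h: "crown_height (crown_rim n ! (3 * i)) = nat (3 * n + 2)" if "3 * i < length (crown_rim n)" for i
    by (simp add: crown_rim_nth[OF that])
  have h0: "crown_height (crown_rim n ! 0) = nat (3 * n + 2)" using h[of 0] len by simp
  have h2: "crown_height (crown_rim n ! (6 * a)) = nat (3 * n + 2)" using h[of "2 * a"] len by simp
  have "real (3 * a) / 2 \<le> hyperbolicity crown.G"
    by (rule crown.hyperbolicity_double_ge[where \<phi> = "\<lambda>p. min (fst p) (crown_coord p)" and p = "crown_rim n"
          and a = "3 * a" and b = "6 * a"])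
      (use crown_rim_path crown_potential[OF n] n h0 h[of a] h2 len in auto)
  moreover have "real_of_int (3 * n) / 4 = real (3 * a) / 2" using k n unfolding a_def by simp
  ultimately show ?thesis by simp
qed

end

text \<open>
  Parents lead up a spoke to the apex, from there to the second rim vertex of the triangle, and back along
  the rim. The grandparent of an apex is the first rim vertex of its triangle.
\<close>

fun crown_parent :: "int \<Rightarrow> triple \<Rightarrow> triple" where
  "crown_parent n (x, j, t) =
    (if x = 0 then (0, 0, 0)
     else if x \<le> 3 * n then (x + 1, j, 0)
     else if x = 3 * n + 1 then (3 * n + 2, j, 1)
     else if 0 < t then (x, j, t - 1)
     else if 0 < j then (x, j - 1, 2) else (0, 0, 0))"

text \<open>
  The bag of a vertex consists of the vertex, its parent, its grandparent and the root; every triangle is an apex with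
  its parent and grandparent.
\<close>

lemma crown_tree_width:
  assumes n: "1 \<le> n"
  shows "tree_width (double (crown_verts n) (crown_adj n) (0, 0, 0)) \<le> 3"
proof -
  interpret crown: rooted_graph "crown_verts n" "crown_adj n" "(0, 0, 0)" crown_height
    using n by (rule crown_rooted)
  define rank :: "triple \<Rightarrow> nat"
    where "rank p = (if fst p = 0 then 0 else nat (1 + crown_coord p + 2 * (3 * n + 2 - fst p)))" for p
  define bag where "bag p = {p, crown_parent n p, crown_parent n (crown_parent n p), (0, 0, 0)}" for p
  have par: "crown_parent n p \<in> crown_verts n" if "p \<in> crown_verts n" for p
    using that n by (cases p; simp only: crown_verts_iff; elim conjE disjE; auto simp: crown_verts_iff)
  obtain T :: "nat ugraph" and bag' where T: "tree_decomposition crown.G T bag'" "decomposition_width T bag' \<le> 3"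
  proof (rule crown.tree_decomposition_double[of "crown_parent n" rank bag 3])
    fix t assume t: "t \<in> crown_verts n"
    have "card (bag t) \<le> 4"
      unfolding bag_def by (auto simp: card_insert_if)
    then show "t \<in> bag t \<and> bag t \<subseteq> crown_verts n \<and> card (bag t) \<le> 3 + 1"
      using t par crown.root unfolding bag_def by auto
    assume "t \<noteq> (0, 0, 0)"
    then have "rank (crown_parent n t) < rank t"
      using t n unfolding rank_def
      by (cases t; simp only: crown_verts_iff; elim conjE disjE; auto)
    then show "crown_parent n t \<in> crown_verts n \<and> rank (crown_parent n t) < rank t" using par[OF t] by simp
    show "bag t \<subseteq> insert t (bag (crown_parent n t))" unfolding bag_def by auto
  next
    show "bag (0, 0, 0) = {(0, 0, 0)}" unfolding bag_def by simp
  next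
    fix p q assume pq: "crown_adj n p q"
    have arc: "q \<in> {crown_parent n p, crown_parent n (crown_parent n p), (0, 0, 0)} \<or>
        p \<in> {crown_parent n q, crown_parent n (crown_parent n q), (0, 0, 0)}"
      if "crown_arc n p q" "p \<in> crown_verts n" "q \<in> crown_verts n" for p q
      using that n by (cases p; cases q; simp only: crown_verts_iff crown_arc.simps; elim conjE disjE; auto)
    have "p \<in> crown_verts n" "q \<in> crown_verts n" "crown_arc n p q \<or> crown_arc n q p"
      using pq unfolding crown_adj_def by auto
    then have "{p, q} \<subseteq> bag p \<or> {p, q} \<subseteq> bag q" using arc[of p q] arc[of q p] unfolding bag_def by auto
    then show "\<exists>t\<in>crown_verts n. {p, q} \<subseteq> bag t" using crown.E_V[OF pq] crown.E_V2[OF pq] by blast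
  qed
  then show ?thesis by (rule tree_width_le)
qed

lemma crown_properties:
  assumes "1 \<le> k"
  shows "\<exists>G :: nat ugraph. simple_graph G \<and> connected_graph G \<and>
        free_of theta G \<and> free_of prism G \<and> free_of wheel G \<and>
        planar G \<and> tree_width G \<le> 3 \<and>
        hyperbolicity G \<ge> real_of_int (\<lceil>real k / 2\<rceil> - 1) \<and>
        ipco G \<ge> k"
proof -
  define n where "n = 2 * int k"
  have n: "1 \<le> n" "even n" using assms unfolding n_def by auto
  interpret crown: rooted_graph "crown_verts n" "crown_adj n" "(0, 0, 0)" crown_height
    using n(1) by (rule crown_rooted)
  have "real_of_int (\<lceil>real k / 2\<rceil> - 1) \<le> real_of_int (3 * n) / 4" unfolding n_def by simp linarith
  then have "real_of_int (\<lceil>real k / 2\<rceil> - 1) \<le> hyperbolicity crown.G"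
    using crown_hyperbolic[OF n] by simp
  moreover have "k \<le> ipco crown.G" using crown_ipco[OF n(1)] unfolding n_def by simp
  ultimately show ?thesis
    using crown.simple_G crown.connected_G crown_tree_width[OF n(1)] crown_wheel_free[OF n(1)]
      crown_theta_free[OF n(1)] crown_prism_free[OF n(1)] crown_planar[OF n(1)]
    by (intro exI[of _ crown.G]) simp
qed

section \<open>Ladders\<close>

text \<open>
  The top \<open>x = 0\<close> of a ladder is a path from the root \<open>(0, -1, 1)\<close> through the triangles formed by \<open>(0, j, 0)\<close>,
  \<open>(0, j, 1)\<close> and the upper end \<open>(1, j, 0)\<close> of rung \<open>j\<close>. The lower end \<open>(3n, j, 0)\<close> of the rung forms a triangle
  with \<open>(3n+1, j, 0)\<close> and \<open>(3n+1, j, 1)\<close> on the bottom path. From one rung to the next it takes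
  two steps along the top and five along the bottom, where \<open>t\<close> runs from 0 to 4. So a
  geodesic from the root runs along the top first and goes down close to its target. The
  coordinate \<open>j = -1\<close> makes the edge from the root to \<open>(0, 0, 0)\<close> one of the regular edges of the top.
\<close>

definition ladder_verts :: "int \<Rightarrow> triple set" where
  "ladder_verts n = {(x, j, t). x = 0 \<and> (j = - 1 \<and> t = 1 \<or> 0 \<le> j \<and> j \<le> n \<and> 0 \<le> t \<and> t \<le> 1) \<or>
     1 \<le> x \<and> x \<le> 3 * n \<and> 0 \<le> j \<and> j \<le> n \<and> t = 0 \<or>
     x = 3 * n + 1 \<and> 0 \<le> j \<and> j \<le> n \<and> 0 \<le> t \<and> t \<le> 4 \<and> (j < n \<or> t \<le> 1)}"

fun ladder_arc :: "int \<Rightarrow> triple \<Rightarrow> triple \<Rightarrow> bool" where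
  "ladder_arc n (x, j, t) (x', j', t') \<longleftrightarrow>
     x' = x + 1 \<and> j' = j \<and> (t = 0 \<and> t' = 0 \<or> x = 0 \<and> t = 1 \<or> x = 3 * n \<and> t' = 1) \<or>
     x' = x \<and> x = 0 \<and> (j' = j \<and> t' = t + 1 \<or> j' = j + 1 \<and> t = 1 \<and> t' = 0) \<or>
     x' = x \<and> x = 3 * n + 1 \<and> (j' = j \<and> t' = t + 1 \<or> j' = j + 1 \<and> t = 4 \<and> t' = 0)"

definition ladder_adj :: "int \<Rightarrow> triple \<Rightarrow> triple \<Rightarrow> bool" where
  "ladder_adj n p q \<longleftrightarrow> p \<in> ladder_verts n \<and> q \<in> ladder_verts n \<and> (ladder_arc n p q \<or> ladder_arc n q p)"

lemma ladder_verts_iff: "(x, j, t) \<in> ladder_verts n \<longleftrightarrow>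
     x = 0 \<and> (j = - 1 \<and> t = 1 \<or> 0 \<le> j \<and> j \<le> n \<and> 0 \<le> t \<and> t \<le> 1) \<or>
     1 \<le> x \<and> x \<le> 3 * n \<and> 0 \<le> j \<and> j \<le> n \<and> t = 0 \<or>
     x = 3 * n + 1 \<and> 0 \<le> j \<and> j \<le> n \<and> 0 \<le> t \<and> t \<le> 4 \<and> (j < n \<or> t \<le> 1)"
  by (simp add: ladder_verts_def)

lemma ladder_adj_iff: "ladder_adj n (x, j, t) (x', j', t') \<longleftrightarrow>
    (x, j, t) \<in> ladder_verts n \<and> (x', j', t') \<in> ladder_verts n \<and>
    (ladder_arc n (x, j, t) (x', j', t') \<or> ladder_arc n (x', j', t') (x, j, t))"
  by (simp add: ladder_adj_def)

lemmas ladder_iff = ladder_adj_iff ladder_verts_iff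

text \<open>
  The vertices \<open>(3n+1, j, t)\<close> are reached by rung \<open>j\<close>, and for \<open>t = 4\<close> equally well by rung \<open>j + 1\<close>: these are
  the local maxima.
\<close>

fun ladder_height :: "triple \<Rightarrow> nat" where
  "ladder_height (x, j, t) = nat (2 * j + 1 + x + (if x = 0 then t else max 0 (t - 1)))"

fun ladder_coord :: "triple \<Rightarrow> int" where
  "ladder_coord (x, j, t) = 5 * j + t + 4"

text \<open>
  On the bottom this is the position along the bottom path. On the top it must
  grow like the position along the top, which is slower by 3 per rung; a rung of length at least \<open>3 * n\<close> makes up for
  the difference.
\<close>

fun ladder_potential :: "triple \<Rightarrow> int" where
  "ladder_potential (x, j, t) = (if j < 0 then 0 else min (5 * j + t + 1) (2 * j + t + 1 + x))"

lemma ladder_rooted: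
  assumes n: "1 \<le> n"
  shows "rooted_graph (ladder_verts n) (ladder_adj n) (0, - 1, 1) ladder_height"
proof
  have "ladder_verts n \<subseteq> {0..3 * n + 1} \<times> {- 1..n} \<times> {0..4}"
    using n by (auto simp: ladder_verts_def)
  then show "finite (ladder_verts n)" by (rule finite_subset) auto
  show "(0, - 1, 1) \<in> ladder_verts n" by (simp add: ladder_verts_def)
  fix p q
  show "ladder_adj n p q \<Longrightarrow> ladder_adj n q p" "ladder_adj n p q \<Longrightarrow> p \<in> ladder_verts n"
    by (auto simp: ladder_adj_def)
  show "\<not> ladder_adj n p p" by (cases p) (auto simp: ladder_adj_def)
  show "ladder_height (0, - 1, 1) = 0" by simp
  show "ladder_height q \<le> ladder_height p + 1" if "ladder_adj n p q"
  proof -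
    obtain x j t x' j' t' where pq: "p = (x, j, t)" "q = (x', j', t')" by (cases p; cases q)
    have "0 \<le> 2 * j + 1 + x + (if x = 0 then t else max 0 (t - 1))"
      "2 * j' + 1 + x' + (if x' = 0 then t' else max 0 (t' - 1)) \<le> 2 * j + 1 + x + (if x = 0 then t else max 0 (t - 1)) + 1"
      using that n unfolding pq by (simp_all add: ladder_iff max_def; smt (z3))+
    then show ?thesis unfolding pq ladder_height.simps by linarith
  qed
  show "\<exists>q. ladder_adj n p q \<and> ladder_height p = ladder_height q + 1" if "p \<in> ladder_verts n" "p \<noteq> (0, - 1, 1)"
  proof -
    obtain x j t where p: "p = (x, j, t)" by (cases p)
    define q :: triple where "q = (if x = 0 then if t = 1 then (0, j, 0) else (0, j - 1, 1)
      else if x \<le> 3 * n then (x - 1, j, 0) else if t \<le> 1 then (3 * n, j, 0) else (x, j, t - 1))"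
    have "ladder_adj n p q"
      using that n unfolding p q_def
      by (simp add: ladder_iff; smt (z3))
    moreover have "ladder_height p = ladder_height q + 1"
      using that n unfolding p q_def
      by (simp only: ladder_verts_iff; elim conjE disjE; auto)
    ultimately show ?thesis by blast
  qed
qed

context
  fixes n :: int
  assumes n: "1 \<le> n"
begin

interpretation ladder: rooted_graph "ladder_verts n" "ladder_adj n" "(0, - 1, 1)" ladder_height
  using n by (rule ladder_rooted)

lemma ladder_nbrs_root: "ladder_adj n (0, - 1, 1) q \<Longrightarrow> q = (0, 0, 0)"
  using n by (cases q; simp add: ladder_iff; smt (z3))

lemma ladder_nbrs_top_0: "ladder_adj n (0, j, 0) q \<Longrightarrow> q = (0, j - 1, 1) \<or> q = (0, j, 1) \<or> q = (1, j, 0)"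
  using n by (cases q; simp add: ladder_iff; smt (z3))

lemma ladder_nbrs_top_1: "ladder_adj n (0, j, 1) q \<Longrightarrow> 0 \<le> j \<Longrightarrow> q = (0, j + 1, 0) \<or> q = (0, j, 0) \<or> q = (1, j, 0)"
  using n by (cases q; simp add: ladder_iff; smt (z3))

lemma ladder_nbrs_upper: "ladder_adj n (1, j, 0) q \<Longrightarrow> q = (2, j, 0) \<or> q = (0, j, 0) \<or> q = (0, j, 1)"
  using n by (cases q; simp add: ladder_iff; smt (z3))

lemma ladder_nbrs_rung: "ladder_adj n (x, j, 0) q \<Longrightarrow> 2 \<le> x \<Longrightarrow> x < 3 * n \<Longrightarrow> q = (x - 1, j, 0) \<or> q = (x + 1, j, 0)"
  using n by (cases q; simp add: ladder_iff; smt (z3))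

lemma ladder_nbrs_lower: "ladder_adj n (3 * n, j, 0) q \<Longrightarrow>
    q = (3 * n - 1, j, 0) \<or> q = (3 * n + 1, j, 0) \<or> q = (3 * n + 1, j, 1)"
  using n by (cases q; simp add: ladder_iff; smt (z3))

lemma ladder_nbrs_bottom_0: "ladder_adj n (3 * n + 1, j, 0) q \<Longrightarrow>
    q = (3 * n + 1, j - 1, 4) \<or> q = (3 * n, j, 0) \<or> q = (3 * n + 1, j, 1)"
  using n by (cases q; simp add: ladder_iff; smt (z3))

lemma ladder_nbrs_bottom_1: "ladder_adj n (3 * n + 1, j, 1) q \<Longrightarrow>
    q = (3 * n + 1, j, 2) \<or> q = (3 * n, j, 0) \<or> q = (3 * n + 1, j, 0)"
  using n by (cases q; simp add: ladder_iff; smt (z3))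

lemma ladder_nbrs_bottom_mid: "ladder_adj n (3 * n + 1, j, t) q \<Longrightarrow> 2 \<le> t \<Longrightarrow>
    q = (3 * n + 1, j, t - 1) \<or> q = (if t = 4 then (3 * n + 1, j + 1, 0) else (3 * n + 1, j, t + 1))"
  using n by (cases q; simp add: ladder_iff split: if_splits; smt (z3))

lemma ladder_cases:
  assumes "p \<in> ladder_verts n"
  obtains "p = (0, - 1, 1)" | j where "p = (0, j, 0)" "0 \<le> j" "j \<le> n" | j where "p = (0, j, 1)" "0 \<le> j" "j \<le> n"
  | j where "p = (1, j, 0)" "0 \<le> j" "j \<le> n"
  | x j where "p = (x, j, 0)" "2 \<le> x" "x < 3 * n"
  | j where "p = (3 * n, j, 0)" "0 \<le> j" "j \<le> n"
  | j where "p = (3 * n + 1, j, 0)" "0 \<le> j" "j \<le> n" | j where "p = (3 * n + 1, j, 1)" "0 \<le> j" "j \<le> n"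
  | j t where "p = (3 * n + 1, j, t)" "2 \<le> t"
proof -
  obtain x j t where p: "p = (x, j, t)" by (cases p)
  consider "x = 0 \<and> j = - 1 \<and> t = 1" | "x = 0 \<and> t = 0 \<and> 0 \<le> j \<and> j \<le> n" | "x = 0 \<and> t = 1 \<and> 0 \<le> j \<and> j \<le> n"
    | "x = 1 \<and> t = 0 \<and> 0 \<le> j \<and> j \<le> n" | "2 \<le> x \<and> x < 3 * n \<and> t = 0" | "x = 3 * n \<and> t = 0 \<and> 0 \<le> j \<and> j \<le> n"
    | "x = 3 * n + 1 \<and> t = 0 \<and> 0 \<le> j \<and> j \<le> n" | "x = 3 * n + 1 \<and> t = 1 \<and> 0 \<le> j \<and> j \<le> n"
    | "x = 3 * n + 1 \<and> 2 \<le> t"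
    using assms n unfolding p ladder_verts_iff by (smt (z3))
  then show ?thesis
    by cases (use that p in simp_all)
qed

lemma ladder_triangles: "0 \<le> j \<Longrightarrow> j \<le> n \<Longrightarrow> ladder_adj n (0, j, 0) (0, j, 1) \<and>
   ladder_adj n (0, j, 0) (1, j, 0) \<and> ladder_adj n (0, j, 1) (1, j, 0) \<and>
   ladder_adj n (3 * n, j, 0) (3 * n + 1, j, 0) \<and>
   ladder_adj n (3 * n, j, 0) (3 * n + 1, j, 1) \<and> ladder_adj n (3 * n + 1, j, 0) (3 * n + 1, j, 1)"
  using n by (auto simp: ladder_iff)

lemma ladder_wheel_free: "free_of wheel ladder.G"
proof (rule ladder.wheel_free_double)
  fix u assume u: "ladder_adj n (0, - 1, 1) u"
  then have "u = (0, 0, 0)" by (rule ladder_nbrs_root)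
  then show "ladder.dull (0, - 1, 1) u"
    using ladder_nbrs_top_0[of 0] ladder_triangles[of 0] n
    by (intro ladder.dull_if_triangle[of "(0, 0, 1)" "(1, 0, 0)"]) auto
next
  fix w assume w: "w \<in> ladder_verts n" "w \<noteq> (0, - 1, 1)"
  show "\<exists>A B. \<forall>u. ladder_adj n w u \<longrightarrow> u = A \<or> u = B \<or>
      u \<noteq> (0, - 1, 1) \<and> ladder.dull w u \<or> u = (0, - 1, 1) \<and> (\<forall>y. ladder_adj n (0, - 1, 1) y \<longrightarrow> y = w)"
    using w(1)
  proof (cases rule: ladder_cases)
    case 1
    then show ?thesis using w by blast
  next
    case (2 j)
    have "u \<noteq> (0, - 1, 1) \<and> ladder.dull w u \<or> u = (0, - 1, 1) \<and> (\<forall>y. ladder_adj n (0, - 1, 1) y \<longrightarrow> y = w)"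
      if "u = (0, j - 1, 1)" for u
    proof (cases "j = 0")
      case True
      then show ?thesis using that ladder_nbrs_root 2 by auto
    next
      case False
      have "ladder.dull w u"
        using ladder_nbrs_top_1[of "j - 1"] ladder_triangles[of "j - 1"] that False 2
        by (intro ladder.dull_if_triangle[of "(0, j - 1, 0)" "(1, j - 1, 0)"]) auto
      then show ?thesis using that False by auto
    qed
    then show ?thesis using ladder_nbrs_top_0[of j] 2 by blast
  next
    case (3 j)
    have "u \<noteq> (0, - 1, 1) \<and> ladder.dull w u" if "ladder_adj n w u" "u = (0, j + 1, 0)" for u
    proof -
      have "j + 1 \<le> n" using ladder.E_V2[OF that(1)] 3 that(2) by (auto simp: ladder_verts_iff)
      then show ?thesis
        using ladder_nbrs_top_0[of "j + 1"] ladder_triangles[of "j + 1"] that 3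
        by (intro conjI ladder.dull_if_triangle[of "(0, j + 1, 1)" "(1, j + 1, 0)"]) auto
    qed
    then show ?thesis using ladder_nbrs_top_1[of j] 3 by blast
  next
    case (4 j)
    have "u \<noteq> (0, - 1, 1) \<and> ladder.dull w u" if "ladder_adj n w u" "u = (2, j, 0)" for u
      using ladder_nbrs_rung[of 2 j] n that(2)
      by (intro conjI ladder.dull_if_two_neighbours[OF that(1)]) auto
    then show ?thesis using ladder_nbrs_upper[of j] 4 by blast
  next
    case (5 x j)
    then show ?thesis using ladder_nbrs_rung[of x j] by blast
  next
    case (6 j)
    have "u \<noteq> (0, - 1, 1) \<and> ladder.dull w u" if "ladder_adj n w u" "u = (3 * n - 1, j, 0)" for u
      using ladder_nbrs_rung[of "3 * n - 1" j] n that(2)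
      by (intro conjI ladder.dull_if_two_neighbours[OF that(1)]) auto
    then show ?thesis using ladder_nbrs_lower[of j] 6 by blast
  next
    case (7 j)
    have "u \<noteq> (0, - 1, 1) \<and> ladder.dull w u" if "ladder_adj n w u" "u = (3 * n + 1, j - 1, 4)" for u
      using ladder_nbrs_bottom_mid[of "j - 1" 4] n that(2)
      by (intro conjI ladder.dull_if_two_neighbours[OF that(1)]) auto
    then show ?thesis using ladder_nbrs_bottom_0[of j] 7 by blast
  next
    case (8 j)
    have "u \<noteq> (0, - 1, 1) \<and> ladder.dull w u" if "ladder_adj n w u" "u = (3 * n + 1, j, 2)" for u
      using ladder_nbrs_bottom_mid[of j 2] n that(2)
      by (intro conjI ladder.dull_if_two_neighbours[OF that(1)]) auto
    then show ?thesis using ladder_nbrs_bottom_1[of j] 8 by blast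
  next
    case (9 j t)
    then show ?thesis using ladder_nbrs_bottom_mid[of j t] by blast
  qed
qed

text \<open>
  Every vertex except the root has degree at most 2, or has two neighbours in a common triangle and at most one further
  neighbour.
\<close>

lemma ladder_claw_free: "\<not> claw_at ladder.G m"
proof
  assume claw: "claw_at ladder.G m"
  have "\<not> ladder.claw_centre a" if a: "a \<in> ladder_verts n" "a \<noteq> (0, - 1, 1)" for a
    using a(1)
  proof (cases rule: ladder_cases)
    case 1
    then show ?thesis using a by blast
  next
    case (2 j)
    then show ?thesis using ladder_nbrs_top_0[of j] ladder_triangles[of j]
      by (intro ladder.no_claw_triangle[of "(0, j, 1)" "(1, j, 0)" _ "(0, j - 1, 1)"]) auto
  next
    case (3 j)
    then show ?thesis using ladder_nbrs_top_1[of j] ladder_triangles[of j]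
      by (intro ladder.no_claw_triangle[of "(0, j, 0)" "(1, j, 0)" _ "(0, j + 1, 0)"]) auto
  next
    case (4 j)
    then show ?thesis using ladder_nbrs_upper[of j] ladder_triangles[of j]
      by (intro ladder.no_claw_triangle[of "(0, j, 0)" "(0, j, 1)" _ "(2, j, 0)"]) auto
  next
    case (5 x j)
    then show ?thesis using ladder_nbrs_rung[of x j] by (intro ladder.no_claw_two_neighbours) auto
  next
    case (6 j)
    then show ?thesis using ladder_nbrs_lower[of j] ladder_triangles[of j]
      by (intro ladder.no_claw_triangle[of "(3 * n + 1, j, 0)" "(3 * n + 1, j, 1)" _ "(3 * n - 1, j, 0)"]) auto
  next
    case (7 j)
    then show ?thesis using ladder_nbrs_bottom_0[of j] ladder_triangles[of j]
      by (intro ladder.no_claw_triangle[of "(3 * n, j, 0)" "(3 * n + 1, j, 1)" _ "(3 * n + 1, j - 1, 4)"]) auto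
  next
    case (8 j)
    then show ?thesis using ladder_nbrs_bottom_1[of j] ladder_triangles[of j]
      by (intro ladder.no_claw_triangle[of "(3 * n, j, 0)" "(3 * n + 1, j, 0)" _ "(3 * n + 1, j, 2)"]) auto
  next
    case (9 j t)
    then show ?thesis using ladder_nbrs_bottom_mid[of j t] by (intro ladder.no_claw_two_neighbours) blast
  qed
  then have "m = ladder.cp True (0, - 1, 1)" using ladder.claw_only_at_root claw by blast
  then show False using claw ladder.no_claw_at_pendant_root ladder_nbrs_root by blast
qed

lemma ladder_planar: "planar ladder.G"
proof (rule ladder.planar_double[where px = fst and py = ladder_coord])
  have up: "fst (snd u) = fst (snd v) \<and> 0 \<le> snd (snd u) \<and> snd (snd u) \<le> 1 \<and>
      (snd (snd v) = 0 \<or> snd (snd u) = 0 \<and> snd (snd v) = 1 \<and> fst u = 3 * n)"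
    if "ladder_adj n u v" "fst v = fst u + 1" for u v
    using that n by (cases u; cases v; simp add: ladder_iff; smt (z3))
  show "ladder_coord v \<le> ladder_coord v'"
    if "ladder_adj n u v" "ladder_adj n u' v'" "fst v = fst u + 1" "fst u' = fst u" "fst v' = fst v"
      "ladder_coord u < ladder_coord u'" for u v u' v'
    using up[OF that(1)] up[OF that(2)] that(3-6) n ladder.E_V[OF that(2)]
    by (cases u; cases v; cases u'; cases v'; simp add: ladder_verts_iff; smt (z3))
  show "fst v = fst u + 1" if "ladder_adj n u v" "fst u < fst v" for u v
    using that by (cases u; cases v) (auto simp: ladder_adj_iff)
  show False if "ladder_adj n u v" "fst u = fst v" "w \<in> ladder_verts n" "fst w = fst u"
    "ladder_coord u < ladder_coord w" "ladder_coord w < ladder_coord v" for u v w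
    using that n by (cases u; cases v; cases w; simp add: ladder_iff; smt (z3))
  show "u = v" if "u \<in> ladder_verts n" "v \<in> ladder_verts n" "fst u = fst v" "ladder_coord u = ladder_coord v" for u v
    using that n by (cases u; cases v; simp add: ladder_verts_iff; smt (z3))
qed (use n in \<open>auto simp: ladder_verts_def\<close>)

lemma ladder_potential_step:
  assumes "ladder_adj n p q"
  shows "ladder_potential q \<le> ladder_potential p + 1"
  using assms n by (cases p; cases q; simp add: ladder_iff min_def; smt (z3))

end

definition ladder_rim :: "int \<Rightarrow> triple list" where
  "ladder_rim n = map (\<lambda>i. (3 * n + 1, int (i div 5), int (i mod 5))) [0..<nat (5 * n) + 2]"

context
  fixes n :: int
  assumes n: "1 \<le> n"
begin

interpretation ladder: rooted_graph "ladder_verts n" "ladder_adj n" "(0, - 1, 1)" ladder_height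
  using n by (rule ladder_rooted)

lemma ladder_rim_nth: "i < length (ladder_rim n) \<Longrightarrow> ladder_rim n ! i = (3 * n + 1, int (i div 5), int (i mod 5))"
  and length_ladder_rim: "length (ladder_rim n) = nat (5 * n) + 2"
  by (simp_all add: ladder_rim_def del: upt_Suc)

lemma ladder_rim_bounds:
  assumes i: "i < length (ladder_rim n)"
  shows "5 * int (i div 5) + int (i mod 5) = int i" "int (i mod 5) \<le> 4"
    "int (i div 5) \<le> n" "int (i div 5) < n \<or> int (i mod 5) \<le> 1"
proof -
  show *: "5 * int (i div 5) + int (i mod 5) = int i" "int (i mod 5) \<le> 4" by presburger+
  moreover have "int i \<le> 5 * n + 1" using i n unfolding length_ladder_rim by linarith
  ultimately show "int (i div 5) \<le> n" "int (i div 5) < n \<or> int (i mod 5) \<le> 1" by linarith+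
qed

lemma ladder_rim_in: "i < length (ladder_rim n) \<Longrightarrow> ladder_rim n ! i \<in> ladder_verts n"
  using ladder_rim_bounds[of i] by (simp add: ladder_rim_nth ladder_verts_iff)

lemma ladder_rim_path:
  shows "ladder_rim n \<noteq> []" "set (ladder_rim n) \<subseteq> ladder_verts n"
    "\<And>i. Suc i < length (ladder_rim n) \<Longrightarrow> ladder_adj n (ladder_rim n ! i) (ladder_rim n ! Suc i)"
    "\<And>i. i < length (ladder_rim n) \<Longrightarrow>
      ladder_potential (ladder_rim n ! i) = ladder_potential (hd (ladder_rim n)) + int i"
proof -
  show ne: "ladder_rim n \<noteq> []" using length_ladder_rim by auto
  show "set (ladder_rim n) \<subseteq> ladder_verts n" using ladder_rim_in by (metis in_set_conv_nth subsetI)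
  show "ladder_adj n (ladder_rim n ! i) (ladder_rim n ! Suc i)" if "Suc i < length (ladder_rim n)" for i
  proof -
    have "int (Suc i div 5) = int (i div 5) \<and> int (Suc i mod 5) = int (i mod 5) + 1 \<or>
        int (Suc i div 5) = int (i div 5) + 1 \<and> int (i mod 5) = 4 \<and> int (Suc i mod 5) = 0"
      by (auto simp: div_Suc mod_Suc)
    then have "ladder_arc n (ladder_rim n ! i) (ladder_rim n ! Suc i)"
      using that by (auto simp: ladder_rim_nth)
    then show ?thesis
      unfolding ladder_adj_def using ladder_rim_in[of i] ladder_rim_in[OF that] that by simp
  qed
  have c: "ladder_potential (ladder_rim n ! i) = int i + 1" if i: "i < length (ladder_rim n)" for i
    using ladder_rim_bounds[OF i] by (simp add: ladder_rim_nth[OF i])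
  show "ladder_potential (ladder_rim n ! i) = ladder_potential (hd (ladder_rim n)) + int i"
    if "i < length (ladder_rim n)" for i
    using c[OF that] c[of 0] ne by (simp add: hd_conv_nth)
qed

lemma ladder_ipco: "nat n \<le> ipco ladder.G"
proof (rule ladder.ipco_double_ge[where \<phi> = ladder_potential and p = "ladder_rim n"
      and M = "(\<lambda>j. (3 * n + 1, j, 4)) ` {0..<n}"])
  show "(\<lambda>j. (3 * n + 1, j, 4)) ` {0..<n} \<subseteq> set (ladder_rim n)"
  proof safe
    fix j assume j: "j \<in> {0..<n}"
    define i where "i = 5 * nat j + 4"
    have "i mod 5 = 4" "i div 5 = nat j" unfolding i_def by presburger+
    then have i: "i < length (ladder_rim n)" "int (i div 5) = j" "int (i mod 5) = 4"
      using j unfolding i_def length_ladder_rim by auto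
    then show "(3 * n + 1, j, 4) \<in> set (ladder_rim n)" using nth_mem[OF i(1)] ladder_rim_nth[OF i(1)] by simp
  qed
  show "nat n \<le> card ((\<lambda>j. (3 * n + 1, j, 4)) ` {0..<n})" by (simp add: card_image inj_on_def)
  show "ladder_height q \<le> ladder_height p"
    if pq: "p \<in> (\<lambda>j. (3 * n + 1, j, 4)) ` {0..<n}" "ladder_adj n p q" for p q
  proof -
    obtain j where p: "p = (3 * n + 1, j, 4)" using pq(1) by auto
    have "q = (3 * n + 1, j, 3) \<or> q = (3 * n + 1, j + 1, 0)"
      using ladder_nbrs_bottom_mid[OF n, of j 4 q] pq(2) p by simp
    then show ?thesis using p n by auto
  qed
qed (use ladder_rim_path ladder_potential_step[OF n] n in auto)

text \<open>
  The height of the rim grows by 2 from rung to rung, much less than the length 5 of the rim between them,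
  so the middle of the rim still witnesses the gap.
\<close>

lemma ladder_hyperbolic:
  assumes "even n"
  shows "real_of_int (3 * n) / 4 \<le> hyperbolicity ladder.G"
proof -
  obtain k where k: "n = 2 * k" using assms by (auto elim: evenE)
  define a where "a = nat k"
  have na: "n = 2 * int a" using n k unfolding a_def by simp
  then have len: "length (ladder_rim n) = 10 * a + 2" unfolding length_ladder_rim by linarith
  have h: "ladder_height (ladder_rim n ! (5 * i)) = 2 * i + 6 * a + 2" if "5 * i < length (ladder_rim n)" for i
    unfolding ladder_rim_nth[OF that] using na by (simp add: nat_eq_iff)
  have h0: "ladder_height (ladder_rim n ! 0) = 6 * a + 2" using h[of 0] len by simp
  have h2: "ladder_height (ladder_rim n ! (10 * a)) = 10 * a + 2" using h[of "2 * a"] len by simp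
  have "real (3 * a) / 2 \<le> hyperbolicity ladder.G"
    by (rule ladder.hyperbolicity_double_ge[where \<phi> = ladder_potential and p = "ladder_rim n"
          and a = "5 * a" and b = "10 * a"])
      (use ladder_rim_path ladder_potential_step[OF n] h0 h[of a] h2 len in auto)
  moreover have "real_of_int (3 * n) / 4 = real (3 * a) / 2" using na by simp
  ultimately show ?thesis by simp
qed

end

lemma ladder_properties:
  assumes "1 \<le> k"
  shows "\<exists>G :: nat ugraph. simple_graph G \<and> connected_graph G \<and>
        free_of theta G \<and> free_of pyramid G \<and> free_of wheel G \<and>
        planar G \<and>
        hyperbolicity G \<ge> real_of_int (\<lceil>real k / 2\<rceil> - 1) \<and>
        ipco G \<ge> k"
proof -
  define n where "n = 2 * int k"
  have n: "1 \<le> n" "even n" using assms unfolding n_def by auto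
  interpret ladder: rooted_graph "ladder_verts n" "ladder_adj n" "(0, - 1, 1)" ladder_height
    using n(1) by (rule ladder_rooted)
  have "real_of_int (\<lceil>real k / 2\<rceil> - 1) \<le> real_of_int (3 * n) / 4" unfolding n_def by simp linarith
  then have "real_of_int (\<lceil>real k / 2\<rceil> - 1) \<le> hyperbolicity ladder.G"
    using ladder_hyperbolic[OF n] by simp
  moreover have "k \<le> ipco ladder.G" using ladder_ipco[OF n(1)] unfolding n_def by simp
  moreover have "free_of theta ladder.G" "free_of pyramid ladder.G"
    using theta_free_if_one_claw[of ladder.G] pyramid_free_if_claw_free[of ladder.G] ladder_claw_free[OF n(1)]
    by blast+
  ultimately show ?thesis
    using ladder.simple_G ladder.connected_G ladder_wheel_free[OF n(1)] ladder_planar[OF n(1)]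
    by (intro exI[of _ ladder.G]) simp
qed

theorem theorem4:
  "\<exists>C :: real. \<forall>k :: nat. k \<ge> 1 \<longrightarrow>
     (\<exists>G :: nat ugraph. simple_graph G \<and> connected_graph G \<and>
        free_of pyramid G \<and> free_of prism G \<and> free_of wheel G \<and>
        tree_width G = 2 \<and>
        hyperbolicity G \<ge> real_of_int (\<lceil>real k / 2\<rceil> - 1) \<and>
        ipco G \<ge> k) \<and>
     (\<exists>G :: nat ugraph. simple_graph G \<and> connected_graph G \<and>
        free_of theta G \<and> free_of prism G \<and> free_of wheel G \<and>
        planar G \<and> tree_width G \<le> 3 \<and>
        hyperbolicity G \<ge> real_of_int (\<lceil>real k / 2\<rceil> - 1) \<and>
        ipco G \<ge> k) \<and>
     (\<exists>G :: nat ugraph. simple_graph G \<and> connected_graph G \<and>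
        free_of theta G \<and> free_of pyramid G \<and> free_of wheel G \<and>
        planar G \<and>
        hyperbolicity G \<ge> real_of_int (\<lceil>real k / 2\<rceil> - 1) \<and>
        ipco G \<ge> k) \<and>
     (\<exists>G :: nat ugraph. simple_graph G \<and> connected_graph G \<and>
        free_of prism G \<and> free_of pyramid G \<and> free_of wheel G \<and>
        planar G \<and> bipartite G \<and>
        real (card (verts G)) \<le> C * real k ^ 2 \<and>
        (\<exists>P. isometric_path_cover G P \<and> card P = 3 * k + 1) \<and>
        (\<forall>v\<in>verts G. \<forall>P. rooted_isometric_path_cover G v P \<longrightarrow> card P \<ge> k ^ 2))"
  using fan_properties crown_properties ladder_properties tall_fan_properties
  by (intro exI[of _ 20] allI impI conjI) blast+

end
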